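(* Let $n\ge 3$, let $T$ be an arbitrary triangulation of a convex $n$-gon, and let $Q=Q_T$ be the (reduced) quiver of the GL$_2$-dimer of $T$, with dimer algebra $\Lambda_Q$ and boundary algebra $\mathcal B_Q=e_b\Lambda_Qe_b$. Then $$\mathcal B_Q\;\cong\;\mathbb{C}\Gamma(n)/I,$$ where $I$ is the ideal generated by the relations, for $i=1,\dots,n$ (indices modulo $2n$), $$x_{2i+1}x_{2i+2}z_{2i+2}=z_{2i}x_{2i-1}x_{2i},\qquad z_{2i}z_{2i-2}=x_{2i+1}x_{2i+2}\cdots x_{2i+2(n-2)}$$ (the right-hand side of the second relation is the path of $2n-4$ consecutive arrows $x$ from $2i$ to $2i-4$), and the isomorphism sends each $x_k$ to the boundary arrow $k-1\to k$ of $Q$. Moreover the element $$t:=\sum_{i=1}^{n}x_{2i-1}x_{2i}z_{2i}+\sum_{i=1}^{n}x_{2i}z_{2i}x_{2i-1}$$ is central in $\mathcal B_Q$.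
   Context: Paths are composed from left to right: for arrows $a:i\to j$, $b:j\to k$, $ab$ denotes the path $i\to j\to k$. A dimer model with boundary is a finite quiver without loops together with a set of faces $Q_2=Q_2^+\sqcup Q_2^-$, each face having an oriented cycle as its boundary, such that every arrow lies in exactly one face (boundary arrow) or exactly two faces (internal arrow), each internal arrow lying in one face of $Q_2^+$ and one of $Q_2^-$, and the incidence graph at each vertex is connected. Its dimer algebra is $\Lambda_Q=\mathbb{C}Q/\langle\partial W\rangle$, where $W=\sum_{F\in Q_2^+}\partial F-\sum_{F\in Q_2^-}\partial F$ and $\partial W$ consists of the relations $p_1\cdots p_k=q_1\cdots q_l$, one for each internal arrow $\alpha$ lying on the positive face boundary $\alpha p_1\cdots p_k$ and the negative face boundary $\alpha q_1\cdots q_l$. Boundary vertices are those incident with a boundary arrow; $e_b$ is the sum of the trivial paths at the boundary vertices, and the boundary algebra is $\mathcal B_Q=e_b\Lambda_Qe_b$. GL$_m$-dimer and its quiver: let $m\ge2$, $n\ge 3$, and let $T$ be a triangulation of a convex $n$-gon $P$ with vertices $v_1,\dots,v_n$ in anticlockwise order. Subdivide every triangle of $T$ by $m-1$ equidistant lines parallel to each of its sides into $m^2$ small triangles (upward ones, i.e. translates of the big triangle, and downward ones). Put a black node at the midpoint of each of the $m$ segments into which each side of each triangle (edge of $P$ or diagonal of $T$) is cut, a black node in every downward small triangle, and a white node in every upward small triangle. Join two nodes of different colour if they belong to the same small triangle or their small triangles share a side. This bipartite graph $G$ is the GL$_m$-dimer of $T$. Its quiver has one vertex for each connected component of $P\setminus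 G$ and, for each edge of $G$, one arrow between the two components it separates, oriented so that the white endpoint lies to its left; each white node gives an anticlockwise face (in $Q_2^+$) and each black node of degree $\ge2$ a clockwise face (in $Q_2^-$). This is a dimer model with boundary. Every 2-cycle of internal arrows is removed using the relations from the potential (on $G$: a bivalent black node is deleted and its two white neighbours are merged); $Q_T$ denotes the resulting reduced quiver and $\Lambda_{Q_T}$ its dimer algebra. $Q_T$ has $mn$ boundary vertices, labelled $1,\dots,mn$ anticlockwise so that vertex $(j-1)m+1$ is the component at the corner $v_j$ (and $(j-1)m+2,\dots,jm$ are the components meeting the interior of the edge $v_jv_{j+1}$); the boundary arrows are $x_k:k-1\to k$, indices modulo $mn$. The quiver $\Gamma(n)$: vertices $1,\dots,2n$; arrows $x_k:k-1\to k$ for $k=1,\dots,2n$ and $z_{2k}:2k\to 2k-2$ for $k=1,\dots,n$ (indices modulo $2n$, taken in $[1,2n]$). *)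

theory Defs
  imports Complex_Main "HOL-Algebra.QuotRing"
begin

record ('v, 'a) quiver =
  verts :: "'v set"
  arrs  :: "'a set"
  src   :: "'a \<Rightarrow> 'v"
  tgt   :: "'a \<Rightarrow> 'v"

text \<open>Paths are composed from left to right. A path is a pair (start vertex, list of arrows);
  the trivial path at v is (v, []).\<close>

fun chain :: "('a \<Rightarrow> 'v) \<Rightarrow> ('a \<Rightarrow> 'v) \<Rightarrow> 'a list \<Rightarrow> bool" where
  "chain s t [] = True"
| "chain s t [a] = True"
| "chain s t (a # b # r) = (t a = s b \<and> chain s t (b # r))"

definition is_path :: "('v, 'a, 'm) quiver_scheme \<Rightarrow> 'v \<times> 'a list \<Rightarrow> bool" where
  "is_path Q p \<longleftrightarrow> fst p \<in> verts Q \<and> set (snd p) \<subseteq> arrs Q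
     \<and> (snd p \<noteq> [] \<longrightarrow> src Q (hd (snd p)) = fst p) \<and> chain (src Q) (tgt Q) (snd p)"

definition pend :: "('v, 'a, 'm) quiver_scheme \<Rightarrow> 'v \<times> 'a list \<Rightarrow> 'v" where
  "pend Q p = (if snd p = [] then fst p else tgt Q (last (snd p)))"

definition path_alg :: "('v, 'a, 'm) quiver_scheme \<Rightarrow> ('v \<times> 'a list \<Rightarrow> complex) ring" where
  "path_alg Q =
    \<lparr> carrier = {f. finite {p. f p \<noteq> 0} \<and> (\<forall>p. f p \<noteq> 0 \<longrightarrow> is_path Q p)},
      monoid.mult = (\<lambda>f g p. \<Sum>qr\<in>{(q, r). f q \<noteq> 0 \<and> g r \<noteq> 0 \<and> pend Q q = fst r
                                        \<and> p = (fst q, snd q @ snd r)}. f (fst qr) * g (snd qr)),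
      one = (\<lambda>p. if snd p = [] \<and> fst p \<in> verts Q then 1 else 0),
      zero = (\<lambda>p. 0),
      add = (\<lambda>f g p. f p + g p) \<rparr>"

definition bpath :: "'v \<times> 'a list \<Rightarrow> ('v \<times> 'a list \<Rightarrow> complex)" where
  "bpath p = (\<lambda>q. if q = p then 1 else 0)"

definition arel :: "('v, 'a, 'm) quiver_scheme \<Rightarrow> 'a list \<Rightarrow> ('v \<times> 'a list \<Rightarrow> complex)" where
  "arel Q as = bpath (src Q (hd as), as)"

definition pscal :: "('v, 'a, 'm) quiver_scheme \<Rightarrow> complex \<Rightarrow> ('v \<times> 'a list \<Rightarrow> complex)" where
  "pscal Q c = (\<lambda>p. c * one (path_alg Q) p)"

definition quot_alg :: "('v, 'a, 'm) quiver_scheme \<Rightarrow> ('v \<times> 'a list \<Rightarrow> complex) set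
    \<Rightarrow> ('v \<times> 'a list \<Rightarrow> complex) set ring" where
  "quot_alg Q R = FactRing (path_alg Q) (genideal (path_alg Q) R)"

definition cls :: "('v, 'a, 'm) quiver_scheme \<Rightarrow> ('v \<times> 'a list \<Rightarrow> complex) set
    \<Rightarrow> ('v \<times> 'a list \<Rightarrow> complex) \<Rightarrow> ('v \<times> 'a list \<Rightarrow> complex) set" where
  "cls Q R f = a_r_coset (path_alg Q) (genideal (path_alg Q) R) f"

text \<open>Faces are given by the list of arrows of their boundary cycle.\<close>

record ('v, 'a) dimer = "('v, 'a) quiver" +
  posf :: "'a list set"
  negf :: "'a list set"

definition faces_of :: "('v, 'a, 'm) dimer_scheme \<Rightarrow> 'a \<Rightarrow> 'a list set" where
  "faces_of D a = {F \<in> posf D \<union> negf D. a \<in> set F}"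

definition bdry_arrow :: "('v, 'a, 'm) dimer_scheme \<Rightarrow> 'a \<Rightarrow> bool" where
  "bdry_arrow D a \<longleftrightarrow> a \<in> arrs D \<and> card (faces_of D a) = 1"

definition internal_arrow :: "('v, 'a, 'm) dimer_scheme \<Rightarrow> 'a \<Rightarrow> bool" where
  "internal_arrow D a \<longleftrightarrow> a \<in> arrs D \<and> card (faces_of D a) = 2
     \<and> card {F \<in> posf D. a \<in> set F} = 1 \<and> card {F \<in> negf D. a \<in> set F} = 1"

definition bverts :: "('v, 'a, 'm) dimer_scheme \<Rightarrow> 'v set" where
  "bverts D = {v. \<exists>a. bdry_arrow D a \<and> (src D a = v \<or> tgt D a = v)}"

definition face_rest :: "'a list \<Rightarrow> 'a \<Rightarrow> 'a list" where
  "face_rest F a = tl (rotate (LEAST i. i < length F \<and> F ! i = a) F)"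

definition dimer_rels :: "('v, 'a, 'm) dimer_scheme \<Rightarrow> ('v \<times> 'a list \<Rightarrow> complex) set" where
  "dimer_rels D = {(\<lambda>q. bpath (tgt D a, face_rest F a) q - bpath (tgt D a, face_rest G a) q) | a F G.
       internal_arrow D a \<and> F \<in> posf D \<and> G \<in> negf D \<and> a \<in> set F \<and> a \<in> set G}"

definition dimer_alg :: "('v, 'a, 'm) dimer_scheme \<Rightarrow> ('v \<times> 'a list \<Rightarrow> complex) set ring" where
  "dimer_alg D = quot_alg D (dimer_rels D)"

definition dcls :: "('v, 'a, 'm) dimer_scheme \<Rightarrow> ('v \<times> 'a list \<Rightarrow> complex) \<Rightarrow> ('v \<times> 'a list \<Rightarrow> complex) set" where
  "dcls D f = cls D (dimer_rels D) f"

definition e_b :: "('v, 'a, 'm) dimer_scheme \<Rightarrow> ('v \<times> 'a list \<Rightarrow> complex) set" where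
  "e_b D = dcls D (\<lambda>p. if snd p = [] \<and> fst p \<in> bverts D then 1 else 0)"

definition corner :: "('x, 'm) ring_scheme \<Rightarrow> 'x \<Rightarrow> 'x ring" where
  "corner R e = \<lparr> carrier = {e \<otimes>\<^bsub>R\<^esub> a \<otimes>\<^bsub>R\<^esub> e | a. a \<in> carrier R},
                  monoid.mult = monoid.mult R, one = e, zero = zero R, add = add R \<rparr>"

definition bdry_alg :: "('v, 'a, 'm) dimer_scheme \<Rightarrow> ('v \<times> 'a list \<Rightarrow> complex) set ring" where
  "bdry_alg D = corner (dimer_alg D) (e_b D)"

section \<open>Triangulations of a convex n-gon (vertices 1..n anticlockwise)\<close>

definition poly_edge :: "nat \<Rightarrow> nat \<Rightarrow> nat \<Rightarrow> bool" where
  "poly_edge n i j \<longleftrightarrow> i \<in> {1..n} \<and> j \<in> {1..n} \<and> (j = i mod n + 1 \<or> i = j mod n + 1)"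

definition is_diag :: "nat \<Rightarrow> nat set \<Rightarrow> bool" where
  "is_diag n d \<longleftrightarrow> (\<exists>i j. d = {i, j} \<and> i \<in> {1..n} \<and> j \<in> {1..n} \<and> i \<noteq> j \<and> \<not> poly_edge n i j)"

definition crosses :: "nat set \<Rightarrow> nat set \<Rightarrow> bool" where
  "crosses d e \<longleftrightarrow> (\<exists>a b c f. ((d = {a, b} \<and> e = {c, f}) \<or> (e = {a, b} \<and> d = {c, f}))
                               \<and> a < c \<and> c < b \<and> b < f)"

definition triangulation :: "nat \<Rightarrow> nat set set \<Rightarrow> bool" where
  "triangulation n T \<longleftrightarrow> (\<forall>d\<in>T. is_diag n d) \<and> (\<forall>d\<in>T. \<forall>e\<in>T. \<not> crosses d e)
     \<and> (\<forall>d. is_diag n d \<and> d \<notin> T \<longrightarrow> (\<exists>e\<in>T. crosses d e))"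

definition adj :: "nat \<Rightarrow> nat set set \<Rightarrow> nat \<Rightarrow> nat \<Rightarrow> bool" where
  "adj n T i j \<longleftrightarrow> poly_edge n i j \<or> {i, j} \<in> T"

definition is_triangle :: "nat \<Rightarrow> nat set set \<Rightarrow> nat \<Rightarrow> nat \<Rightarrow> nat \<Rightarrow> bool" where
  "is_triangle n T a b c \<longleftrightarrow> 1 \<le> a \<and> a < b \<and> b < c \<and> c \<le> n
     \<and> adj n T a b \<and> adj n T b c \<and> adj n T a c"

text \<open>Vertices: Bnd k (k = 1..2n) are the boundary vertices, Bnd (2j-1) the region at the
  corner v_j and Bnd (2j) the region at the midpoint of the edge v_j v_(j+1);
  Dg i j (i<j, {i,j} a diagonal of T) is the region at the midpoint of that diagonal.
  Arrows: X k is the boundary arrow k-1 -> k; Ar A B C (A,B,C the corners of a triangle of T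
  in anticlockwise cyclic order) is the arrow dual to the edge joining the white node at
  corner A to the black node of the central downward small triangle; it goes from the region
  at the midpoint of AB to the region at the midpoint of CA.\<close>

datatype qv = Bnd nat | Dg nat nat
datatype qa = X nat | Ar nat nat nat

definition side :: "nat \<Rightarrow> nat \<Rightarrow> nat \<Rightarrow> qv" where
  "side n i j = (if j = i mod n + 1 then Bnd (2 * i)
                 else if i = j mod n + 1 then Bnd (2 * j) else Dg (min i j) (max i j))"

definition nbrs :: "nat \<Rightarrow> nat set set \<Rightarrow> nat \<Rightarrow> nat list" where
  "nbrs n T j = map (\<lambda>d. (j + d - 1) mod n + 1)
                   (filter (\<lambda>d. adj n T j ((j + d - 1) mod n + 1)) [1..<n])"

definition white_face :: "nat \<Rightarrow> nat set set \<Rightarrow> nat \<Rightarrow> qa list" where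
  "white_face n T j = (let u = nbrs n T j in
      [X (2 * j)] @ map (\<lambda>i. Ar j (u ! i) (u ! Suc i)) [0..<length u - 1] @ [X (2 * j - 1)])"

definition QT :: "nat \<Rightarrow> nat set set \<Rightarrow> (qv, qa) dimer" where
  "QT n T = \<lparr> verts = Bnd ` {1..2 * n} \<union> {Dg i j | i j. i < j \<and> {i, j} \<in> T},
     arrs = X ` {1..2 * n} \<union> {Ar a b c | a b c. is_triangle n T a b c}
              \<union> {Ar c a b | a b c. is_triangle n T a b c} \<union> {Ar b c a | a b c. is_triangle n T a b c},
     src = (\<lambda>x. case x of X k \<Rightarrow> Bnd (if k = 1 then 2 * n else k - 1) | Ar A B C \<Rightarrow> side n A B),
     tgt = (\<lambda>x. case x of X k \<Rightarrow> Bnd k | Ar A B C \<Rightarrow> side n C A),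
     posf = white_face n T ` {1..n},
     negf = {[Ar a b c, Ar c a b, Ar b c a] | a b c. is_triangle n T a b c} \<rparr>"

datatype ga = GX nat | GZ nat

definition rd :: "nat \<Rightarrow> int \<Rightarrow> nat" where
  "rd n k = nat ((k - 1) mod (2 * int n) + 1)"

definition Gamma :: "nat \<Rightarrow> (nat, ga) quiver" where
  "Gamma n = \<lparr> verts = {1..2 * n},
     arrs = GX ` {1..2 * n} \<union> GZ ` {k \<in> {1..2 * n}. even k},
     src = (\<lambda>x. case x of GX k \<Rightarrow> rd n (int k - 1) | GZ k \<Rightarrow> k),
     tgt = (\<lambda>x. case x of GX k \<Rightarrow> k | GZ k \<Rightarrow> rd n (int k - 2)) \<rparr>"

definition Gamma_rels :: "nat \<Rightarrow> (nat \<times> ga list \<Rightarrow> complex) set" where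
  "Gamma_rels n =
     (\<lambda>i. (\<lambda>q. arel (Gamma n) [GX (rd n (2 * int i + 1)), GX (rd n (2 * int i + 2)), GZ (rd n (2 * int i + 2))] q
              - arel (Gamma n) [GZ (2 * i), GX (rd n (2 * int i - 1)), GX (2 * i)] q)) ` {1..n}
   \<union> (\<lambda>i. (\<lambda>q. arel (Gamma n) [GZ (2 * i), GZ (rd n (2 * int i - 2))] q
              - arel (Gamma n) (map (\<lambda>l. GX (rd n (2 * int i + 1 + int l))) [0..<2 * n - 4]) q)) ` {1..n}"

definition t_elem :: "nat \<Rightarrow> (nat \<times> ga list \<Rightarrow> complex)" where
  "t_elem n = (\<lambda>q. (\<Sum>i\<in>{1..n}. arel (Gamma n) [GX (rd n (2 * int i - 1)), GX (2 * i), GZ (2 * i)] q)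
                 + (\<Sum>i\<in>{1..n}. arel (Gamma n) [GX (2 * i), GZ (2 * i), GX (rd n (2 * int i - 1))] q))"

end

theory Submission
  imports Defs
begin

text \<open>All relations involved are of the form path = path, so both algebras are spanned by classes of
  paths. Rotating around the polygon vertex \<open>j\<close> in \<open>Q\<^sub>T\<close> gives the image of \<open>z\<^sub>2\<^sub>j\<close>. Give boundary
  arrows degree 1 and the arrow at the corner \<open>a\<close> of a triangle \<open>abc\<close> the number of polygon edges
  between \<open>b\<close> and \<open>c\<close> (its angle in a regular polygon, in units of \<open>\<pi>/n\<close>). Then every face has
  degree \<open>n\<close>, because the angles of a triangle, and the angles at a vertex together with the two
  boundary arrows, add up to \<open>n\<close>; hence the relations of \<open>\<Lambda>\<^sub>Q\<close> are homogeneous and paths of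
  different degree are linearly independent. On the side of \<open>\<Gamma>(n)\<close>, every path has a normal form
  \<open>x\<^sup>a\<close>, \<open>x\<^sup>a z\<close> or \<open>x\<^sup>a z x\<close>, and start, end and degree determine it: this gives injectivity and
  centrality of \<open>t\<close>. The relation for \<open>zz\<close> follows by induction over the subpolygons cut off by
  diagonals, and the same computation rewrites every path that starts on the boundary as a boundary
  path followed by a partial rotation around one polygon vertex, which gives surjectivity.\<close>

section \<open>Path algebras\<close>

text \<open>Injectivity is obtained without computing inside the dimer algebra. The linear map that
  records only start, end and degree of a path kills every ideal generated by homogeneous relations,
  so it is defined on \<open>\<Lambda>\<^sub>Q\<close>. It separates classes in the algebra of
  \<open>\<Gamma>(n)\<close> as soon as paths with equal data are congruent there. The degree of
  \<open>z\<close> is forced to be \<open>n - 2\<close>, the interior angle of the regular polygon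
  in these units. The second relation, with \<open>2n - 4\<close> arrows on the right, is then
  homogeneous. Along an \<open>x\<close> the degree grows as fast as the position on the circle of
  \<open>2n\<close> boundary vertices; along a \<open>z\<close> the position drops by 2 while the
  degree grows by \<open>n - 2\<close>. So degree minus displacement is 0 or \<open>n\<close> modulo
  \<open>2n\<close> according to the parity of the number of \<open>z\<close>, and this is what
  makes start, end and degree sufficient. The arguments apply to the given triangulation directly,
  with no passage to a special one by flips.\<close>

definition single :: "complex \<Rightarrow> 'b \<Rightarrow> 'b \<Rightarrow> complex" where
  "single c b = (\<lambda>q. if q = b then c else 0)"

text \<open>The linear extension of a map of basis elements. Both the algebra map induced by a map
  of quivers and the passage to degrees are of this kind, so one calculus serves for both.\<close>

definition push :: "('p \<Rightarrow> 'b) \<Rightarrow> ('p \<Rightarrow> complex) \<Rightarrow> 'b \<Rightarrow> complex" where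
  "push F f = (\<lambda>b. \<Sum>p | f p \<noteq> 0 \<and> F p = b. f p)"

definition pcomp :: "'v \<times> 'a list \<Rightarrow> 'v \<times> 'a list \<Rightarrow> 'v \<times> 'a list" where
  "pcomp p q = (fst p, snd p @ snd q)"

lemma bpath_eq_single: "bpath p = single 1 p"
  by (simp add: bpath_def single_def)

lemma single_0 [simp]: "single 0 p = (\<lambda>_. 0)"
  by (auto simp: single_def)

lemma push_zero [simp]: "push F (\<lambda>_. 0) = (\<lambda>_. 0)"
  by (simp add: push_def)

lemma push_superset:
  assumes "finite S" "{p. f p \<noteq> 0} \<subseteq> S"
  shows "push F f b = (\<Sum>p\<in>S. if F p = b then f p else 0)"
proof -
  have "(\<Sum>p\<in>S. if F p = b then f p else 0) = (\<Sum>p\<in>{p\<in>S. F p = b}. f p)"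
    using assms(1) by (simp add: sum.inter_filter)
  also have "\<dots> = (\<Sum>p | f p \<noteq> 0 \<and> F p = b. f p)"
    using assms by (intro sum.mono_neutral_right) auto
  finally show ?thesis by (simp add: push_def)
qed

lemma push_add:
  assumes "finite {p. f p \<noteq> 0}" "finite {p. g p \<noteq> 0}"
  shows "push F (\<lambda>p. f p + g p) = (\<lambda>b. push F f b + push F g b)"
proof
  fix b
  let ?S = "{p. f p \<noteq> 0} \<union> {p. g p \<noteq> 0}"
  have "push F (\<lambda>p. f p + g p) b = (\<Sum>p\<in>?S. if F p = b then f p + g p else 0)"
    by (rule push_superset) (use assms in auto)
  also have "\<dots> = (\<Sum>p\<in>?S. if F p = b then f p else 0) + (\<Sum>p\<in>?S. if F p = b then g p else 0)"
    unfolding sum.distrib[symmetric] by (rule sum.cong) auto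
  also have "\<dots> = push F f b + push F g b"
    using assms push_superset[of ?S f F b] push_superset[of ?S g F b] by simp
  finally show "push F (\<lambda>p. f p + g p) b = push F f b + push F g b" .
qed

lemma push_single [simp]: "push F (single c p) = single c (F p)"
proof
  fix b
  have "push F (single c p) b = (\<Sum>q\<in>{p}. if F q = b then single c p q else 0)"
    by (rule push_superset) (auto simp: single_def)
  then show "push F (single c p) b = single c (F p) b" by (auto simp: single_def)
qed

lemma finite_supp_single: "finite {p. single c b p \<noteq> 0}"
  by (rule finite_subset[of _ "{b}"]) (auto simp: single_def)

lemma finite_supp_add:
  fixes f g :: "'b \<Rightarrow> complex"
  assumes "finite {p. f p \<noteq> 0}" "finite {p. g p \<noteq> 0}"
  shows "finite {p. f p + g p \<noteq> 0}"
  by (rule finite_subset[of _ "{p. f p \<noteq> 0} \<union> {p. g p \<noteq> 0}"]) (use assms in auto)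

lemma finite_supp_push:
  assumes "finite {p. f p \<noteq> 0}" shows "finite {b. push F f b \<noteq> 0}"
proof -
  have "push F f b = 0" if "b \<notin> F ` {p. f p \<noteq> 0}" for b
    unfolding push_def by (rule sum.neutral) (use that in auto)
  then have "{b. push F f b \<noteq> 0} \<subseteq> F ` {p. f p \<noteq> 0}" by blast
  then show ?thesis by (rule finite_subset) (use assms in simp)
qed

lemma fin_supp_induct [consumes 1, case_names zero add]:
  fixes f :: "'b \<Rightarrow> complex"
  assumes "finite {p. f p \<noteq> 0}"
    and "P (\<lambda>_. 0)"
    and "\<And>f c p. finite {p. f p \<noteq> 0} \<Longrightarrow> P f \<Longrightarrow> P (\<lambda>q. f q + single c p q)"
  shows "P f"
proof -
  have "P g" if "finite S" "{p. g p \<noteq> 0} \<subseteq> S" for S and g :: "'b \<Rightarrow> complex"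
    using that
  proof (induction S arbitrary: g)
    case empty
    then have "g = (\<lambda>_. 0)" by auto
    then show ?case using assms(2) by simp
  next
    case (insert x S)
    let ?h = "\<lambda>q. if q = x then 0 else g q"
    have S: "{p. ?h p \<noteq> 0} \<subseteq> S" using insert.prems by auto
    then have "P ?h" by (rule insert.IH)
    have "finite {p. ?h p \<noteq> 0}" using S insert.hyps(1) by (rule finite_subset)
    then have "P (\<lambda>q. ?h q + single (g x) x q)" using \<open>P ?h\<close> by (rule assms(3))
    moreover have "(\<lambda>q. ?h q + single (g x) x q) = g" by (auto simp: single_def)
    ultimately show ?case by simp
  qed
  from this[OF assms(1) order_refl] show ?thesis .
qed

lemma push_push:
  assumes "finite {p. f p \<noteq> 0}"
  shows "push G (push F f) = push (G \<circ> F) f"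
  using assms
proof (induction rule: fin_supp_induct)
  case (add f c p)
  then show ?case
    by (simp add: push_add finite_supp_single finite_supp_push)
qed simp

section \<open>Composition of paths and the product of the path algebra\<close>

lemma chain_append:
  "chain s t (as @ bs) \<longleftrightarrow> chain s t as \<and> chain s t bs
     \<and> (as \<noteq> [] \<and> bs \<noteq> [] \<longrightarrow> t (last as) = s (hd bs))"
proof (induction s t as rule: chain.induct)
  case (2 s t a)
  then show ?case by (cases bs) auto
qed auto

lemma fst_pcomp [simp]: "fst (pcomp p q) = fst p"
  and snd_pcomp [simp]: "snd (pcomp p q) = snd p @ snd q"
  by (simp_all add: pcomp_def)

lemma pcomp_assoc: "pcomp (pcomp p q) r = pcomp p (pcomp q r)"
  by (simp add: pcomp_def)

lemma pend_pcomp [simp]: "pend Q p = fst q \<Longrightarrow> pend Q (pcomp p q) = pend Q q"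
  by (auto simp: pend_def)

lemma pend_Nil [simp]: "pend Q (v, []) = v"
  by (simp add: pend_def)

lemma pend_nonempty: "as \<noteq> [] \<Longrightarrow> pend Q (v, as) = tgt Q (last as)"
  by (simp add: pend_def)

lemma is_path_pcomp:
  "is_path Q p \<Longrightarrow> is_path Q q \<Longrightarrow> pend Q p = fst q \<Longrightarrow> is_path Q (pcomp p q)"
  by (auto simp: is_path_def chain_append pend_def hd_append)

lemma is_path_append:
  "is_path Q (v, as @ bs) \<longleftrightarrow> is_path Q (v, as) \<and>
     (bs \<noteq> [] \<longrightarrow> set bs \<subseteq> arrs Q \<and> src Q (hd bs) = pend Q (v, as) \<and> chain (src Q) (tgt Q) bs)"
  by (auto simp: is_path_def chain_append pend_def hd_append)

lemma carrier_path_alg: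
  "f \<in> carrier (path_alg Q) \<longleftrightarrow> finite {p. f p \<noteq> 0} \<and> (\<forall>p. f p \<noteq> 0 \<longrightarrow> is_path Q p)"
  by (simp add: path_alg_def)

lemma zero_path_alg [simp]: "zero (path_alg Q) = (\<lambda>_. 0)"
  by (simp add: path_alg_def)

lemma add_path_alg [simp]: "add (path_alg Q) f g = (\<lambda>p. f p + g p)"
  by (simp add: path_alg_def)

lemma one_path_alg: "one (path_alg Q) = (\<lambda>p. if snd p = [] \<and> fst p \<in> verts Q then 1 else 0)"
  by (simp add: path_alg_def)

text \<open>The defining sum runs over pairs taken from the supports of \<open>f\<close> and
  \<open>g\<close>, which obstructs additivity. Summed over the cut points of the given path, the
  index set depends on the path alone; hence the additivity laws that follow hold for arbitrary
  functions, without finiteness hypotheses.\<close>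

lemma mult_path_alg:
  "monoid.mult (path_alg Q) f g (v, as) =
     (\<Sum>k\<le>length as. f (v, take k as) * g (pend Q (v, take k as), drop k as))"
proof -
  let ?S = "{(q, r). f q \<noteq> 0 \<and> g r \<noteq> 0 \<and> pend Q q = fst r \<and> (v, as) = (fst q, snd q @ snd r)}"
  let ?h = "\<lambda>k. ((v, take k as), (pend Q (v, take k as), drop k as))"
  let ?F = "\<lambda>qr. f (fst qr) * g (snd qr)"
  have inj: "inj_on ?h {..length as}"
  proof (rule inj_onI)
    fix k l assume "k \<in> {..length as}" "l \<in> {..length as}" "?h k = ?h l"
    then have "length (take k as) = length (take l as)" by auto
    then show "k = l" using \<open>k \<in> _\<close> \<open>l \<in> _\<close> by auto
  qed
  have "?S \<subseteq> ?h ` {..length as}"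
  proof
    fix x assume x: "x \<in> ?S"
    obtain a b c d where abcd: "x = ((a, b), (c, d))" by (metis surj_pair)
    show "x \<in> ?h ` {..length as}"
      using x unfolding abcd by (intro image_eqI[of _ _ "length b"]) auto
  qed
  moreover have "?F x = 0" if "x \<in> ?h ` {..length as} - ?S" for x
    using that by fastforce
  ultimately have "sum ?F ?S = sum ?F (?h ` {..length as})"
    by (intro sum.mono_neutral_left) auto
  also have "\<dots> = (\<Sum>k\<le>length as. ?F (?h k))"
    by (subst sum.reindex[OF inj]) simp
  finally show ?thesis by (simp add: path_alg_def)
qed

lemma mult_add_left:
  "monoid.mult (path_alg Q) (\<lambda>p. f p + g p) h
     = (\<lambda>p. monoid.mult (path_alg Q) f h p + monoid.mult (path_alg Q) g h p)"
proof
  fix p :: "'a \<times> 'b list" show "monoid.mult (path_alg Q) (\<lambda>p. f p + g p) h p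
     = monoid.mult (path_alg Q) f h p + monoid.mult (path_alg Q) g h p"
    by (cases p) (simp add: mult_path_alg distrib_right sum.distrib)
qed

lemma mult_add_right:
  "monoid.mult (path_alg Q) h (\<lambda>p. f p + g p)
     = (\<lambda>p. monoid.mult (path_alg Q) h f p + monoid.mult (path_alg Q) h g p)"
proof
  fix p :: "'a \<times> 'b list" show "monoid.mult (path_alg Q) h (\<lambda>p. f p + g p) p
     = monoid.mult (path_alg Q) h f p + monoid.mult (path_alg Q) h g p"
    by (cases p) (simp add: mult_path_alg distrib_left sum.distrib)
qed

lemma mult_zero_left [simp]: "monoid.mult (path_alg Q) (\<lambda>_. 0) h = (\<lambda>_. 0)"
proof
  fix p :: "'a \<times> 'b list" show "monoid.mult (path_alg Q) (\<lambda>_. 0) h p = 0"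
    by (cases p) (simp add: mult_path_alg)
qed

lemma mult_zero_right [simp]: "monoid.mult (path_alg Q) h (\<lambda>_. 0) = (\<lambda>_. 0)"
proof
  fix p :: "'a \<times> 'b list" show "monoid.mult (path_alg Q) h (\<lambda>_. 0) p = 0"
    by (cases p) (simp add: mult_path_alg)
qed

lemma mult_single:
  "monoid.mult (path_alg Q) (single c p) (single d q)
     = (if pend Q p = fst q then single (c * d) (pcomp p q) else (\<lambda>_. 0))"
proof
  fix x
  let ?S = "{(q', r). single c p q' \<noteq> 0 \<and> single d q r \<noteq> 0 \<and> pend Q q' = fst r
                \<and> x = (fst q', snd q' @ snd r)}"
  have S: "?S = (if c \<noteq> 0 \<and> d \<noteq> 0 \<and> pend Q p = fst q \<and> x = pcomp p q then {(p, q)} else {})"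
    by (auto simp: single_def pcomp_def)
  have "monoid.mult (path_alg Q) (single c p) (single d q) x
      = (\<Sum>qr\<in>?S. single c p (fst qr) * single d q (snd qr))"
    by (simp add: path_alg_def)
  also have "\<dots> = (if pend Q p = fst q then single (c * d) (pcomp p q) else (\<lambda>_. 0)) x"
    unfolding S by (auto simp: single_def)
  finally show "monoid.mult (path_alg Q) (single c p) (single d q) x
      = (if pend Q p = fst q then single (c * d) (pcomp p q) else (\<lambda>_. 0)) x" .
qed

lemma single_carrier: "is_path Q p \<Longrightarrow> single c p \<in> carrier (path_alg Q)"
  by (auto simp: carrier_path_alg finite_supp_single) (auto simp: single_def split: if_splits)

lemma zero_carrier: "(\<lambda>_. 0) \<in> carrier (path_alg Q)"
  by (simp add: carrier_path_alg)

lemma add_carrier: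
  assumes "f \<in> carrier (path_alg Q)" "g \<in> carrier (path_alg Q)"
  shows "(\<lambda>p. f p + g p) \<in> carrier (path_alg Q)"
  using assms unfolding carrier_path_alg by (metis (mono_tags, lifting) add.right_neutral finite_supp_add)

text \<open>Reduces linear statements to single paths. In contrast to plain induction over finite
  supports, each new basis element is known to be a path, which is what keeps products inside the
  carrier.\<close>

lemma path_alg_induct [consumes 1, case_names zero add]:
  assumes "f \<in> carrier (path_alg Q)"
    and "P (\<lambda>_. 0)"
    and "\<And>f c p. f \<in> carrier (path_alg Q) \<Longrightarrow> P f \<Longrightarrow> is_path Q p \<Longrightarrow> P (\<lambda>q. f q + single c p q)"
  shows "P f"
proof -
  have "P g" if "finite S" "{p. g p \<noteq> 0} \<subseteq> S" "\<forall>p. g p \<noteq> 0 \<longrightarrow> is_path Q p" for S g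
    using that
  proof (induction S arbitrary: g)
    case empty
    then have "g = (\<lambda>_. 0)" by auto
    then show ?case using assms(2) by simp
  next
    case (insert x S)
    show ?case
    proof (cases "g x = 0")
      case True
      then have "{p. g p \<noteq> 0} \<subseteq> S" using insert.prems(1) by auto
      then show ?thesis using insert.prems(2) by (rule insert.IH)
    next
      case False
      let ?h = "\<lambda>q. if q = x then 0 else g q"
      have S: "{p. ?h p \<noteq> 0} \<subseteq> S" using insert.prems by auto
      have p: "\<forall>p. ?h p \<noteq> 0 \<longrightarrow> is_path Q p" using insert.prems by auto
      have h: "?h \<in> carrier (path_alg Q)"
        unfolding carrier_path_alg using p finite_subset[OF S insert.hyps(1)] by (intro conjI)
      have "is_path Q x" by (rule insert.prems(2)[rule_format, OF False])
      then have "P (\<lambda>q. ?h q + single (g x) x q)"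
        by (rule assms(3)[OF h insert.IH[OF S p]])
      moreover have "(\<lambda>q. ?h q + single (g x) x q) = g" by (auto simp: single_def)
      ultimately show ?thesis by simp
    qed
  qed
  moreover have "finite {p. f p \<noteq> 0}" "\<forall>p. f p \<noteq> 0 \<longrightarrow> is_path Q p"
    using assms(1) by (simp_all add: carrier_path_alg)
  ultimately show ?thesis by (metis order_refl)
qed

lemma mult_carrier:
  assumes "f \<in> carrier (path_alg Q)" "g \<in> carrier (path_alg Q)"
  shows "monoid.mult (path_alg Q) f g \<in> carrier (path_alg Q)"
  using assms(1)
proof (induction rule: path_alg_induct)
  case zero
  then show ?case by (simp add: zero_carrier)
next
  case (add f c p)
  have "monoid.mult (path_alg Q) (single c p) g \<in> carrier (path_alg Q)"
    using assms(2)
  proof (induction rule: path_alg_induct)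
    case (add f d q)
    then show ?case
      using \<open>is_path Q p\<close>
      by (auto simp: mult_add_right mult_single intro!: add_carrier single_carrier is_path_pcomp)
  qed (simp add: zero_carrier)
  then show ?case using add by (simp add: mult_add_left add_carrier)
qed

lemma mult_single_assoc:
  "monoid.mult (path_alg Q) (monoid.mult (path_alg Q) (single c p) (single d q)) (single e r)
     = monoid.mult (path_alg Q) (single c p) (monoid.mult (path_alg Q) (single d q) (single e r))"
  by (auto simp: mult_single pcomp_assoc mult.assoc)

lemma mult_path_alg_assoc:
  assumes "f \<in> carrier (path_alg Q)" "g \<in> carrier (path_alg Q)" "h \<in> carrier (path_alg Q)"
  shows "monoid.mult (path_alg Q) (monoid.mult (path_alg Q) f g) h
       = monoid.mult (path_alg Q) f (monoid.mult (path_alg Q) g h)"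
  using assms(1)
proof (induction rule: path_alg_induct)
  case (add f c p)
  have "monoid.mult (path_alg Q) (monoid.mult (path_alg Q) (single c p) g) h
       = monoid.mult (path_alg Q) (single c p) (monoid.mult (path_alg Q) g h)"
    using assms(2)
  proof (induction rule: path_alg_induct)
    case (add g d q)
    have "monoid.mult (path_alg Q) (monoid.mult (path_alg Q) (single c p) (single d q)) h
         = monoid.mult (path_alg Q) (single c p) (monoid.mult (path_alg Q) (single d q) h)"
      using assms(3)
      by (induction rule: path_alg_induct) (simp_all add: mult_add_right mult_single_assoc)
    then show ?case using add by (simp add: mult_add_left mult_add_right)
  qed simp
  then show ?case using add by (simp add: mult_add_left)
qed simp

section \<open>Vertex idempotents and the ring structure of the path algebra\<close>

locale fin_quiver =
  fixes Q :: "('v, 'a, 'm) quiver_scheme"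
  assumes finite_verts: "finite (verts Q)"
    and src_verts: "a \<in> arrs Q \<Longrightarrow> src Q a \<in> verts Q"
    and tgt_verts: "a \<in> arrs Q \<Longrightarrow> tgt Q a \<in> verts Q"
begin

text \<open>With \<open>B\<close> all vertices this is the unit; with \<open>B\<close> the boundary
  vertices it represents the idempotent that cuts out the boundary algebra.\<close>

definition idem :: "'v set \<Rightarrow> 'v \<times> 'a list \<Rightarrow> complex" where
  "idem B = (\<lambda>p. if snd p = [] \<and> fst p \<in> B then 1 else 0)"

lemma pend_verts: "is_path Q p \<Longrightarrow> pend Q p \<in> verts Q"
  by (auto simp: is_path_def pend_def intro!: tgt_verts)

lemma is_path_Nil [simp]: "is_path Q (v, []) \<longleftrightarrow> v \<in> verts Q"
  by (simp add: is_path_def)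

lemma finite_idem:
  assumes "finite B" shows "finite {p. idem B p \<noteq> 0}"
  by (rule finite_subset[of _ "(\<lambda>v. (v, [])) ` B"]) (use assms in \<open>auto simp: idem_def split: if_splits\<close>)

lemma idem_carrier:
  assumes "B \<subseteq> verts Q" shows "idem B \<in> carrier (path_alg Q)"
  unfolding carrier_path_alg
  using assms finite_idem[OF finite_subset[OF assms finite_verts]]
  by (auto simp: idem_def is_path_def split: if_splits)

lemma idem_mult_single:
  "monoid.mult (path_alg Q) (idem B) (single c p) = (if fst p \<in> B then single c p else (\<lambda>_. 0))"
proof
  fix x :: "'v \<times> 'a list"
  obtain v as where x: "x = (v, as)" by force
  have "monoid.mult (path_alg Q) (idem B) (single c p) x
      = (\<Sum>k\<le>length as. idem B (v, take k as) * single c p (pend Q (v, take k as), drop k as))"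
    unfolding x mult_path_alg ..
  \<comment> \<open>\<open>idem B\<close> vanishes on nontrivial paths, so only the cut in front of
    the first arrow contributes.\<close>
  also have "\<dots> = (\<Sum>k\<in>{0}. idem B (v, take k as) * single c p (pend Q (v, take k as), drop k as))"
    by (rule sum.mono_neutral_right) (auto simp: idem_def)
  finally show "monoid.mult (path_alg Q) (idem B) (single c p) x
      = (if fst p \<in> B then single c p else (\<lambda>_. 0)) x"
    by (auto simp: idem_def single_def x)
qed

lemma single_mult_idem:
  "monoid.mult (path_alg Q) (single c p) (idem B) = (if pend Q p \<in> B then single c p else (\<lambda>_. 0))"
proof
  fix x :: "'v \<times> 'a list"
  obtain v as where x: "x = (v, as)" by force
  have "monoid.mult (path_alg Q) (single c p) (idem B) x
      = (\<Sum>k\<le>length as. single c p (v, take k as) * idem B (pend Q (v, take k as), drop k as))"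
    unfolding x mult_path_alg ..
  also have "\<dots> = (\<Sum>k\<in>{length as}. single c p (v, take k as) * idem B (pend Q (v, take k as), drop k as))"
    by (rule sum.mono_neutral_right) (auto simp: idem_def)
  finally show "monoid.mult (path_alg Q) (single c p) (idem B) x
      = (if pend Q p \<in> B then single c p else (\<lambda>_. 0)) x"
    by (auto simp: idem_def single_def x)
qed

lemma one_eq_idem: "one (path_alg Q) = idem (verts Q)"
  by (simp add: one_path_alg idem_def)

lemma idem_mult_self:
  assumes "B \<subseteq> verts Q"
  shows "monoid.mult (path_alg Q) (idem B) (idem B) = idem B"
proof
  fix x :: "'v \<times> 'a list"
  obtain v as where x: "x = (v, as)" by force
  have "monoid.mult (path_alg Q) (idem B) (idem B) x
      = (\<Sum>k\<le>length as. idem B (v, take k as) * idem B (pend Q (v, take k as), drop k as))"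
    unfolding x mult_path_alg ..
  also have "\<dots> = (\<Sum>k\<in>{length as}. idem B (v, take k as) * idem B (pend Q (v, take k as), drop k as))"
    by (rule sum.mono_neutral_right) (auto simp: idem_def)
  finally show "monoid.mult (path_alg Q) (idem B) (idem B) x = idem B x"
    by (auto simp: idem_def x)
qed

lemma one_mult:
  assumes "f \<in> carrier (path_alg Q)"
  shows "monoid.mult (path_alg Q) (idem (verts Q)) f = f"
  using assms
  by (induction rule: path_alg_induct) (simp_all add: mult_add_right idem_mult_single, auto simp: is_path_def)

lemma mult_one:
  assumes "f \<in> carrier (path_alg Q)"
  shows "monoid.mult (path_alg Q) f (idem (verts Q)) = f"
  using assms
  by (induction rule: path_alg_induct) (simp_all add: mult_add_left single_mult_idem pend_verts)

lemma uminus_carrier: "f \<in> carrier (path_alg Q) \<Longrightarrow> (\<lambda>p. - f p) \<in> carrier (path_alg Q)"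
  by (simp add: carrier_path_alg)

lemma ring_path_alg: "ring (path_alg Q)"
proof (rule ringI)
  show "abelian_group (path_alg Q)"
  proof (rule abelian_groupI)
    fix f assume "f \<in> carrier (path_alg Q)"
    then show "\<exists>g\<in>carrier (path_alg Q). g \<oplus>\<^bsub>path_alg Q\<^esub> f = \<zero>\<^bsub>path_alg Q\<^esub>"
      by (intro bexI[OF _ uminus_carrier]) auto
  qed (auto simp: add_carrier zero_carrier)
  show "Group.monoid (path_alg Q)"
    by (rule monoidI)
      (auto simp: mult_carrier idem_carrier one_eq_idem one_mult mult_one mult_path_alg_assoc)
qed (auto simp: mult_add_left mult_add_right)

lemma a_minus_path_alg:
  assumes "f \<in> carrier (path_alg Q)" "g \<in> carrier (path_alg Q)"
  shows "f \<ominus>\<^bsub>path_alg Q\<^esub> g = (\<lambda>p. f p - g p)"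
proof -
  interpret ring "path_alg Q" by (rule ring_path_alg)
  have "\<ominus>\<^bsub>path_alg Q\<^esub> g = (\<lambda>p. - g p)"
    using assms by (intro minus_equality) (auto simp: uminus_carrier)
  then show ?thesis by (simp add: a_minus_def)
qed

end

section \<open>Quotients of path algebras\<close>

locale quiver_rels = fin_quiver Q
  for Q :: "('v, 'a, 'm) quiver_scheme" +
  fixes R :: "('v \<times> 'a list \<Rightarrow> complex) set"
  assumes rels_carrier: "R \<subseteq> carrier (path_alg Q)"
begin

abbreviation rel_ideal :: "('v \<times> 'a list \<Rightarrow> complex) set" where
  "rel_ideal \<equiv> genideal (path_alg Q) R"

lemma ideal_rel_ideal: "ideal rel_ideal (path_alg Q)"
  using ring.genideal_ideal[OF ring_path_alg rels_carrier] .

lemma rel_ideal_zero: "(\<lambda>_. 0) \<in> rel_ideal"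
  using additive_subgroup.zero_closed[OF ideal.axioms(1)[OF ideal_rel_ideal]] by simp

lemma rel_ideal_add: "f \<in> rel_ideal \<Longrightarrow> g \<in> rel_ideal \<Longrightarrow> (\<lambda>p. f p + g p) \<in> rel_ideal"
  using additive_subgroup.a_closed[OF ideal.axioms(1)[OF ideal_rel_ideal], of f g] by simp

lemma rel_ideal_mult_left:
  "f \<in> rel_ideal \<Longrightarrow> g \<in> carrier (path_alg Q) \<Longrightarrow> monoid.mult (path_alg Q) g f \<in> rel_ideal"
  using ideal.I_l_closed[OF ideal_rel_ideal] .

lemma rel_ideal_mult_right:
  "f \<in> rel_ideal \<Longrightarrow> g \<in> carrier (path_alg Q) \<Longrightarrow> monoid.mult (path_alg Q) f g \<in> rel_ideal"
  using ideal.I_r_closed[OF ideal_rel_ideal] .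

text \<open>Congruence of single paths, which turns computations in the quotient into rewriting.
  Equality of the ends is built in so that whatever composes with one path composes with the
  other.\<close>

definition peq :: "'v \<times> 'a list \<Rightarrow> 'v \<times> 'a list \<Rightarrow> bool" where
  "peq p q \<longleftrightarrow> is_path Q p \<and> is_path Q q \<and> fst p = fst q \<and> pend Q p = pend Q q
     \<and> (\<lambda>r. single 1 p r + single (- 1) q r) \<in> rel_ideal"

lemma peqD:
  assumes "peq p q"
  shows "is_path Q p" "is_path Q q" "fst p = fst q" "pend Q p = pend Q q"
  using assms by (simp_all add: peq_def)

lemma peq_pcomp_left:
  assumes "peq q q'" "is_path Q p" "pend Q p = fst q"
  shows "peq (pcomp p q) (pcomp p q')"
proof -
  have "monoid.mult (path_alg Q) (single 1 p) (\<lambda>r. single 1 q r + single (- 1) q' r) \<in> rel_ideal"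
    using assms by (intro rel_ideal_mult_left single_carrier) (auto simp: peq_def)
  then show ?thesis
    using assms by (simp add: peq_def mult_add_right mult_single is_path_pcomp)
qed

lemma peq_pcomp_right:
  assumes "peq p p'" "is_path Q q" "pend Q p = fst q"
  shows "peq (pcomp p q) (pcomp p' q)"
proof -
  have "monoid.mult (path_alg Q) (\<lambda>r. single 1 p r + single (- 1) p' r) (single 1 q) \<in> rel_ideal"
    using assms by (intro rel_ideal_mult_right single_carrier) (auto simp: peq_def)
  then show ?thesis
    using assms by (simp add: peq_def mult_add_left mult_single is_path_pcomp)
qed

text \<open>The ideal is only known to be closed under ring operations; scaling by \<open>c\<close>
  is multiplication with \<open>c\<close> times the trivial path at the start.\<close>

lemma peq_scale:
  assumes "peq p q"
  shows "(\<lambda>r. single c p r + single (- c) q r) \<in> rel_ideal"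
proof -
  have path: "is_path Q (fst p, [])" using assms by (auto simp: peq_def is_path_def)
  have "monoid.mult (path_alg Q) (single c (fst p, [])) (\<lambda>r. single 1 p r + single (- 1) q r)
      \<in> rel_ideal"
    using assms path by (intro rel_ideal_mult_left single_carrier) (auto simp: peq_def)
  moreover have "pcomp (fst p, []) p = p" by (simp add: pcomp_def)
  moreover have "pcomp (fst p, []) q = q" by (simp add: pcomp_def peqD(3)[OF assms])
  ultimately show ?thesis
    using assms by (simp add: peq_def mult_add_right mult_single)
qed

lemma peq_refl: "is_path Q p \<Longrightarrow> peq p p"
proof -
  have "(\<lambda>r. single 1 p r + single (- 1) p r) = (\<lambda>_. 0)" by (auto simp: single_def)
  then show "is_path Q p \<Longrightarrow> peq p p" by (simp add: peq_def rel_ideal_zero)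
qed

lemma peq_sym: "peq p q \<Longrightarrow> peq q p"
  using peq_scale[of p q "- 1"] by (simp add: peq_def add.commute)

lemma peq_trans [trans]:
  assumes "peq p q" "peq q r" shows "peq p r"
proof -
  have "(\<lambda>x. (single 1 p x + single (- 1) q x) + (single 1 q x + single (- 1) r x)) \<in> rel_ideal"
    by (rule rel_ideal_add) (use assms in \<open>auto simp: peq_def\<close>)
  moreover have "(\<lambda>x. (single 1 p x + single (- 1) q x) + (single 1 q x + single (- 1) r x))
      = (\<lambda>x. single 1 p x + single (- 1) r x)"
    by (auto simp: single_def)
  ultimately show ?thesis using assms by (simp add: peq_def)
qed

lemma peq_rel:
  assumes "(\<lambda>r. bpath p r - bpath q r) \<in> R" "is_path Q p" "is_path Q q"
    "fst p = fst q" "pend Q p = pend Q q"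
  shows "peq p q"
proof -
  have "(\<lambda>r. bpath p r - bpath q r) = (\<lambda>r. single 1 p r + single (- 1) q r)"
    by (auto simp: bpath_def single_def)
  then show ?thesis
    using assms ring.genideal_self[OF ring_path_alg rels_carrier] by (auto simp: peq_def)
qed

lemma cls_eq_iff:
  assumes "f \<in> carrier (path_alg Q)" "g \<in> carrier (path_alg Q)"
  shows "cls Q R f = cls Q R g \<longleftrightarrow> (\<lambda>p. f p - g p) \<in> rel_ideal"
  unfolding cls_def a_minus_path_alg[OF assms, symmetric]
  using ring.quotient_eq_iff_same_a_r_cos[OF ring_path_alg ideal_rel_ideal assms] by simp

lemma cls_hom: "cls Q R \<in> ring_hom (path_alg Q) (quot_alg Q R)"
proof -
  have "cls Q R = (+>\<^bsub>path_alg Q\<^esub>) rel_ideal" by (rule ext) (simp add: cls_def)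
  then show ?thesis using ideal.rcos_ring_hom[OF ideal_rel_ideal] by (simp add: quot_alg_def)
qed

lemma ring_quot_alg: "ring (quot_alg Q R)"
  unfolding quot_alg_def by (rule ideal.quotient_is_ring[OF ideal_rel_ideal])

lemma carrier_quot_alg: "carrier (quot_alg Q R) = cls Q R ` carrier (path_alg Q)"
  by (auto simp: quot_alg_def FactRing_def A_RCOSETS_def' cls_def)

lemma zero_quot_alg: "zero (quot_alg Q R) = cls Q R (\<lambda>_. 0)"
  using ring_hom_zero[OF cls_hom ring_path_alg ring_quot_alg] by simp

lemma cls_eq_zero_iff:
  assumes "f \<in> carrier (path_alg Q)"
  shows "cls Q R f = zero (quot_alg Q R) \<longleftrightarrow> f \<in> rel_ideal"
  using cls_eq_iff[OF assms zero_carrier] by (simp add: zero_quot_alg)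

lemma peq_cls: "peq p q \<Longrightarrow> cls Q R (single c p) = cls Q R (single c q)"
proof -
  assume pq: "peq p q"
  have "(\<lambda>r. single c p r - single c q r) = (\<lambda>r. single c p r + single (- c) q r)"
    by (auto simp: single_def)
  with pq peq_scale[OF pq, of c] show ?thesis
    by (subst cls_eq_iff) (auto simp: single_carrier peq_def)
qed

section \<open>Grading by start, end and weight\<close>

definition path_data :: "('a \<Rightarrow> nat) \<Rightarrow> 'v \<times> 'a list \<Rightarrow> 'v \<times> 'v \<times> nat" where
  "path_data w p = (fst p, pend Q p, sum_list (map w (snd p)))"

lemma finite_supp_carrier: "f \<in> carrier (path_alg Q) \<Longrightarrow> finite {p. f p \<noteq> 0}"
  by (simp add: carrier_path_alg)

text \<open>Multiplying by a path shifts the data, so the data of the product depend on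
  \<open>f\<close> only through the data of \<open>f\<close>. The guard on \<open>d\<close> is
  needed because subtraction of natural numbers truncates.\<close>

lemma push_path_data_mult_left:
  assumes "f \<in> carrier (path_alg Q)" "is_path Q p"
  shows "push (path_data w) (monoid.mult (path_alg Q) (single c p) f) =
    (\<lambda>(i, k, d). if i = fst p \<and> sum_list (map w (snd p)) \<le> d
       then c * push (path_data w) f (pend Q p, k, d - sum_list (map w (snd p))) else 0)"
  using assms(1)
proof (induction rule: path_alg_induct)
  case zero
  then show ?case by auto
next
  case (add f a q)
  have fin: "finite {x. monoid.mult (path_alg Q) (single c p) f x \<noteq> 0}"
    "finite {x. monoid.mult (path_alg Q) (single c p) (single a q) x \<noteq> 0}"
    using add assms(2) by (auto intro!: finite_supp_carrier mult_carrier single_carrier)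
  have pd: "path_data w x = (fst x, pend Q x, sum_list (map w (snd x)))" for x
    by (rule path_data_def)
  have sum: "push (path_data w) (monoid.mult (path_alg Q) (single c p) (\<lambda>q'. f q' + single a q q'))
      = (\<lambda>b. push (path_data w) (monoid.mult (path_alg Q) (single c p) f) b + (if pend Q p = fst q then single (c * a) (path_data w (pcomp p q)) b else 0))"
    unfolding mult_add_right push_add[OF fin] by (simp add: mult_single)
  show ?case
    unfolding sum add.IH push_add[OF finite_supp_carrier[OF add.hyps(1)] finite_supp_single] push_single
    by (rule ext) (auto simp: single_def pd distrib_left distrib_right split: if_split_asm)
qed

lemma push_path_data_mult_right:
  assumes "f \<in> carrier (path_alg Q)" "is_path Q p"
  shows "push (path_data w) (monoid.mult (path_alg Q) f (single c p)) =
    (\<lambda>(i, k, d). if k = pend Q p \<and> sum_list (map w (snd p)) \<le> d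
       then push (path_data w) f (i, fst p, d - sum_list (map w (snd p))) * c else 0)"
  using assms(1)
proof (induction rule: path_alg_induct)
  case zero
  then show ?case by auto
next
  case (add f a q)
  have fin: "finite {x. monoid.mult (path_alg Q) f (single c p) x \<noteq> 0}"
    "finite {x. monoid.mult (path_alg Q) (single a q) (single c p) x \<noteq> 0}"
    using add assms(2) by (auto intro!: finite_supp_carrier mult_carrier single_carrier)
  have pd: "path_data w x = (fst x, pend Q x, sum_list (map w (snd x)))" for x
    by (rule path_data_def)
  have sum: "push (path_data w) (monoid.mult (path_alg Q) (\<lambda>q'. f q' + single a q q') (single c p))
      = (\<lambda>b. push (path_data w) (monoid.mult (path_alg Q) f (single c p)) b + (if pend Q q = fst p then single (a * c) (path_data w (pcomp q p)) b else 0))"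
    unfolding mult_add_left push_add[OF fin] by (simp add: mult_single)
  show ?case
    unfolding sum add.IH push_add[OF finite_supp_carrier[OF add.hyps(1)] finite_supp_single] push_single
    by (rule ext) (auto simp: single_def pd distrib_left distrib_right split: if_split_asm)
qed

text \<open>By the two shift formulas the elements with vanishing data form a two-sided ideal;
  containing the relations, it contains the ideal they generate.\<close>

lemma push_path_data_ideal:
  assumes "\<And>r. r \<in> R \<Longrightarrow> push (path_data w) r = (\<lambda>_. 0)" and "f \<in> rel_ideal"
  shows "push (path_data w) f = (\<lambda>_. 0)"
proof -
  let ?J = "{f \<in> carrier (path_alg Q). push (path_data w) f = (\<lambda>_. 0)}"
  interpret ring "path_alg Q" by (rule ring_path_alg)
  have uminus: "\<ominus>\<^bsub>path_alg Q\<^esub> g = (\<lambda>p. - g p)" if "g \<in> carrier (path_alg Q)" for g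
    using that by (intro minus_equality) (auto simp: uminus_carrier)
  have "ideal ?J (path_alg Q)"
  proof (rule idealI[OF ring_path_alg])
    have "push (path_data w) (\<lambda>p. - f p) = (\<lambda>_. 0)" if f: "f \<in> ?J" for f
    proof -
      have "push (path_data w) (\<lambda>p. f p + - f p) = (\<lambda>b. push (path_data w) f b + push (path_data w) (\<lambda>p. - f p) b)"
        using f by (intro push_add finite_supp_carrier uminus_carrier) auto
      then show ?thesis using f by (auto simp: fun_eq_iff)
    qed
    note neg = this
    show "subgroup ?J (add_monoid (path_alg Q))"
    proof (rule subgroup.intro)
      fix f assume f: "f \<in> ?J"
      then show "inv\<^bsub>add_monoid (path_alg Q)\<^esub> f \<in> ?J"
        using neg[OF f] uminus[unfolded a_inv_def] by (simp add: uminus_carrier)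
    qed (auto simp: add_carrier zero_carrier push_add finite_supp_carrier)
  next
    fix f g assume f: "f \<in> ?J" and g: "g \<in> carrier (path_alg Q)"
    have "push (path_data w) (monoid.mult (path_alg Q) g f) = (\<lambda>_. 0)"
      using g
    proof (induction rule: path_alg_induct)
      case (add g c p)
      then have "push (path_data w) (monoid.mult (path_alg Q) (\<lambda>q. g q + single c p q) f)
          = (\<lambda>b. push (path_data w) (monoid.mult (path_alg Q) g f) b
               + push (path_data w) (monoid.mult (path_alg Q) (single c p) f) b)"
        unfolding mult_add_left using f
        by (intro push_add finite_supp_carrier mult_carrier single_carrier) auto
      then show ?case using f add by (auto simp: push_path_data_mult_left)
    qed simp
    then show "g \<otimes>\<^bsub>path_alg Q\<^esub> f \<in> ?J" using f g by (simp add: mult_carrier)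
    have "push (path_data w) (monoid.mult (path_alg Q) f g) = (\<lambda>_. 0)"
      using g
    proof (induction rule: path_alg_induct)
      case (add g c p)
      then have "push (path_data w) (monoid.mult (path_alg Q) f (\<lambda>q. g q + single c p q))
          = (\<lambda>b. push (path_data w) (monoid.mult (path_alg Q) f g) b
               + push (path_data w) (monoid.mult (path_alg Q) f (single c p)) b)"
        unfolding mult_add_right using f
        by (intro push_add finite_supp_carrier mult_carrier single_carrier) auto
      then show ?case using f add by (auto simp: push_path_data_mult_right)
    qed simp
    then show "f \<otimes>\<^bsub>path_alg Q\<^esub> g \<in> ?J" using f g by (simp add: mult_carrier)
  qed
  then have "rel_ideal \<subseteq> ?J"
    by (rule genideal_minimal) (use assms(1) rels_carrier in auto)
  then show ?thesis using assms(2) by auto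
qed

lemma mult_scaled_idem:
  "monoid.mult (path_alg Q) (\<lambda>p. c * idem B p) g = (\<lambda>p. c * monoid.mult (path_alg Q) (idem B) g p)"
proof
  fix p :: "'v \<times> 'a list"
  show "monoid.mult (path_alg Q) (\<lambda>p. c * idem B p) g p = c * monoid.mult (path_alg Q) (idem B) g p"
    by (cases p) (simp add: mult_path_alg sum_distrib_left mult.assoc)
qed

text \<open>By linearity it is enough to compare both products with one path. The hypothesis fits an
  element \<open>t\<close> that attaches exactly one loop at either end of a path.\<close>

lemma central_cls:
  assumes "t \<in> carrier (path_alg Q)" "f \<in> carrier (path_alg Q)"
    and "\<And>c p. is_path Q p \<Longrightarrow> \<exists>q q'. peq q q'
          \<and> monoid.mult (path_alg Q) t (single c p) = single c q
          \<and> monoid.mult (path_alg Q) (single c p) t = single c q'"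
  shows "cls Q R (monoid.mult (path_alg Q) t f) = cls Q R (monoid.mult (path_alg Q) f t)"
  using assms(2)
proof (induction rule: path_alg_induct)
  case (add f c p)
  note hom = ring_hom_add[OF cls_hom, simplified]
  obtain q q' where q: "peq q q'" "monoid.mult (path_alg Q) t (single c p) = single c q"
    "monoid.mult (path_alg Q) (single c p) t = single c q'"
    using assms(3)[OF add.hyps(2)] by blast
  note carr = mult_carrier[OF assms(1) add.hyps(1)] mult_carrier[OF add.hyps(1) assms(1)]
    mult_carrier[OF assms(1) single_carrier[OF add.hyps(2)]]
    mult_carrier[OF single_carrier[OF add.hyps(2)] assms(1)]
  show ?case
    unfolding mult_add_left mult_add_right hom[OF carr(1,3)] hom[OF carr(2,4)] add.IH
    by (simp add: q peq_cls[OF q(1)])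
qed simp

lemma ring_corner:
  assumes "B \<subseteq> verts Q"
  shows "ring (corner (quot_alg Q R) (cls Q R (idem B)))"
proof -
  let ?S = "quot_alg Q R" and ?e = "cls Q R (idem B)"
  interpret S: ring ?S by (rule ring_quot_alg)
  have e: "?e \<in> carrier ?S" unfolding carrier_quot_alg using idem_carrier[OF assms] by blast
  have ee: "?e \<otimes>\<^bsub>?S\<^esub> ?e = ?e"
    using ring_hom_mult[OF cls_hom idem_carrier[OF assms] idem_carrier[OF assms]]
    by (simp add: idem_mult_self[OF assms])
  have ec: "?e \<otimes>\<^bsub>?S\<^esub> (?e \<otimes>\<^bsub>?S\<^esub> a \<otimes>\<^bsub>?S\<^esub> ?e) = ?e \<otimes>\<^bsub>?S\<^esub> a \<otimes>\<^bsub>?S\<^esub> ?e" if "a \<in> carrier ?S" for a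
    using that e ee by (simp flip: S.m_assoc)
  have ce: "(?e \<otimes>\<^bsub>?S\<^esub> a \<otimes>\<^bsub>?S\<^esub> ?e) \<otimes>\<^bsub>?S\<^esub> ?e = ?e \<otimes>\<^bsub>?S\<^esub> a \<otimes>\<^bsub>?S\<^esub> ?e" if "a \<in> carrier ?S" for a
    using that e ee by (simp add: S.m_assoc)
  \<comment> \<open>Being fixed by the idempotent on both sides is a condition on \<open>x\<close>
    alone, so closure under the ring operations follows without choosing preimages.\<close>
  have mem: "x \<in> carrier (corner ?S ?e) \<longleftrightarrow> x \<in> carrier ?S \<and> ?e \<otimes>\<^bsub>?S\<^esub> x = x \<and> x \<otimes>\<^bsub>?S\<^esub> ?e = x" for x
  proof
    assume "x \<in> carrier (corner ?S ?e)"
    then show "x \<in> carrier ?S \<and> ?e \<otimes>\<^bsub>?S\<^esub> x = x \<and> x \<otimes>\<^bsub>?S\<^esub> ?e = x"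
      using e ec ce by (auto simp: corner_def)
  next
    assume "x \<in> carrier ?S \<and> ?e \<otimes>\<^bsub>?S\<^esub> x = x \<and> x \<otimes>\<^bsub>?S\<^esub> ?e = x"
    then show "x \<in> carrier (corner ?S ?e)" by (auto simp: corner_def intro!: exI[of _ x])
  qed
  have ops: "monoid.mult (corner ?S ?e) = monoid.mult ?S" "add (corner ?S ?e) = add ?S"
    "zero (corner ?S ?e) = zero ?S" "one (corner ?S ?e) = ?e"
    by (simp_all add: corner_def)
  show ?thesis
  proof (rule ringI)
    show "abelian_group (corner ?S ?e)"
    proof (rule abelian_groupI)
      fix x assume x: "x \<in> carrier (corner ?S ?e)"
      then have "\<ominus>\<^bsub>?S\<^esub> x \<in> carrier (corner ?S ?e)"
        using e by (simp add: mem S.r_minus S.l_minus)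
      then show "\<exists>y\<in>carrier (corner ?S ?e). y \<oplus>\<^bsub>corner ?S ?e\<^esub> x = \<zero>\<^bsub>corner ?S ?e\<^esub>"
        using x by (intro bexI[of _ "\<ominus>\<^bsub>?S\<^esub> x"]) (simp_all add: mem ops S.l_neg)
    qed (use e in \<open>auto simp: mem ops S.a_ac S.l_distr S.r_distr\<close>)
    show "Group.monoid (corner ?S ?e)"
    proof (rule monoidI)
      fix x y assume x: "x \<in> carrier (corner ?S ?e)" and y: "y \<in> carrier (corner ?S ?e)"
      then show "x \<otimes>\<^bsub>corner ?S ?e\<^esub> y \<in> carrier (corner ?S ?e)"
        using e unfolding mem ops by (metis S.m_assoc S.m_closed)
    qed (use e ee in \<open>auto simp: mem ops S.m_assoc\<close>)
  qed (auto simp: mem ops S.l_distr S.r_distr)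
qed

end

section \<open>Comparison with a corner algebra\<close>

text \<open>Arrows are sent to whole paths because \<open>z\<close> becomes a rotation. Injectivity
  on vertices guarantees that paths with zero product keep zero product; otherwise the linear
  extension would not be multiplicative.\<close>

locale boundary_hom = G: quiver_rels G RG + D: quiver_rels Q RQ
  for G :: "('g, 'ga, 'm) quiver_scheme" and RG
    and Q :: "('v, 'a, 'n) quiver_scheme" and RQ +
  fixes vm :: "'g \<Rightarrow> 'v" and am :: "'ga \<Rightarrow> 'a list" and w :: "'a \<Rightarrow> nat"
  assumes inj_vm: "inj_on vm (verts G)" and vm_verts: "vm ` verts G \<subseteq> verts Q"
    and am_path: "a \<in> arrs G \<Longrightarrow> is_path Q (vm (src G a), am a)"
    and am_pend: "a \<in> arrs G \<Longrightarrow> pend Q (vm (src G a), am a) = vm (tgt G a)"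
begin

definition pmap :: "'g \<times> 'ga list \<Rightarrow> 'v \<times> 'a list" where
  "pmap p = (vm (fst p), concat (map am (snd p)))"

lemma fst_pmap [simp]: "fst (pmap p) = vm (fst p)"
  by (simp add: pmap_def)

lemma pmap_pcomp: "pmap (pcomp p q) = pcomp (pmap p) (pmap q)"
  by (simp add: pmap_def pcomp_def)

lemma is_path_pmap:
  assumes "is_path G p"
  shows "is_path Q (pmap p)" "pend Q (pmap p) = vm (pend G p)"
proof -
  have "is_path Q (pmap (v, as)) \<and> pend Q (pmap (v, as)) = vm (pend G (v, as))"
    if "is_path G (v, as)" for v as
    using that
  proof (induction as rule: rev_induct)
    case Nil
    then show ?case using vm_verts by (auto simp: pmap_def)
  next
    case (snoc a as)
    then have as: "is_path G (v, as)" and a: "a \<in> arrs G" "src G a = pend G (v, as)"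
      by (auto simp: is_path_append)
    have eq: "pmap (v, as @ [a]) = pcomp (pmap (v, as)) (vm (src G a), am a)"
      by (simp add: pmap_def pcomp_def)
    show ?case
      unfolding eq using snoc.IH[OF as] am_path[OF a(1)] am_pend[OF a(1)] a(2)
      by (auto simp: is_path_pcomp pend_nonempty)
  qed
  then show "is_path Q (pmap p)" "pend Q (pmap p) = vm (pend G p)"
    using assms by (metis surj_pair)+
qed

lemma push_pmap_carrier:
  assumes "f \<in> carrier (path_alg G)"
  shows "push pmap f \<in> carrier (path_alg Q)"
  using assms
proof (induction rule: path_alg_induct)
  case (add f c p)
  then show ?case
    by (simp add: push_add G.finite_supp_carrier finite_supp_single add_carrier single_carrier is_path_pmap)
qed (simp add: zero_carrier)

lemma push_pmap_single_mult:
  assumes "g \<in> carrier (path_alg G)" "is_path G p"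
  shows "push pmap (monoid.mult (path_alg G) (single c p) g)
       = monoid.mult (path_alg Q) (single c (pmap p)) (push pmap g)"
  using assms(1)
proof (induction rule: path_alg_induct)
  case (add g d q)
  have fin: "finite {x. monoid.mult (path_alg G) (single c p) g x \<noteq> 0}"
    "finite {x. monoid.mult (path_alg G) (single c p) (single d q) x \<noteq> 0}"
    using add assms(2) by (auto intro!: G.finite_supp_carrier mult_carrier single_carrier)
  have "vm (pend G p) = vm (fst q) \<longleftrightarrow> pend G p = fst q"
    using inj_onD[OF inj_vm] G.pend_verts[OF assms(2)] add.hyps(2) by (auto simp: is_path_def)
  then have "push pmap (monoid.mult (path_alg G) (single c p) (single d q))
      = monoid.mult (path_alg Q) (single c (pmap p)) (single d (pmap q))"
    by (auto simp: mult_single is_path_pmap[OF assms(2)] pmap_pcomp)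
  then show ?case
    unfolding mult_add_right push_add[OF fin] add.IH
      push_add[OF G.finite_supp_carrier[OF add.hyps(1)] finite_supp_single]
    by simp
qed simp

lemma push_pmap_mult:
  assumes "f \<in> carrier (path_alg G)" "g \<in> carrier (path_alg G)"
  shows "push pmap (monoid.mult (path_alg G) f g)
       = monoid.mult (path_alg Q) (push pmap f) (push pmap g)"
  using assms(1)
proof (induction rule: path_alg_induct)
  case (add f c p)
  have fin: "finite {x. monoid.mult (path_alg G) f g x \<noteq> 0}"
    "finite {x. monoid.mult (path_alg G) (single c p) g x \<noteq> 0}"
    using add assms(2) by (auto intro!: G.finite_supp_carrier mult_carrier single_carrier)
  show ?case
    unfolding mult_add_left push_add[OF fin] add.IH
      push_add[OF G.finite_supp_carrier[OF add.hyps(1)] finite_supp_single]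
      push_pmap_single_mult[OF assms(2) add.hyps(2)]
    by (simp add: mult_add_left)
qed simp

text \<open>The factor \<open>c\<close> is carried along so that one induction over the vertices
  gives both the image of the unit and the images of the scalars.\<close>

lemma push_pmap_scaled_idem:
  assumes "V \<subseteq> verts G"
  shows "push pmap (\<lambda>p. c * G.idem V p) = (\<lambda>p. c * D.idem (vm ` V) p)"
proof -
  have "finite V" using assms G.finite_verts finite_subset by blast
  then show ?thesis using assms
  proof (induction V rule: finite_induct)
    case empty
    then show ?case by (simp add: G.idem_def D.idem_def)
  next
    case (insert v V)
    have "(\<lambda>p. c * G.idem (insert v V) p) = (\<lambda>p. c * G.idem V p + single c (v, []) p)"
      using insert.hyps by (auto simp: G.idem_def single_def fun_eq_iff)
    moreover have "vm v \<notin> vm ` V"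
      using insert inj_vm by (auto simp: inj_on_def)
    then have "(\<lambda>p. c * D.idem (vm ` insert v V) p) = (\<lambda>p. c * D.idem (vm ` V) p + single c (vm v, []) p)"
      by (auto simp: D.idem_def single_def fun_eq_iff)
    moreover have "finite {p. c * G.idem V p \<noteq> 0}"
      by (rule finite_subset[OF _ G.finite_idem[OF insert.hyps(1)]]) auto
    ultimately show ?case
      using insert by (simp add: push_add finite_supp_single pmap_def)
  qed
qed

abbreviation bdry :: "'v set" where "bdry \<equiv> vm ` verts G"

lemma push_pmap_corner:
  assumes "f \<in> carrier (path_alg G)"
  shows "monoid.mult (path_alg Q) (D.idem bdry) (monoid.mult (path_alg Q) (push pmap f) (D.idem bdry))
    = push pmap f"
  using assms
proof (induction rule: path_alg_induct)
  case (add f c p)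
  then have "fst p \<in> verts G" "pend G p \<in> verts G"
    by (auto simp: is_path_def G.pend_verts)
  then show ?case
    using add.IH by (simp add: push_add G.finite_supp_carrier[OF add.hyps(1)] finite_supp_single mult_add_left mult_add_right
        D.single_mult_idem D.idem_mult_single is_path_pmap[OF add.hyps(2)])
qed simp

end

text \<open>The comparison of algebras is reduced to facts about paths. \<open>rels_mapped\<close>
  lets the map descend to the quotient and \<open>full\<close> makes it surjective. Injectivity is
  shared: \<open>rels_homogeneous\<close> keeps images with different data independent, and
  \<open>faithful\<close> identifies paths whose data agree.\<close>

locale boundary_iso = boundary_hom G RG Q RQ vm am w
  for G :: "('g, 'ga, 'm) quiver_scheme" and RG
    and Q :: "('v, 'a, 'n) quiver_scheme" and RQ
    and vm :: "'g \<Rightarrow> 'v" and am :: "'ga \<Rightarrow> 'a list" and w :: "'a \<Rightarrow> nat" +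
  assumes rels_mapped: "r \<in> RG \<Longrightarrow> push pmap r \<in> D.rel_ideal"
    and rels_homogeneous: "s \<in> RQ \<Longrightarrow> push (D.path_data w) s = (\<lambda>_. 0)"
    and faithful: "is_path G p \<Longrightarrow> is_path G q \<Longrightarrow> fst p = fst q \<Longrightarrow> pend G p = pend G q
      \<Longrightarrow> sum_list (map w (snd (pmap p))) = sum_list (map w (snd (pmap q))) \<Longrightarrow> G.peq p q"
    and full: "is_path Q x \<Longrightarrow> fst x \<in> vm ` verts G \<Longrightarrow> pend Q x \<in> vm ` verts G
      \<Longrightarrow> \<exists>g. is_path G g \<and> D.peq x (pmap g)"
begin

abbreviation target :: "('v \<times> 'a list \<Rightarrow> complex) set ring" where
  "target \<equiv> corner (quot_alg Q RQ) (cls Q RQ (D.idem bdry))"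

definition bhom :: "('g \<times> 'ga list \<Rightarrow> complex) \<Rightarrow> ('v \<times> 'a list \<Rightarrow> complex) set" where
  "bhom f = cls Q RQ (push pmap f)"

lemma cls_corner:
  assumes "f \<in> carrier (path_alg Q)"
  shows "cls Q RQ (D.idem bdry) \<otimes>\<^bsub>quot_alg Q RQ\<^esub> cls Q RQ f \<otimes>\<^bsub>quot_alg Q RQ\<^esub> cls Q RQ (D.idem bdry)
       = cls Q RQ (monoid.mult (path_alg Q) (D.idem bdry) (monoid.mult (path_alg Q) f (D.idem bdry)))"
  using assms ring_hom_mult[OF D.cls_hom] D.idem_carrier[OF vm_verts]
  by (simp add: mult_carrier flip: mult_path_alg_assoc)

lemma bhom_in_target:
  assumes "f \<in> carrier (path_alg G)"
  shows "bhom f \<in> carrier target"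
proof -
  have "bhom f = cls Q RQ (D.idem bdry) \<otimes>\<^bsub>quot_alg Q RQ\<^esub> bhom f \<otimes>\<^bsub>quot_alg Q RQ\<^esub> cls Q RQ (D.idem bdry)"
    unfolding bhom_def cls_corner[OF push_pmap_carrier[OF assms]] push_pmap_corner[OF assms] ..
  moreover have "bhom f \<in> carrier (quot_alg Q RQ)"
    unfolding bhom_def D.carrier_quot_alg using push_pmap_carrier[OF assms] by blast
  ultimately show ?thesis unfolding corner_def by auto
qed

lemma bhom_add:
  assumes "f \<in> carrier (path_alg G)" "g \<in> carrier (path_alg G)"
  shows "bhom (\<lambda>p. f p + g p) = bhom f \<oplus>\<^bsub>quot_alg Q RQ\<^esub> bhom g"
  using assms ring_hom_add[OF D.cls_hom push_pmap_carrier push_pmap_carrier]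
  by (simp add: bhom_def push_add G.finite_supp_carrier)

lemma ring_hom_ring_bhom: "ring_hom_ring (path_alg G) target bhom"
proof (rule ring_hom_ringI[OF G.ring_path_alg D.ring_corner[OF vm_verts]])
  fix f g assume fg: "f \<in> carrier (path_alg G)" "g \<in> carrier (path_alg G)"
  show "bhom (f \<otimes>\<^bsub>path_alg G\<^esub> g) = bhom f \<otimes>\<^bsub>target\<^esub> bhom g"
    using fg ring_hom_mult[OF D.cls_hom push_pmap_carrier push_pmap_carrier]
    by (simp add: corner_def bhom_def push_pmap_mult)
  show "bhom (f \<oplus>\<^bsub>path_alg G\<^esub> g) = bhom f \<oplus>\<^bsub>target\<^esub> bhom g"
    using bhom_add[OF fg] by (simp add: corner_def)
next
  show "bhom \<one>\<^bsub>path_alg G\<^esub> = \<one>\<^bsub>target\<^esub>"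
    using push_pmap_scaled_idem[of "verts G" 1] by (simp add: bhom_def corner_def G.one_eq_idem)
qed (rule bhom_in_target)

text \<open>An element of the corner is a combination of paths cut down by the idempotent on both
  sides. Paths with an end off the boundary are annihilated, and the others are images by
  \<open>full\<close>.\<close>

lemma bhom_surj: "bhom ` carrier (path_alg G) = carrier target"
proof
  show "bhom ` carrier (path_alg G) \<subseteq> carrier target" using bhom_in_target by blast
  show "carrier target \<subseteq> bhom ` carrier (path_alg G)"
  proof
    fix x assume "x \<in> carrier target"
    then obtain f where f: "f \<in> carrier (path_alg Q)"
      and x: "x = cls Q RQ (monoid.mult (path_alg Q) (D.idem bdry) (monoid.mult (path_alg Q) f (D.idem bdry)))"
      using cls_corner unfolding corner_def D.carrier_quot_alg by auto
    let ?r = "\<lambda>f. monoid.mult (path_alg Q) (D.idem bdry) (monoid.mult (path_alg Q) f (D.idem bdry))"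
    have "cls Q RQ (?r f) \<in> bhom ` carrier (path_alg G)"
      using f
    proof (induction rule: path_alg_induct)
      case zero
      then show ?case
        using zero_carrier[of G] by (intro image_eqI[of _ _ "\<lambda>_. 0"]) (auto simp: bhom_def)
    next
      case (add f c p)
      note ic = D.idem_carrier[OF vm_verts]
      have carr: "?r f \<in> carrier (path_alg Q)" "?r (single c p) \<in> carrier (path_alg Q)"
        by (intro mult_carrier ic add.hyps single_carrier)+
      obtain g where g: "g \<in> carrier (path_alg G)" "cls Q RQ (?r f) = bhom g"
        using add.IH by blast
      have "\<exists>h\<in>carrier (path_alg G). cls Q RQ (?r (single c p)) = bhom h"
      proof (cases "fst p \<in> bdry \<and> pend Q p \<in> bdry")
        case True
        then obtain h where h: "is_path G h" "D.peq p (pmap h)" using full add.hyps(2) by blast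
        have "cls Q RQ (?r (single c p)) = bhom (single c h)"
          using True D.peq_cls[OF h(2)] by (simp add: bhom_def D.single_mult_idem D.idem_mult_single)
        then show ?thesis using single_carrier[OF h(1)] by blast
      next
        case False
        then have "cls Q RQ (?r (single c p)) = bhom (\<lambda>_. 0)"
          by (auto simp: bhom_def D.single_mult_idem D.idem_mult_single)
        then show ?thesis using zero_carrier by blast
      qed
      then obtain h where h: "h \<in> carrier (path_alg G)" "cls Q RQ (?r (single c p)) = bhom h"
        by blast
      have "cls Q RQ (?r (\<lambda>q. f q + single c p q)) = bhom (\<lambda>p. g p + h p)"
        unfolding bhom_add[OF g(1) h(1)] g(2)[symmetric] h(2)[symmetric] mult_add_left mult_add_right
        using ring_hom_add[OF D.cls_hom carr] by simp
      then show ?case using add_carrier[OF g(1) h(1)] by blast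
    qed
    then show "x \<in> bhom ` carrier (path_alg G)" using x by simp
  qed
qed

lemma bhom_eq_zero_iff:
  assumes "f \<in> carrier (path_alg G)"
  shows "bhom f = zero target \<longleftrightarrow> push pmap f \<in> D.rel_ideal"
  using D.cls_eq_zero_iff[OF push_pmap_carrier[OF assms]] by (simp add: bhom_def corner_def)

text \<open>Modulo the ideal every path is replaced by a chosen representative \<open>\<rho>\<close> of its start, end and
  degree; the coefficient of \<open>\<rho>\<close> is then read off from the push-forward along \<open>path_data\<close>.\<close>

lemma push_pmap_ideal_imp:
  assumes f: "f \<in> carrier (path_alg G)" and ker: "push pmap f \<in> D.rel_ideal"
  shows "f \<in> G.rel_ideal"
proof -
  let ?d = "D.path_data w \<circ> pmap"
  define \<rho> where "\<rho> d = (SOME p. is_path G p \<and> ?d p = d)" for d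
  have \<rho>: "is_path G (\<rho> (?d p)) \<and> ?d (\<rho> (?d p)) = ?d p" if "is_path G p" for p
    unfolding \<rho>_def by (rule someI[of _ p]) (use that in simp)
  have "G.peq p (\<rho> (?d p))" if p: "is_path G p" for p
  proof -
    let ?q = "\<rho> (?d p)"
    have q: "is_path G ?q" "?d ?q = ?d p" using \<rho>[OF p] by auto
    then have "vm (fst ?q) = vm (fst p)" "vm (pend G ?q) = vm (pend G p)"
      "sum_list (map w (snd (pmap ?q))) = sum_list (map w (snd (pmap p)))"
      by (auto simp: D.path_data_def is_path_pmap p)
    then show ?thesis
      using p q inj_onD[OF inj_vm] by (intro faithful) (auto simp: is_path_def G.pend_verts)
  qed
  note eqv = this
  have "(\<lambda>p. f p + - push (\<rho> \<circ> ?d) f p) \<in> G.rel_ideal"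
    using f
  proof (induction rule: path_alg_induct)
    case zero
    then show ?case by (simp add: G.rel_ideal_zero)
  next
    case (add f c p)
    have "(\<lambda>x. (f x + - push (\<rho> \<circ> ?d) f x) + (single c p x + single (- c) (\<rho> (?d p)) x)) \<in> G.rel_ideal"
      by (rule G.rel_ideal_add[OF add.IH G.peq_scale[OF eqv[OF add.hyps(2)]]])
    also have "(\<lambda>x. (f x + - push (\<rho> \<circ> ?d) f x) + (single c p x + single (- c) (\<rho> (?d p)) x))
       = (\<lambda>x. (f x + single c p x) + - push (\<rho> \<circ> ?d) (\<lambda>q. f q + single c p q) x)"
      unfolding push_add[OF G.finite_supp_carrier[OF add.hyps(1)] finite_supp_single] push_single
      by (auto simp: single_def)
    finally show ?case .
  qed
  \<comment> \<open>As \<open>\<rho>\<close> sees only the data, this push-forward factors through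
    the data of \<open>push pmap f\<close>, which vanish because it lies in an ideal with
    homogeneous generators.\<close>
  moreover have "push (\<rho> \<circ> ?d) f = (\<lambda>_. 0)"
  proof -
    have fin: "finite {p. f p \<noteq> 0}" using f by (rule G.finite_supp_carrier)
    have "push (\<rho> \<circ> ?d) f = push \<rho> (push (D.path_data w) (push pmap f))"
      using fin by (simp add: push_push finite_supp_push comp_assoc)
    also have "push (D.path_data w) (push pmap f) = (\<lambda>_. 0)"
      using rels_homogeneous ker by (rule D.push_path_data_ideal)
    finally show ?thesis by (simp only: push_zero)
  qed
  ultimately show ?thesis by simp
qed

lemma kernel_bhom: "a_kernel (path_alg G) target bhom = G.rel_ideal"
proof
  have "ideal (a_kernel (path_alg G) target bhom) (path_alg G)"
    by (rule ring_hom_ring.kernel_is_ideal[OF ring_hom_ring_bhom])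
  then show "G.rel_ideal \<subseteq> a_kernel (path_alg G) target bhom"
  proof (rule ring.genideal_minimal[OF G.ring_path_alg])
    show "RG \<subseteq> a_kernel (path_alg G) target bhom"
    proof
      fix r assume r: "r \<in> RG"
      then have "r \<in> carrier (path_alg G)" using G.rels_carrier by blast
      with bhom_eq_zero_iff[OF this] rels_mapped[OF r]
      show "r \<in> a_kernel (path_alg G) target bhom" unfolding a_kernel_def' by blast
    qed
  qed
  show "a_kernel (path_alg G) target bhom \<subseteq> G.rel_ideal"
    using push_pmap_ideal_imp by (auto simp: a_kernel_def' bhom_eq_zero_iff)
qed

theorem corner_iso:
  "\<exists>\<phi>. \<phi> \<in> ring_iso (quot_alg G RG) target
     \<and> (\<forall>f\<in>carrier (path_alg G). \<phi> (cls G RG f) = cls Q RQ (push pmap f))"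
proof (intro exI conjI ballI)
  show "(\<lambda>X. the_elem (bhom ` X)) \<in> ring_iso (quot_alg G RG) target"
    using ring_hom_ring.FactRing_iso_set[OF ring_hom_ring_bhom bhom_surj]
    unfolding kernel_bhom quot_alg_def[of G RG] .
  show "the_elem (bhom ` cls G RG f) = cls Q RQ (push pmap f)" if "f \<in> carrier (path_alg G)" for f
    using ring_hom_ring.the_elem_simp[OF ring_hom_ring_bhom that]
    unfolding kernel_bhom cls_def[of G RG, symmetric] bhom_def[of f] .
qed

end

section \<open>Triangulations of a polygon\<close>

text \<open>Strict anticlockwise order of three polygon vertices. Being invariant under rotation, it
  avoids the case distinctions caused by the linear order in \<open>crosses\<close>.\<close>

definition cyc :: "nat \<Rightarrow> nat \<Rightarrow> nat \<Rightarrow> bool" where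
  "cyc a b c \<longleftrightarrow> a < b \<and> b < c \<or> b < c \<and> c < a \<or> c < a \<and> a < b"

locale polygon_triangulation =
  fixes n :: nat and T :: "nat set set"
  assumes n3: "n \<ge> 3" and tri: "triangulation n T"
begin

definition pv :: "nat \<Rightarrow> nat \<Rightarrow> nat" where
  "pv j d = (j + d - 1) mod n + 1"

text \<open>The number of anticlockwise steps from \<open>j\<close> to \<open>k\<close>, inverse to
  \<open>pv j\<close>. Seen from \<open>j\<close>, cyclic order becomes the order of these numbers;
  they also supply the angles of the grading.\<close>

definition off :: "nat \<Rightarrow> nat \<Rightarrow> nat" where
  "off j k = (if j \<le> k then k - j else k + n - j)"

lemma pv_if: "j \<in> {1..n} \<Longrightarrow> d \<le> n \<Longrightarrow> pv j d = (if j + d \<le> n then j + d else j + d - n)"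
  by (auto simp: pv_def mod_if)

lemma pv_range: "pv j d \<in> {1..n}"
  using n3 by (simp add: pv_def Suc_leI)

lemma off_pv: "j \<in> {1..n} \<Longrightarrow> d < n \<Longrightarrow> off j (pv j d) = d"
  by (auto simp: pv_if off_def)

lemma pv_off: "j \<in> {1..n} \<Longrightarrow> k \<in> {1..n} \<Longrightarrow> pv j (off j k) = k"
  by (subst pv_if) (auto simp: off_def)

lemma off_less: "j \<in> {1..n} \<Longrightarrow> k \<in> {1..n} \<Longrightarrow> off j k < n"
  by (auto simp: off_def)

lemma off_pos: "j \<in> {1..n} \<Longrightarrow> k \<in> {1..n} \<Longrightarrow> j \<noteq> k \<Longrightarrow> 1 \<le> off j k"
  by (auto simp: off_def)

lemma cyc_off:
  assumes "j \<in> {1..n}" "a \<in> {1..n}" "b \<in> {1..n}" "j \<noteq> a" "j \<noteq> b"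
  shows "cyc j a b \<longleftrightarrow> off j a < off j b"
  using assms by (auto simp: cyc_def off_def)

abbreviation nadj :: "nat \<Rightarrow> nat \<Rightarrow> bool" where "nadj \<equiv> adj n T"

lemma mod_succ_if: "i \<in> {1..n} \<Longrightarrow> i mod n + 1 = (if i = n then 1 else i + 1)"
  by auto

lemma poly_edge_alt:
  "poly_edge n i j \<longleftrightarrow> i \<in> {1..n} \<and> j \<in> {1..n}
     \<and> (j = i + 1 \<or> i = j + 1 \<or> i = 1 \<and> j = n \<or> i = n \<and> j = 1)"
proof (cases "i \<in> {1..n} \<and> j \<in> {1..n}")
  case True
  then show ?thesis
    unfolding poly_edge_def using mod_succ_if[of i] mod_succ_if[of j] by auto
qed (auto simp: poly_edge_def)

lemma nadj_sym: "nadj i j \<longleftrightarrow> nadj j i"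
  by (auto simp: adj_def poly_edge_def insert_commute)

lemma nadj_range:
  assumes "nadj i j" shows "i \<in> {1..n}" "j \<in> {1..n}" "i \<noteq> j"
proof -
  have "i \<in> {1..n} \<and> j \<in> {1..n} \<and> i \<noteq> j"
  proof (cases "poly_edge n i j")
    case True
    then show ?thesis using n3 by (auto simp: poly_edge_alt)
  next
    case False
    then have "is_diag n {i, j}" using assms tri by (auto simp: adj_def triangulation_def)
    then show ?thesis by (auto simp: is_diag_def doubleton_eq_iff)
  qed
  then show "i \<in> {1..n}" "j \<in> {1..n}" "i \<noteq> j" by auto
qed

lemma crossesI:
  assumes "cyc a c b" "cyc b d a" shows "crosses {a, b} {c, d}"
proof -
  consider "a < c" "c < b" "b < d" | "c < b" "b < d" "d < a" | "b < d" "d < a" "a < c"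
    | "d < a" "a < c" "c < b"
    using assms by (auto simp: cyc_def)
  then show ?thesis
  proof cases
    case 1 then show ?thesis unfolding crosses_def by blast
  next
    case 2 then show ?thesis unfolding crosses_def
      by (intro exI[of _ c] exI[of _ d] exI[of _ b] exI[of _ a]) auto
  next
    case 3 then show ?thesis unfolding crosses_def
      by (intro exI[of _ b] exI[of _ a] exI[of _ d] exI[of _ c]) auto
  next
    case 4 then show ?thesis unfolding crosses_def
      by (intro exI[of _ d] exI[of _ c] exI[of _ a] exI[of _ b]) auto
  qed
qed

lemma crossesD:
  assumes "crosses e {b, c}"
  obtains p q where "e = {p, q}" "cyc b p c" "cyc c q b"
proof -
  obtain x y z w where *: "e = {x, y} \<and> {b, c} = {z, w} \<or> {b, c} = {x, y} \<and> e = {z, w}"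
    "x < z" "z < y" "y < w"
    using assms by (auto simp: crosses_def)
  then have "e = {x, y} \<and> (b = z \<and> c = w \<or> b = w \<and> c = z) \<or> e = {z, w} \<and> (b = x \<and> c = y \<or> b = y \<and> c = x)"
    by (auto simp: doubleton_eq_iff)
  then show ?thesis
    using *(2-4) that[of x y] that[of y x] that[of z w] that[of w z]
    by (auto simp: cyc_def insert_commute)
qed

text \<open>An edge of the polygon has no vertex strictly between its ends on one side, so nothing
  crosses it. For two diagonals this is the noncrossing condition of the triangulation.\<close>

lemma noncrossing:
  assumes "nadj a b" "nadj c d" "cyc a c b" "cyc b d a"
  shows False
proof (cases "poly_edge n a b \<or> poly_edge n c d")
  case True
  then show ?thesis
    using assms(3,4) nadj_range[OF assms(1)] nadj_range[OF assms(2)]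
    by (auto simp: poly_edge_alt cyc_def)
next
  case False
  then have "{a, b} \<in> T" "{c, d} \<in> T" using assms by (auto simp: adj_def)
  then show False using crossesI[OF assms(3,4)] tri by (auto simp: triangulation_def)
qed

text \<open>Here maximality of the triangulation enters. If \<open>bc\<close> were missing, some
  diagonal \<open>pq\<close> of \<open>T\<close> would cross it, with \<open>p\<close> between
  \<open>b\<close> and \<open>c\<close> and \<open>q\<close> on the side of \<open>a\<close>. If
  \<open>q = a\<close>, then \<open>p\<close> is a forbidden neighbour of \<open>a\<close>;
  otherwise \<open>pq\<close> crosses \<open>ab\<close> or \<open>ac\<close>.\<close>

lemma nadj_consecutive:
  assumes "nadj a b" "nadj a c" "cyc a b c" and free: "\<And>d. nadj a d \<Longrightarrow> \<not> cyc b d c"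
  shows "nadj b c"
proof (rule ccontr)
  assume "\<not> nadj b c"
  have range: "a \<in> {1..n}" "b \<in> {1..n}" "c \<in> {1..n}" "a \<noteq> b" "a \<noteq> c"
    using nadj_range[OF assms(1)] nadj_range[OF assms(2)] by auto
  have "b \<noteq> c" using assms(3) by (auto simp: cyc_def)
  with \<open>\<not> nadj b c\<close> range have "is_diag n {b, c}" "{b, c} \<notin> T"
    by (auto simp: is_diag_def adj_def)
  then obtain e where e: "e \<in> T" "crosses {b, c} e" using tri by (auto simp: triangulation_def)
  then have "crosses e {b, c}" unfolding crosses_def by blast
  then obtain p q where pq: "e = {p, q}" "cyc b p c" "cyc c q b" by (rule crossesD)
  have adj: "nadj p q" "nadj q p" using e pq by (auto simp: adj_def insert_commute)
  show False
  proof (cases "q = a")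
    case True
    then show False using free[of p] adj pq by auto
  next
    case False
    then have "cyc a q b \<or> cyc c q a" using pq(3) assms(3) by (auto simp: cyc_def)
    then show False
    proof
      assume "cyc a q b"
      moreover have "cyc b p a" using pq(2) assms(3) by (auto simp: cyc_def)
      ultimately show False using noncrossing[OF assms(1) adj(2)] by blast
    next
      assume "cyc c q a"
      moreover have "cyc a p c" using pq(2) assms(3) by (auto simp: cyc_def)
      ultimately show False using noncrossing[of c a q p] adj(2) assms(2) nadj_sym by blast
    qed
  qed
qed

section \<open>Triangles as corners between consecutive neighbours of a polygon vertex\<close>

definition tri_cyc :: "nat \<Rightarrow> nat \<Rightarrow> nat \<Rightarrow> bool" where
  "tri_cyc a b c \<longleftrightarrow> cyc a b c \<and> nadj a b \<and> nadj b c \<and> nadj c a"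

lemma tri_cyc_rotate: "tri_cyc a b c \<Longrightarrow> tri_cyc b c a"
  by (auto simp: tri_cyc_def cyc_def)

text \<open>\<open>is_triangle\<close> lists the corners in increasing order, whereas rotations need
  a triangle to be readable from any of its corners; \<open>tri_cyc\<close> is the version closed
  under cyclic shifts.\<close>

lemma tri_cyc_iff:
  "tri_cyc a b c \<longleftrightarrow> is_triangle n T a b c \<or> is_triangle n T b c a \<or> is_triangle n T c a b"
proof
  assume t: "tri_cyc a b c"
  then have "a \<in> {1..n}" "b \<in> {1..n}" "c \<in> {1..n}"
    using nadj_range unfolding tri_cyc_def by blast+
  with t show "is_triangle n T a b c \<or> is_triangle n T b c a \<or> is_triangle n T c a b"
    using nadj_sym unfolding tri_cyc_def cyc_def is_triangle_def by auto
next
  assume "is_triangle n T a b c \<or> is_triangle n T b c a \<or> is_triangle n T c a b"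
  then show "tri_cyc a b c"
    using nadj_sym unfolding tri_cyc_def cyc_def is_triangle_def by auto
qed

definition offs :: "nat \<Rightarrow> nat list" where
  "offs j = filter (\<lambda>d. nadj j (pv j d)) [1..<n]"

abbreviation nb :: "nat \<Rightarrow> nat list" where "nb \<equiv> nbrs n T"

lemma nb_offs: "nb j = map (pv j) (offs j)"
  by (simp add: nbrs_def offs_def pv_def)

lemma length_nb: "length (nb j) = length (offs j)"
  by (simp add: nb_offs)

lemma nb_nth: "i < length (nb j) \<Longrightarrow> nb j ! i = pv j (offs j ! i)"
  by (simp add: nb_offs)

lemma set_offs: "set (offs j) = {d \<in> {1..<n}. nadj j (pv j d)}"
  by (auto simp: offs_def)

lemma offs_range: "i < length (nb j) \<Longrightarrow> offs j ! i \<in> {1..<n} \<and> nadj j (nb j ! i)"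
  using set_offs[of j] nth_mem[of i "offs j"] by (auto simp: length_nb nb_nth)

lemma offs_mono: "i < k \<Longrightarrow> k < length (nb j) \<Longrightarrow> offs j ! i < offs j ! k"
proof -
  have "sorted_wrt (<) (offs j)" by (simp add: offs_def sorted_wrt_filter)
  then show "i < k \<Longrightarrow> k < length (nb j) \<Longrightarrow> offs j ! i < offs j ! k"
    by (simp add: sorted_wrt_nth_less length_nb)
qed

lemma nb_ex:
  assumes "nadj j k" obtains i where "i < length (nb j)" "nb j ! i = k"
proof -
  have "off j k \<in> set (offs j)"
    using nadj_range[OF assms] assms off_pos off_less pv_off by (auto simp: set_offs)
  then obtain i where "i < length (offs j)" "offs j ! i = off j k" by (metis in_set_conv_nth)
  then show ?thesis
    using that[of i] nadj_range[OF assms] pv_off by (simp add: nb_nth length_nb)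
qed

lemma nb_adj: "i < length (nb j) \<Longrightarrow> nadj j (nb j ! i)"
  using offs_range by blast

lemma off_nb: "j \<in> {1..n} \<Longrightarrow> i < length (nb j) \<Longrightarrow> off j (nb j ! i) = offs j ! i"
  using offs_range[of i j] by (simp add: nb_nth off_pv)

lemma nb_inj: "j \<in> {1..n} \<Longrightarrow> i < length (nb j) \<Longrightarrow> k < length (nb j) \<Longrightarrow> nb j ! i = nb j ! k \<longleftrightarrow> i = k"
  using off_nb offs_mono by (metis less_irrefl nat_neq_iff)

lemma nb_cyc:
  assumes "j \<in> {1..n}" "i < length (nb j)" "k < length (nb j)"
  shows "cyc j (nb j ! i) (nb j ! k) \<longleftrightarrow> i < k"
proof -
  have "cyc j (nb j ! i) (nb j ! k) \<longleftrightarrow> offs j ! i < offs j ! k"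
    using cyc_off[of j "nb j ! i" "nb j ! k"] assms nadj_range[OF nb_adj[OF assms(2)]] nadj_range[OF nb_adj[OF assms(3)]]
    by (simp add: off_nb)
  then show ?thesis using offs_mono assms by (metis less_irrefl nat_neq_iff not_less_iff_gr_or_eq)
qed

text \<open>The two neighbouring polygon vertices are always adjacent to \<open>j\<close>, at
  offsets 1 and \<open>n - 1\<close>. Hence a full rotation at \<open>j\<close> runs from one
  incident polygon edge to the other.\<close>

lemma offs_ends:
  assumes "j \<in> {1..n}"
  shows "offs j = 1 # tl (offs j)" "last (offs j) = n - 1" "2 \<le> length (offs j)"
proof -
  have adj: "nadj j (pv j 1)" "nadj j (pv j (n - 1))"
    using assms n3 by (auto simp: adj_def poly_edge_alt pv_if mod_succ_if)
  have "[1..<n] = 1 # [2..<n - 1] @ [n - 1]"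
    using n3 upt_conv_Cons[of 1 n] upt_Suc_append[of 2 "n - 1"]
    by (simp add: numeral_2_eq_2)
  then have eq: "offs j = 1 # filter (\<lambda>d. nadj j (pv j d)) [2..<n - 1] @ [n - 1]"
    using adj by (simp add: offs_def)
  show "offs j = 1 # tl (offs j)" "last (offs j) = n - 1" "2 \<le> length (offs j)"
    by (simp_all add: eq)
qed

lemma nb_first:
  assumes "j \<in> {1..n}" shows "nb j ! 0 = j mod n + 1"
proof -
  have "offs j ! 0 = 1" using offs_ends(1)[OF assms] by (metis nth_Cons_0)
  moreover have "0 < length (nb j)" using offs_ends(3)[OF assms] unfolding length_nb by linarith
  ultimately show ?thesis by (simp add: nb_nth pv_def)
qed

lemma nb_last:
  assumes "j \<in> {1..n}" shows "nb j ! (length (nb j) - 1) = pv j (n - 1)"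
proof -
  have "offs j \<noteq> []" using offs_ends(3)[OF assms] by auto
  then have "length (nb j) - 1 < length (nb j)" "offs j ! (length (nb j) - 1) = n - 1"
    using offs_ends(2)[OF assms] last_conv_nth[of "offs j"] by (auto simp: length_nb)
  then show ?thesis by (simp add: nb_nth)
qed

lemma nb_length: "j \<in> {1..n} \<Longrightarrow> 2 \<le> length (nb j)"
  using offs_ends by (simp add: length_nb)

text \<open>No neighbour of \<open>j\<close> lies between two consecutive ones, which is exactly the
  hypothesis of \<open>nadj_consecutive\<close>.\<close>

lemma tri_cyc_nb:
  assumes "j \<in> {1..n}" "Suc i < length (nb j)"
  shows "tri_cyc j (nb j ! i) (nb j ! Suc i)"
proof -
  have i: "i < length (nb j)" using assms by simp
  have c: "cyc j (nb j ! i) (nb j ! Suc i)" using assms by (simp add: nb_cyc)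
  have "nadj (nb j ! i) (nb j ! Suc i)"
  proof (rule nadj_consecutive[OF nb_adj[OF i] nb_adj[OF assms(2)] c])
    fix d assume "nadj j d"
    then obtain k where k: "k < length (nb j)" "nb j ! k = d" by (rule nb_ex)
    show "\<not> cyc (nb j ! i) d (nb j ! Suc i)"
    proof
      assume "cyc (nb j ! i) d (nb j ! Suc i)"
      then have "cyc j (nb j ! i) d" "cyc j d (nb j ! Suc i)"
        using c nadj_range[OF \<open>nadj j d\<close>] by (auto simp: cyc_def)
      then show False using k assms i by (auto simp: nb_cyc)
    qed
  qed
  then show ?thesis using c nb_adj[OF i] nb_adj[OF assms(2)] nadj_sym by (auto simp: tri_cyc_def)
qed

text \<open>Conversely, a neighbour of \<open>j\<close> strictly between \<open>b\<close> and
  \<open>c\<close> would give a diagonal from \<open>j\<close> crossing \<open>bc\<close>.\<close>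

lemma nb_tri_cyc:
  assumes "tri_cyc j b c"
  obtains i where "Suc i < length (nb j)" "nb j ! i = b" "nb j ! Suc i = c"
proof -
  have adj: "nadj j b" "nadj j c" "cyc j b c" "nadj b c"
    using assms nadj_sym by (auto simp: tri_cyc_def)
  have j: "j \<in> {1..n}" using nadj_range[OF adj(1)] by simp
  obtain i where i: "i < length (nb j)" "nb j ! i = b" using adj(1) by (rule nb_ex)
  obtain k where k: "k < length (nb j)" "nb j ! k = c" using adj(2) by (rule nb_ex)
  have "i < k" using adj(3) nb_cyc[OF j i(1) k(1)] i k by simp
  have "k = Suc i"
  proof (rule ccontr)
    assume "k \<noteq> Suc i"
    with \<open>i < k\<close> have m: "Suc i < k" "Suc i < length (nb j)" using k(1) by auto
    let ?d = "nb j ! Suc i"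
    have "cyc j b ?d" "cyc j ?d c"
      using nb_cyc[OF j i(1) m(2)] nb_cyc[OF j m(2) k(1)] m i k by auto
    then have "cyc b ?d c" "cyc c j b" using adj(3) by (auto simp: cyc_def)
    then show False
      using noncrossing[OF adj(4) _ \<open>cyc b ?d c\<close> \<open>cyc c j b\<close>] nb_adj[OF m(2)] nadj_sym by blast
  qed
  then show ?thesis using that[of i] i k by simp
qed

end

section \<open>The dimer algebra of a triangulation\<close>

lemma face_rest_split:
  assumes "a \<notin> set ys"
  shows "face_rest (ys @ a # zs) a = zs @ ys"
proof -
  have "(LEAST i. i < length (ys @ a # zs) \<and> (ys @ a # zs) ! i = a) = length ys"
  proof (rule Least_equality)
    fix i assume i: "i < length (ys @ a # zs) \<and> (ys @ a # zs) ! i = a"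
    show "length ys \<le> i"
    proof (rule ccontr)
      assume "\<not> length ys \<le> i"
      then have "ys ! i = a" "i < length ys" using i by (auto simp: nth_append)
      then show False using assms nth_mem by blast
    qed
  qed simp
  then show ?thesis by (simp add: face_rest_def rotate_append)
qed

lemma dimer_relsI:
  assumes "internal_arrow Q a" "F \<in> posf Q" "G \<in> negf Q" "a \<in> set F" "a \<in> set G"
  shows "(\<lambda>q. bpath (tgt Q a, face_rest F a) q - bpath (tgt Q a, face_rest G a) q) \<in> dimer_rels Q"
  unfolding dimer_rels_def using assms by blast

context polygon_triangulation
begin

abbreviation D :: "(qv, qa) dimer" where "D \<equiv> QT n T"

lemma QT_simps [simp]:
  "verts D = Bnd ` {1..2 * n} \<union> {Dg i j | i j. i < j \<and> {i, j} \<in> T}"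
  "tgt D (X k) = Bnd k"
  "src D (Ar a b c) = side n a b" "tgt D (Ar a b c) = side n c a"
  "posf D = white_face n T ` {1..n}"
  "negf D = {[Ar a b c, Ar c a b, Ar b c a] | a b c. is_triangle n T a b c}"
  by (simp_all add: QT_def)

lemma src_X: "src D (X k) = Bnd (if k = 1 then 2 * n else k - 1)"
  by (simp add: QT_def)

lemma arrs_QT: "a \<in> arrs D \<longleftrightarrow> (\<exists>k\<in>{1..2 * n}. a = X k) \<or> (\<exists>A B C. tri_cyc A B C \<and> a = Ar A B C)"
  unfolding QT_def tri_cyc_iff by auto

lemma X_arrs: "X k \<in> arrs D \<longleftrightarrow> k \<in> {1..2 * n}"
  by (auto simp: arrs_QT)

lemma Ar_arrs: "Ar A B C \<in> arrs D \<longleftrightarrow> tri_cyc A B C"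
  by (auto simp: arrs_QT)

lemma side_sym: "i \<in> {1..n} \<Longrightarrow> j \<in> {1..n} \<Longrightarrow> side n i j = side n j i"
  using n3 mod_succ_if[of i] mod_succ_if[of j]
  by (auto simp: side_def min.commute max.commute split: if_splits)

lemma side_verts:
  assumes "nadj i j" shows "side n i j \<in> verts D"
proof -
  note r = nadj_range[OF assms]
  show ?thesis
  proof (cases "poly_edge n i j")
    case True
    then show ?thesis using r by (auto simp: side_def poly_edge_def)
  next
    case False
    then have "{i, j} \<in> T" using assms by (simp add: adj_def)
    moreover have "{i, j} = {min i j, max i j}" by (auto simp: min_def max_def)
    ultimately have "{min i j, max i j} \<in> T" by simp
    moreover have "min i j < max i j" using r by auto
    ultimately have "Dg (min i j) (max i j) \<in> verts D" by auto
    then show ?thesis using False r by (auto simp: side_def poly_edge_def)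
  qed
qed

lemma side_cases:
  obtains s where "side n a b = Bnd (2 * s)" "{a, b} = {s, s mod n + 1}"
  | "side n a b = Dg (min a b) (max a b)"
proof -
  consider "b = a mod n + 1" | "b \<noteq> a mod n + 1" "a = b mod n + 1"
    | "b \<noteq> a mod n + 1" "a \<noteq> b mod n + 1"
    by blast
  then show ?thesis
  proof cases
    case 1
    then show ?thesis using that(1)[of a] by (simp add: side_def)
  next
    case 2
    then show ?thesis using that(1)[of b] by (simp add: side_def insert_commute)
  next
    case 3
    then show ?thesis using that(2) by (simp add: side_def)
  qed
qed

text \<open>Needed to decide which arrows can continue a rotation: an arrow leaving the midpoint of
  a side belongs to a corner at one of the two ends of that side.\<close>

lemma side_inj:
  assumes "side n a b = side n c d"
  shows "a = c \<and> b = d \<or> a = d \<and> b = c"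
proof -
  have "{a, b} = {c, d}"
  proof (cases a b rule: side_cases)
    case s: (1 s)
    show ?thesis
      by (cases c d rule: side_cases) (use s assms in auto)
  next
    case ab: 2
    then have "side n c d = Dg (min c d) (max c d)"
      by (cases c d rule: side_cases) (use assms in auto)
    then have "min a b = min c d" "max a b = max c d" using ab assms by auto
    then show ?thesis by (auto simp: min_def max_def split: if_splits)
  qed
  then show ?thesis by (auto simp: doubleton_eq_iff)
qed

lemma finite_verts_QT: "finite (verts D)"
proof -
  have "{Dg i j | i j. i < j \<and> {i, j} \<in> T} \<subseteq> (\<lambda>(i, j). Dg i j) ` ({1..n} \<times> {1..n})"
  proof
    fix x assume "x \<in> {Dg i j | i j. i < j \<and> {i, j} \<in> T}"
    then obtain i j where "x = Dg i j" "nadj i j" by (auto simp: adj_def)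
    then show "x \<in> (\<lambda>(i, j). Dg i j) ` ({1..n} \<times> {1..n})" using nadj_range[of i j] by auto
  qed
  then have "finite {Dg i j | i j. i < j \<and> {i, j} \<in> T}" by (rule finite_subset) simp
  then show ?thesis by simp
qed

lemma fin_quiver_QT: "fin_quiver D"
proof
  show "finite (verts D)" by (rule finite_verts_QT)
  fix a assume "a \<in> arrs D"
  then show "src D a \<in> verts D" "tgt D a \<in> verts D"
    unfolding arrs_QT using side_verts n3 by (auto simp: tri_cyc_def src_X simp del: QT_simps(1)) (auto simp: image_iff)
qed

text \<open>The path that turns around the polygon vertex \<open>j\<close> from its
  \<open>a\<close>-th to its \<open>b\<close>-th neighbour, one triangle corner per arrow.\<close>

definition rot :: "nat \<Rightarrow> nat \<Rightarrow> nat \<Rightarrow> qa list" where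
  "rot j a b = map (\<lambda>i. Ar j (nb j ! i) (nb j ! Suc i)) [a..<b]"

abbreviation lst :: "nat \<Rightarrow> nat" where "lst j \<equiv> length (nb j) - 1"

lemma white_face_eq: "white_face n T j = X (2 * j) # rot j 0 (lst j) @ [X (2 * j - 1)]"
  by (simp add: white_face_def rot_def Let_def)

lemma rot_Nil [simp]: "rot j a a = []"
  by (simp add: rot_def)

lemma rot_append: "a \<le> b \<Longrightarrow> b \<le> c \<Longrightarrow> rot j a b @ rot j b c = rot j a c"
  using upt_add_eq_append[of a b "c - b"] by (simp add: rot_def flip: map_append)

lemma rot_Suc: "a \<le> b \<Longrightarrow> rot j a (Suc b) = rot j a b @ [Ar j (nb j ! b) (nb j ! Suc b)]"
  by (simp add: rot_def)

lemma rot_Cons: "a < b \<Longrightarrow> rot j a b = Ar j (nb j ! a) (nb j ! Suc a) # rot j (Suc a) b"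
  by (simp add: rot_def upt_conv_Cons)

lemma rot_split:
  assumes "i < b" shows "rot j 0 b = rot j 0 i @ Ar j (nb j ! i) (nb j ! Suc i) # rot j (Suc i) b"
  using assms rot_append[of 0 i b j] rot_Cons[of i b j] by simp

lemma set_rot: "set (rot j 0 (lst j)) = {Ar j b c | b c. tri_cyc j b c}" if "j \<in> {1..n}"
proof (intro equalityI subsetI)
  fix x assume "x \<in> set (rot j 0 (lst j))"
  then show "x \<in> {Ar j b c | b c. tri_cyc j b c}"
    using tri_cyc_nb[OF that] by (auto simp: rot_def)
next
  fix x assume "x \<in> {Ar j b c | b c. tri_cyc j b c}"
  then obtain b c where "x = Ar j b c" "tri_cyc j b c" by blast
  moreover from this(2) obtain i where "Suc i < length (nb j)" "nb j ! i = b" "nb j ! Suc i = c"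
    by (rule nb_tri_cyc)
  ultimately show "x \<in> set (rot j 0 (lst j))" unfolding rot_def by force
qed

lemma set_white_face:
  "j \<in> {1..n} \<Longrightarrow> set (white_face n T j) = {X (2 * j), X (2 * j - 1)} \<union> {Ar j b c | b c. tri_cyc j b c}"
  unfolding white_face_eq using set_rot by auto

lemma tri_cyc_range: "tri_cyc a b c \<Longrightarrow> a \<in> {1..n}"
  using nadj_range unfolding tri_cyc_def by blast

section \<open>Faces, internal arrows and boundary arrows\<close>

lemma posf_of_Ar:
  assumes "tri_cyc a b c" shows "{F \<in> posf D. Ar a b c \<in> set F} = {white_face n T a}"
  using assms tri_cyc_range[OF assms] by (auto simp: set_white_face)

text \<open>A black face is stored as a list beginning at its smallest corner, so the given arrow
  may be at any of three positions. The split into \<open>ys\<close> and \<open>zs\<close> hides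
  this position; read cyclically, the rest of the face is always the same.\<close>

lemma negf_of_Ar:
  assumes "tri_cyc a b c"
  shows "\<exists>ys zs. {F \<in> negf D. Ar a b c \<in> set F} = {ys @ Ar a b c # zs} \<and> Ar a b c \<notin> set ys
     \<and> zs @ ys = [Ar c a b, Ar b c a]"
proof -
  have distinct: "a \<noteq> b" "b \<noteq> c" "a \<noteq> c" using assms by (auto simp: tri_cyc_def cyc_def)
  define tf where "tf x y z = [Ar x y z, Ar z x y, Ar y z x]" for x y z
  have mem: "Ar a b c \<in> set (tf x y z) \<longleftrightarrow> x = a \<and> y = b \<and> z = c \<or> x = b \<and> y = c \<and> z = a \<or> x = c \<and> y = a \<and> z = b"
    for x y z by (auto simp: tf_def)
  have negf: "negf D = {tf x y z | x y z. is_triangle n T x y z}" by (simp add: tf_def)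
  have sorted: "is_triangle n T x y z \<Longrightarrow> \<not> is_triangle n T y z x \<and> \<not> is_triangle n T z x y" for x y z
    by (simp add: is_triangle_def)
  consider "is_triangle n T a b c" | "is_triangle n T b c a" | "is_triangle n T c a b"
    using assms tri_cyc_iff by blast
  then show ?thesis
  proof cases
    case 1
    then have "{F \<in> negf D. Ar a b c \<in> set F} = {tf a b c}"
      unfolding negf by (auto simp: mem dest: sorted)
    then show ?thesis
      by (intro exI[of _ "[]"] exI[of _ "[Ar c a b, Ar b c a]"]) (simp add: tf_def)
  next
    case 2
    then have "{F \<in> negf D. Ar a b c \<in> set F} = {tf b c a}"
      unfolding negf by (auto simp: mem dest: sorted)
    then show ?thesis
      using distinct by (intro exI[of _ "[Ar b c a]"] exI[of _ "[Ar c a b]"]) (simp add: tf_def)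
  next
    case 3
    then have "{F \<in> negf D. Ar a b c \<in> set F} = {tf c a b}"
      unfolding negf by (auto simp: mem dest: sorted)
    then show ?thesis
      using distinct by (intro exI[of _ "[Ar c a b, Ar b c a]"] exI[of _ "[]"]) (simp add: tf_def)
  qed
qed

lemma X_white_face: "j \<in> {1..n} \<Longrightarrow> X (2 * j) \<in> set (white_face n T j)"
  by (simp add: white_face_eq)

lemma internal_arrow_iff: "internal_arrow D x \<longleftrightarrow> (\<exists>a b c. tri_cyc a b c \<and> x = Ar a b c)"
  and bdry_arrow_iff: "bdry_arrow D x \<longleftrightarrow> (\<exists>k\<in>{1..2 * n}. x = X k)"
proof -
  have faces: "faces_of D x = {F \<in> posf D. x \<in> set F} \<union> {F \<in> negf D. x \<in> set F}" for x
    by (auto simp: faces_of_def)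
  have Ar: "internal_arrow D (Ar a b c) \<and> \<not> bdry_arrow D (Ar a b c)" if t: "tri_cyc a b c" for a b c
  proof -
    obtain ys zs where neg: "{F \<in> negf D. Ar a b c \<in> set F} = {ys @ Ar a b c # zs}"
      and yz: "zs @ ys = [Ar c a b, Ar b c a]"
      using negf_of_Ar[OF t] by blast
    \<comment> \<open>To count two faces, the white and the black one must differ as lists; the
      boundary arrow occurs only in the white one.\<close>
    have "X (2 * a) \<notin> set (ys @ Ar a b c # zs)"
      using arg_cong[OF yz, of set] by auto
    then have "white_face n T a \<noteq> ys @ Ar a b c # zs"
      using X_white_face[OF tri_cyc_range[OF t]] by metis
    then have "card (faces_of D (Ar a b c)) = 2"
      unfolding faces posf_of_Ar[OF t] neg by simp
    then show ?thesis
      using t by (simp add: internal_arrow_def bdry_arrow_def Ar_arrs posf_of_Ar[OF t] neg del: QT_simps)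
  qed
  have X: "bdry_arrow D (X k) \<and> \<not> internal_arrow D (X k)" if k: "k \<in> {1..2 * n}" for k
  proof -
    have "{F \<in> posf D. X k \<in> set F} = {white_face n T ((k + 1) div 2)}"
    proof -
      have "X k \<in> set (white_face n T j) \<longleftrightarrow> j = (k + 1) div 2" if "j \<in> {1..n}" for j
        using that by (auto simp: set_white_face)
      moreover have "(k + 1) div 2 \<in> {1..n}" using k by auto
      ultimately show ?thesis by auto
    qed
    moreover have "{F \<in> negf D. X k \<in> set F} = {}" by auto
    ultimately have "faces_of D (X k) = {white_face n T ((k + 1) div 2)}" unfolding faces by blast
    then have "card (faces_of D (X k)) = 1" by simp
    then show ?thesis using k by (simp add: internal_arrow_def bdry_arrow_def X_arrs)
  qed
  show "internal_arrow D x \<longleftrightarrow> (\<exists>a b c. tri_cyc a b c \<and> x = Ar a b c)"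
    using Ar X arrs_QT[of x] unfolding internal_arrow_def by blast
  show "bdry_arrow D x \<longleftrightarrow> (\<exists>k\<in>{1..2 * n}. x = X k)"
    using Ar X arrs_QT[of x] unfolding bdry_arrow_def by blast
qed

lemma bverts_QT: "bverts D = Bnd ` {1..2 * n}"
proof
  show "bverts D \<subseteq> Bnd ` {1..2 * n}"
    unfolding bverts_def bdry_arrow_iff using n3 by (auto simp: src_X intro!: imageI) arith+
  show "Bnd ` {1..2 * n} \<subseteq> bverts D"
    unfolding bverts_def bdry_arrow_iff by force
qed

text \<open>The white face at \<open>j\<close> without its \<open>i\<close>-th corner arrow, read
  from the end of that arrow: finish the rotation, pass the polygon corner along two boundary
  arrows, and rotate up to the gap.\<close>

definition white_rest :: "nat \<Rightarrow> nat \<Rightarrow> qa list" where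
  "white_rest j i = rot j (Suc i) (lst j) @ [X (2 * j - 1), X (2 * j)] @ rot j 0 i"

lemma face_rest_white:
  assumes "j \<in> {1..n}" "Suc i < length (nb j)"
  shows "face_rest (white_face n T j) (Ar j (nb j ! i) (nb j ! Suc i)) = white_rest j i"
proof -
  have i: "i < lst j" using assms by simp
  \<comment> \<open>\<open>face_rest\<close> cuts at the first occurrence, so the arrow must not
    occur earlier in the face.\<close>
  have "Ar j (nb j ! i) (nb j ! Suc i) \<notin> set (X (2 * j) # rot j 0 i)"
    using assms by (auto simp: rot_def nb_inj)
  then show ?thesis
    unfolding white_face_eq rot_split[OF i] white_rest_def
    using face_rest_split[of _ "X (2 * j) # rot j 0 i"] by simp
qed

text \<open>Internal arrows correspond to triangle corners, that is, to pairs of consecutive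
  neighbours, so the relations can be indexed by a polygon vertex and a position in its neighbour
  list.\<close>

lemma dimer_rels_QT:
  "dimer_rels D = {(\<lambda>q. bpath (side n j (nb j ! Suc i), white_rest j i) q
      - bpath (side n j (nb j ! Suc i), [Ar (nb j ! Suc i) j (nb j ! i), Ar (nb j ! i) (nb j ! Suc i) j]) q)
     | i j. j \<in> {1..n} \<and> Suc i < length (nb j)}" (is "_ = ?R")
proof (intro equalityI subsetI)
  fix r assume "r \<in> dimer_rels D"
  then obtain x F H where r: "r = (\<lambda>q. bpath (tgt D x, face_rest F x) q - bpath (tgt D x, face_rest H x) q)"
    and x: "internal_arrow D x" "F \<in> posf D" "H \<in> negf D" "x \<in> set F" "x \<in> set H"
    unfolding dimer_rels_def by blast
  obtain a b c where abc: "tri_cyc a b c" "x = Ar a b c" using x(1) internal_arrow_iff by blast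
  obtain i where i: "Suc i < length (nb a)" "nb a ! i = b" "nb a ! Suc i = c"
    using abc(1) by (rule nb_tri_cyc)
  have F: "F = white_face n T a" using x(2,4) posf_of_Ar[OF abc(1)] abc(2) by blast
  obtain ys zs where neg: "{F \<in> negf D. Ar a b c \<in> set F} = {ys @ Ar a b c # zs}" "Ar a b c \<notin> set ys"
    and yz: "zs @ ys = [Ar c a b, Ar b c a]"
    using negf_of_Ar[OF abc(1)] by blast
  have "H = ys @ Ar a b c # zs" using neg(1) x(3,5) abc(2) by blast
  then have H: "face_rest H x = [Ar c a b, Ar b c a]"
    by (simp only: abc(2) face_rest_split[OF neg(2)] yz)
  have sd: "side n c a = side n a c"
    using tri_cyc_range[OF abc(1)] tri_cyc_range[OF tri_cyc_rotate[OF tri_cyc_rotate[OF abc(1)]]]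
    by (rule side_sym[rotated])
  have "r = (\<lambda>q. bpath (side n a (nb a ! Suc i), white_rest a i) q
      - bpath (side n a (nb a ! Suc i), [Ar (nb a ! Suc i) a (nb a ! i), Ar (nb a ! i) (nb a ! Suc i) a]) q)"
    using face_rest_white[OF tri_cyc_range[OF abc(1)] i(1)] r H sd by (simp add: F abc(2) i)
  then show "r \<in> ?R" using i(1) tri_cyc_range[OF abc(1)] by blast
next
  fix r assume "r \<in> ?R"
  then obtain i j where j: "j \<in> {1..n}" "Suc i < length (nb j)"
    and r: "r = (\<lambda>q. bpath (side n j (nb j ! Suc i), white_rest j i) q
      - bpath (side n j (nb j ! Suc i), [Ar (nb j ! Suc i) j (nb j ! i), Ar (nb j ! i) (nb j ! Suc i) j]) q)"
    by blast
  let ?x = "Ar j (nb j ! i) (nb j ! Suc i)"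
  have t: "tri_cyc j (nb j ! i) (nb j ! Suc i)" using tri_cyc_nb[OF j] .
  obtain ys zs where neg: "{F \<in> negf D. ?x \<in> set F} = {ys @ ?x # zs}" "?x \<notin> set ys"
    and yz: "zs @ ys = [Ar (nb j ! Suc i) j (nb j ! i), Ar (nb j ! i) (nb j ! Suc i) j]"
    using negf_of_Ar[OF t] by blast
  have mem: "ys @ ?x # zs \<in> negf D" "white_face n T j \<in> posf D" "?x \<in> set (white_face n T j)"
    using neg(1) posf_of_Ar[OF t] by (blast, blast, blast)
  have int: "internal_arrow D ?x" using internal_arrow_iff t by blast
  have "side n j (nb j ! Suc i) = tgt D ?x"
    using j(1) tri_cyc_range[OF tri_cyc_rotate[OF tri_cyc_rotate[OF t]]] by (simp add: side_sym)
  then have "r = (\<lambda>q. bpath (tgt D ?x, face_rest (white_face n T j) ?x) q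
      - bpath (tgt D ?x, face_rest (ys @ ?x # zs) ?x) q)"
    by (simp only: r face_rest_white[OF j] face_rest_split[OF neg(2)] yz)
  then show "r \<in> dimer_rels D"
    using dimer_relsI[OF int mem(2,1,3)] by (simp only: in_set_conv_decomp) blast
qed

lemma side_nb_first: "j \<in> {1..n} \<Longrightarrow> side n j (nb j ! 0) = Bnd (2 * j)"
  by (simp add: nb_first side_def)

lemma side_nb_last:
  assumes "j \<in> {1..n}" shows "side n j (nb j ! lst j) = src D (X (2 * j - 1))"
proof (cases "j = 1")
  case True
  then have "nb j ! lst j = n" using n3 assms unfolding nb_last[OF assms] by (simp add: pv_if)
  then show ?thesis using True n3 by (simp add: side_def src_X)
next
  case False
  then have "nb j ! lst j = j - 1" using n3 assms unfolding nb_last[OF assms] by (auto simp: pv_if)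
  moreover have "j - 1 \<noteq> j mod n + 1"
    unfolding mod_succ_if[OF assms] using n3 False by auto
  moreover have "(j - 1) mod n + 1 = j"
    using mod_succ_if[of "j - 1"] assms False by auto
  moreover have "2 * (j - 1) = 2 * j - 1 - 1" "2 * j - 1 \<noteq> 1" using False assms by auto
  ultimately show ?thesis by (simp only: side_def src_X if_False if_True refl)
qed

lemma is_path_rot:
  assumes "j \<in> {1..n}" "a \<le> b" "b \<le> lst j"
  shows "is_path D (side n j (nb j ! a), rot j a b)" "pend D (side n j (nb j ! a), rot j a b) = side n j (nb j ! b)"
proof -
  have "is_path D (side n j (nb j ! a), rot j a b) \<and> pend D (side n j (nb j ! a), rot j a b) = side n j (nb j ! b)"
    using assms(2,3)
  proof (induction rule: dec_induct)
    case base
    have "a < length (nb j)" using assms nb_length[OF assms(1)] by simp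
    then show ?case
      using side_verts[OF nb_adj[of a j]] by (simp add: is_path_def del: QT_simps)
  next
    case (step b)
    have t: "tri_cyc j (nb j ! b) (nb j ! Suc b)" using step by (intro tri_cyc_nb assms) simp
    have "nb j ! Suc b \<in> {1..n}" using tri_cyc_range[OF tri_cyc_rotate[OF tri_cyc_rotate[OF t]]] .
    then show ?case
      using step t assms(1) by (simp add: rot_Suc is_path_append pend_nonempty Ar_arrs side_sym)
  qed
  then show "is_path D (side n j (nb j ! a), rot j a b)" "pend D (side n j (nb j ! a), rot j a b) = side n j (nb j ! b)"
    by auto
qed

lemma is_path_XX:
  assumes "j \<in> {1..n}"
  shows "is_path D (src D (X (2 * j - 1)), [X (2 * j - 1), X (2 * j)])"
  using assms by (auto simp: is_path_def X_arrs src_X image_iff)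

lemma is_path_white_rest:
  assumes "j \<in> {1..n}" "Suc i < length (nb j)"
  shows "is_path D (side n j (nb j ! Suc i), white_rest j i)"
    "pend D (side n j (nb j ! Suc i), white_rest j i) = side n j (nb j ! i)"
proof -
  let ?p = "(side n j (nb j ! Suc i), rot j (Suc i) (lst j))"
  let ?x = "(src D (X (2 * j - 1)), [X (2 * j - 1), X (2 * j)])"
  let ?q = "(side n j (nb j ! 0), rot j 0 i)"
  have eq: "(side n j (nb j ! Suc i), white_rest j i) = pcomp ?p (pcomp ?x ?q)"
    by (simp add: white_rest_def pcomp_def)
  have p: "is_path D ?p" "pend D ?p = fst ?x"
    using is_path_rot[of j "Suc i" "lst j"] assms side_nb_last by (auto simp del: QT_simps)
  have q: "is_path D ?q" "pend D ?q = side n j (nb j ! i)"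
    using is_path_rot[of j 0 i] assms by (auto simp del: QT_simps)
  have x: "is_path D ?x" "pend D ?x = fst ?q"
    using is_path_XX[OF assms(1)] side_nb_first[OF assms(1)] by (auto simp: pend_nonempty)
  have xq: "is_path D (pcomp ?x ?q)" by (rule is_path_pcomp[OF x(1) q(1) x(2)])
  show "is_path D (side n j (nb j ! Suc i), white_rest j i)"
    unfolding eq by (rule is_path_pcomp[OF p(1) xq]) (use p(2) in simp)
  show "pend D (side n j (nb j ! Suc i), white_rest j i) = side n j (nb j ! i)"
    unfolding eq using p x q by simp
qed

lemma is_path_back:
  assumes "tri_cyc a b c"
  shows "is_path D (side n a c, [Ar c a b, Ar b c a])" "pend D (side n a c, [Ar c a b, Ar b c a]) = side n a b"
proof -
  have r: "tri_cyc b c a" "tri_cyc c a b" using assms tri_cyc_rotate by blast+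
  note range = tri_cyc_range[OF assms] tri_cyc_range[OF r(1)] tri_cyc_range[OF r(2)]
  have "nadj a c" using assms nadj_sym by (auto simp: tri_cyc_def)
  then show "is_path D (side n a c, [Ar c a b, Ar b c a])"
    using r range side_verts[of a c] by (simp add: is_path_def Ar_arrs side_sym del: QT_simps(1))
  show "pend D (side n a c, [Ar c a b, Ar b c a]) = side n a b"
    using range by (simp add: pend_nonempty side_sym)
qed

lemma quiver_rels_QT: "quiver_rels D (dimer_rels D)"
proof (intro quiver_rels.intro fin_quiver_QT quiver_rels_axioms.intro subsetI)
  fix r assume "r \<in> dimer_rels D"
  then obtain i j where j: "j \<in> {1..n}" "Suc i < length (nb j)"
    and r: "r = (\<lambda>q. bpath (side n j (nb j ! Suc i), white_rest j i) q
      - bpath (side n j (nb j ! Suc i), [Ar (nb j ! Suc i) j (nb j ! i), Ar (nb j ! i) (nb j ! Suc i) j]) q)"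
    unfolding dimer_rels_QT by blast
  have "r = (\<lambda>q. single 1 (side n j (nb j ! Suc i), white_rest j i) q
     + single (- 1) (side n j (nb j ! Suc i), [Ar (nb j ! Suc i) j (nb j ! i), Ar (nb j ! i) (nb j ! Suc i) j]) q)"
    unfolding r by (auto simp: bpath_def single_def)
  then show "r \<in> carrier (path_alg D)"
    using is_path_white_rest[OF j] is_path_back[OF tri_cyc_nb[OF j]]
    by (simp add: add_carrier single_carrier)
qed

end

sublocale polygon_triangulation \<subseteq> D: quiver_rels "QT n T" "dimer_rels (QT n T)"
  by (rule quiver_rels_QT)

context polygon_triangulation
begin

lemma peq_white:
  assumes "j \<in> {1..n}" "Suc i < length (nb j)" "nb j ! i = b" "nb j ! Suc i = c"
  shows "D.peq (side n j c, white_rest j i) (side n j c, [Ar c j b, Ar b c j])"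
proof (rule D.peq_rel)
  show "(\<lambda>r. bpath (side n j c, white_rest j i) r - bpath (side n j c, [Ar c j b, Ar b c j]) r) \<in> dimer_rels D"
    unfolding dimer_rels_QT using assms by blast
qed (use is_path_white_rest[OF assms(1,2)] is_path_back[OF tri_cyc_nb[OF assms(1,2)]] assms in auto)

section \<open>The angle grading\<close>

fun wt :: "qa \<Rightarrow> nat" where
  "wt (X k) = 1"
| "wt (Ar a b c) = off b c"

abbreviation wts :: "qa list \<Rightarrow> nat" where "wts as \<equiv> sum_list (map wt as)"

text \<open>Seen from \<open>j\<close>, arcs between neighbours are differences of offsets; this is
  why weights of rotations telescope.\<close>

lemma off_nb_nb:
  assumes "j \<in> {1..n}" "i < k" "k < length (nb j)"
  shows "off (nb j ! i) (nb j ! k) = offs j ! k - offs j ! i"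
proof -
  have "offs j ! i \<in> {1..<n}" "offs j ! k \<in> {1..<n}" using offs_range assms by auto
  moreover have "offs j ! i < offs j ! k" using offs_mono assms by simp
  ultimately show ?thesis using assms by (auto simp: nb_nth off_def pv_if)
qed

lemma wts_rot:
  assumes "j \<in> {1..n}" "a \<le> b" "b \<le> lst j"
  shows "wts (rot j a b) + offs j ! a = offs j ! b"
  using assms(2,3)
proof (induction rule: dec_induct)
  case (step b)
  then have b: "Suc b < length (nb j)" using nb_length[OF assms(1)] by simp
  have "offs j ! b < offs j ! Suc b" using offs_mono b by simp
  then show ?case using step b assms(1) by (simp add: rot_Suc off_nb_nb)
qed simp

lemma offs_first: "j \<in> {1..n} \<Longrightarrow> offs j ! 0 = 1"
  using offs_ends(1) by (metis nth_Cons_0)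

lemma offs_last: "j \<in> {1..n} \<Longrightarrow> offs j ! lst j = n - 1"
  using off_nb[of j "lst j"] nb_length[of j] n3 unfolding nb_last by (simp add: nb_last[simplified] off_pv)

lemma wts_full_rot: "j \<in> {1..n} \<Longrightarrow> wts (rot j 0 (lst j)) = n - 2"
  using wts_rot[of j 0 "lst j"] offs_first offs_last by simp

text \<open>The offsets at \<open>j\<close> run from 1 to \<open>n - 1\<close>, so all corner arrows
  together weigh \<open>n - 2\<close>; the two boundary arrows bring the white face to
  \<open>n\<close>.\<close>

lemma wts_white_rest:
  assumes "j \<in> {1..n}" "Suc i < length (nb j)"
  shows "wts (white_rest j i) + off (nb j ! i) (nb j ! Suc i) = n"
proof -
  have "wts (rot j (Suc i) (lst j)) + offs j ! Suc i = n - 1"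
    using wts_rot[of j "Suc i" "lst j"] assms offs_last by simp
  moreover have "wts (rot j 0 i) + 1 = offs j ! i"
    using wts_rot[of j 0 i] assms offs_first by simp
  moreover have "off (nb j ! i) (nb j ! Suc i) = offs j ! Suc i - offs j ! i" "offs j ! i < offs j ! Suc i"
    using off_nb_nb[of j i "Suc i"] offs_mono[of i "Suc i" j] assms by auto
  ultimately show ?thesis using n3 by (simp add: white_rest_def)
qed

text \<open>The three arcs between the corners go once around the polygon, as inscribed angles of a
  triangle do.\<close>

lemma off_cyc_sum: "tri_cyc a b c \<Longrightarrow> off a b + off b c + off c a = n"
  using tri_cyc_range[of a b c] tri_cyc_range[of b c a] tri_cyc_range[of c a b] tri_cyc_rotate
  by (auto simp: tri_cyc_def cyc_def off_def)

lemma rels_homogeneous: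
  assumes "r \<in> dimer_rels D"
  shows "push (D.path_data wt) r = (\<lambda>_. 0)"
proof -
  obtain i j where j: "j \<in> {1..n}" "Suc i < length (nb j)"
    and r: "r = (\<lambda>q. bpath (side n j (nb j ! Suc i), white_rest j i) q
      - bpath (side n j (nb j ! Suc i), [Ar (nb j ! Suc i) j (nb j ! i), Ar (nb j ! i) (nb j ! Suc i) j]) q)"
    using assms unfolding dimer_rels_QT by blast
  let ?p = "(side n j (nb j ! Suc i), white_rest j i)"
  let ?q = "(side n j (nb j ! Suc i), [Ar (nb j ! Suc i) j (nb j ! i), Ar (nb j ! i) (nb j ! Suc i) j])"
  note t = tri_cyc_nb[OF j]
  \<comment> \<open>Either side, completed by the arrow of the relation, is a face of weight
    \<open>n\<close>; so both sides weigh \<open>n\<close> minus that arrow.\<close>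
  have "D.path_data wt ?p = D.path_data wt ?q"
    using is_path_white_rest(2)[OF j] is_path_back(2)[OF t] wts_white_rest[OF j] off_cyc_sum[OF t]
    by (simp add: D.path_data_def)
  moreover have "r = (\<lambda>q. single 1 ?p q + single (- 1) ?q q)"
    unfolding r by (auto simp: bpath_def single_def)
  ultimately show ?thesis
    by (simp add: push_add finite_supp_single) (auto simp: single_def)
qed

end

section \<open>The algebra of \<open>\<Gamma>(n)\<close>\<close>

lemma rd_range: "rd n k \<in> {1..2 * n}" if "n > 0"
proof -
  have "0 \<le> (k - 1) mod (2 * int n)" "(k - 1) mod (2 * int n) < 2 * int n" using that by auto
  then show ?thesis unfolding rd_def atLeastAtMost_iff by linarith
qed

lemma int_rd: "n > 0 \<Longrightarrow> int (rd n k) = (k - 1) mod (2 * int n) + 1"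
  by (simp add: rd_def)

lemma rd_eq_iff: "n > 0 \<Longrightarrow> rd n k = rd n l \<longleftrightarrow> k mod (2 * int n) = l mod (2 * int n)"
proof -
  assume "n > 0"
  then have "rd n k = rd n l \<longleftrightarrow> (k - 1) mod (2 * int n) = (l - 1) mod (2 * int n)"
    using int_rd[of n k] int_rd[of n l] by linarith
  also have "\<dots> \<longleftrightarrow> k mod (2 * int n) = l mod (2 * int n)"
    by (simp add: mod_eq_dvd_iff)
  finally show ?thesis .
qed

lemma rd_eqI: "n > 0 \<Longrightarrow> (2 * int n) dvd (k - l) \<Longrightarrow> rd n k = rd n l"
  by (simp add: rd_eq_iff mod_eq_dvd_iff)

lemma rd_id [simp]: "k \<in> {1..2 * n} \<Longrightarrow> rd n (int k) = k"
  by (auto simp: rd_def)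

lemma rd_rd_add: "rd n (int (rd n k) + l) = rd n (k + l)" if "n > 0"
proof -
  have "((k - 1) mod (2 * int n) + (1 + l)) mod (2 * int n) = (k - 1 + (1 + l)) mod (2 * int n)"
    by (rule mod_add_left_eq)
  then show ?thesis using that by (simp add: rd_eq_iff int_rd add.assoc)
qed

lemma rd_rd_diff: "n > 0 \<Longrightarrow> rd n (int (rd n k) - l) = rd n (k - l)"
  using rd_rd_add[of n k "- l"] by simp

lemma rd_rd [simp]: "n > 0 \<Longrightarrow> rd n (int (rd n k)) = rd n k"
  using rd_rd_add[of n k 0] by simp

lemma even_rd: "n > 0 \<Longrightarrow> even (rd n k) \<longleftrightarrow> even k"
proof -
  assume "n > 0"
  have "even (int (rd n k)) \<longleftrightarrow> even k"
    unfolding int_rd[OF \<open>n > 0\<close>] by (simp add: dvd_mod_iff)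
  then show ?thesis by simp
qed

locale gamma_quiver =
  fixes n :: nat
  assumes n3: "n \<ge> 3"
begin

abbreviation \<Gamma> :: "(nat, ga) quiver" where "\<Gamma> \<equiv> Gamma n"

lemma npos: "n > 0" using n3 by simp

lemma Gamma_simps [simp]:
  "verts \<Gamma> = {1..2 * n}"
  "src \<Gamma> (GX k) = rd n (int k - 1)" "tgt \<Gamma> (GX k) = k"
  "src \<Gamma> (GZ k) = k" "tgt \<Gamma> (GZ k) = rd n (int k - 2)"
  by (simp_all add: Gamma_def)

lemma GX_arrs: "GX k \<in> arrs \<Gamma> \<longleftrightarrow> k \<in> {1..2 * n}"
  and GZ_arrs: "GZ k \<in> arrs \<Gamma> \<longleftrightarrow> k \<in> {1..2 * n} \<and> even k"
  by (auto simp: Gamma_def)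

lemma GX_rd [simp]: "GX (rd n k) \<in> arrs \<Gamma>"
  unfolding GX_arrs by (rule rd_range[OF npos])

lemma GZ_rd [simp]: "GZ (rd n k) \<in> arrs \<Gamma> \<longleftrightarrow> even k"
  unfolding GZ_arrs using rd_range[OF npos, of k] even_rd[OF npos] by simp

lemma rd_verts: "rd n k \<in> verts \<Gamma>"
  using rd_range[OF npos] by simp

lemma fin_quiver_Gamma: "fin_quiver \<Gamma>"
proof
  fix a assume a: "a \<in> arrs \<Gamma>"
  have "src \<Gamma> a \<in> verts \<Gamma> \<and> tgt \<Gamma> a \<in> verts \<Gamma>"
  proof (cases a)
    case (GX k)
    then show ?thesis using a rd_verts[of "int k - 1"] by (auto simp: GX_arrs)
  next
    case (GZ k)
    then show ?thesis using a rd_verts[of "int k - 2"] by (auto simp: GZ_arrs)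
  qed
  then show "src \<Gamma> a \<in> verts \<Gamma>" "tgt \<Gamma> a \<in> verts \<Gamma>" by auto
qed simp

text \<open>The start is an integer that is reduced only inside \<open>rd\<close>. Indices can then
  be added freely, with no case distinction when a path passes vertex \<open>2n\<close>.\<close>

definition xs :: "int \<Rightarrow> nat \<Rightarrow> ga list" where
  "xs v m = map (\<lambda>l. GX (rd n (v + 1 + int l))) [0..<m]"

lemma xs_0 [simp]: "xs v 0 = []"
  by (simp add: xs_def)

lemma xs_Suc: "xs v (Suc m) = xs v m @ [GX (rd n (v + int m + 1))]"
  by (simp add: xs_def algebra_simps)

lemma xs_add: "xs v (a + b) = xs v a @ xs (v + int a) b"
  by (induction b) (simp_all add: xs_Suc algebra_simps)

lemma src_GX_rd: "src \<Gamma> (GX (rd n k)) = rd n (k - 1)"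
  and tgt_GZ_rd: "tgt \<Gamma> (GZ (rd n k)) = rd n (k - 2)"
  by (simp_all add: rd_rd_diff npos)

lemma is_path_snoc:
  "is_path \<Gamma> (v, as @ [a]) \<longleftrightarrow> is_path \<Gamma> (v, as) \<and> a \<in> arrs \<Gamma> \<and> src \<Gamma> a = pend \<Gamma> (v, as)"
  by (simp add: is_path_append)

lemma pend_snoc: "pend Q (v, as @ [a]) = tgt Q a"
  by (simp add: pend_def)

lemma is_path_xs: "is_path \<Gamma> (rd n v, xs v m)" "pend \<Gamma> (rd n v, xs v m) = rd n (v + int m)"
proof -
  have "is_path \<Gamma> (rd n v, xs v m) \<and> pend \<Gamma> (rd n v, xs v m) = rd n (v + int m)"
  proof (induction m)
    case 0
    then show ?case using rd_range[OF npos, of v] by (simp add: is_path_def)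
  next
    case (Suc m)
    then show ?case by (simp add: xs_Suc is_path_snoc pend_snoc src_GX_rd algebra_simps del: Gamma_simps) simp
  qed
  then show "is_path \<Gamma> (rd n v, xs v m)" "pend \<Gamma> (rd n v, xs v m) = rd n (v + int m)" by auto
qed

lemma is_path_rel1:
  assumes "even u"
  shows "is_path \<Gamma> (rd n u, [GX (rd n (u + 1)), GX (rd n (u + 2)), GZ (rd n (u + 2))])"
    "is_path \<Gamma> (rd n u, [GZ (rd n u), GX (rd n (u - 1)), GX (rd n u)])"
    "is_path \<Gamma> (rd n u, [GZ (rd n u), GZ (rd n (u - 2))])"
  using assms rd_range[OF npos, of u] by (simp_all add: is_path_def rd_rd_diff npos algebra_simps)

lemma arel_Gamma:
  "arel \<Gamma> (GX (rd n k) # as) = bpath (rd n (k - 1), GX (rd n k) # as)"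
  "arel \<Gamma> (GZ (rd n k) # as) = bpath (rd n k, GZ (rd n k) # as)"
  by (simp_all add: arel_def rd_rd_diff npos)

lemma Gamma_rels_cases:
  assumes "r \<in> Gamma_rels n"
  obtains i where "i \<in> {1..n}" "r = (\<lambda>q. bpath (rd n (2 * int i),
        [GX (rd n (2 * int i + 1)), GX (rd n (2 * int i + 2)), GZ (rd n (2 * int i + 2))]) q
      - bpath (rd n (2 * int i), [GZ (rd n (2 * int i)), GX (rd n (2 * int i - 1)), GX (rd n (2 * int i))]) q)"
  | i where "i \<in> {1..n}" "r = (\<lambda>q. bpath (rd n (2 * int i), [GZ (rd n (2 * int i)), GZ (rd n (2 * int i - 2))]) q
      - bpath (rd n (2 * int i), xs (2 * int i) (2 * n - 4)) q)"
proof -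
  have id: "rd n (2 * int i) = 2 * i" if "i \<in> {1..n}" for i
    using rd_id[of "2 * i" n] that by simp
  have xs: "arel \<Gamma> (map (\<lambda>l. GX (rd n (2 * int i + 1 + int l))) [0..<2 * n - 4])
      = bpath (rd n (2 * int i), xs (2 * int i) (2 * n - 4))" for i
    using n3 by (simp add: arel_def xs_def upt_conv_Cons rd_rd_diff npos)
  from assms show ?thesis
    unfolding Gamma_rels_def
  proof (elim UnE imageE)
    fix i assume i: "i \<in> {1..n}"
      "r = (\<lambda>q. arel \<Gamma> [GX (rd n (2 * int i + 1)), GX (rd n (2 * int i + 2)), GZ (rd n (2 * int i + 2))] q
              - arel \<Gamma> [GZ (2 * i), GX (rd n (2 * int i - 1)), GX (2 * i)] q)"
    show ?thesis
      by (rule that(1)[OF i(1)]) (simp add: i(2) arel_Gamma flip: id[OF i(1)])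
  next
    fix i assume i: "i \<in> {1..n}"
      "r = (\<lambda>q. arel \<Gamma> [GZ (2 * i), GZ (rd n (2 * int i - 2))] q
              - arel \<Gamma> (map (\<lambda>l. GX (rd n (2 * int i + 1 + int l))) [0..<2 * n - 4]) q)"
    show ?thesis
      by (rule that(2)[OF i(1)]) (simp add: i(2) xs arel_Gamma flip: id[OF i(1)])
  qed
qed

lemma even_rd_2: "rd n (2 * int i) = 2 * i" if "i \<in> {1..n}"
  using rd_id[of "2 * i" n] that by simp

lemma Gamma_relsI:
  assumes "i \<in> {1..n}"
  shows "(\<lambda>q. bpath (rd n (2 * int i),
        [GX (rd n (2 * int i + 1)), GX (rd n (2 * int i + 2)), GZ (rd n (2 * int i + 2))]) q
      - bpath (rd n (2 * int i), [GZ (rd n (2 * int i)), GX (rd n (2 * int i - 1)), GX (rd n (2 * int i))]) q)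
     \<in> Gamma_rels n" (is "?r1 \<in> _")
    and "(\<lambda>q. bpath (rd n (2 * int i), [GZ (rd n (2 * int i)), GZ (rd n (2 * int i - 2))]) q
      - bpath (rd n (2 * int i), xs (2 * int i) (2 * n - 4)) q) \<in> Gamma_rels n" (is "?r2 \<in> _")
proof -
  have xs: "arel \<Gamma> (map (\<lambda>l. GX (rd n (2 * int i + 1 + int l))) [0..<2 * n - 4])
      = bpath (rd n (2 * int i), xs (2 * int i) (2 * n - 4))"
    using n3 by (simp add: arel_def xs_def upt_conv_Cons rd_rd_diff npos)
  have "?r1 = (\<lambda>q. arel \<Gamma> [GX (rd n (2 * int i + 1)), GX (rd n (2 * int i + 2)), GZ (rd n (2 * int i + 2))] q
              - arel \<Gamma> [GZ (2 * i), GX (rd n (2 * int i - 1)), GX (2 * i)] q)"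
    by (simp add: arel_Gamma flip: even_rd_2[OF assms])
  then show "?r1 \<in> Gamma_rels n" unfolding Gamma_rels_def using assms by blast
  have "?r2 = (\<lambda>q. arel \<Gamma> [GZ (2 * i), GZ (rd n (2 * int i - 2))] q
              - arel \<Gamma> (map (\<lambda>l. GX (rd n (2 * int i + 1 + int l))) [0..<2 * n - 4]) q)"
    by (simp add: xs arel_Gamma flip: even_rd_2[OF assms])
  then show "?r2 \<in> Gamma_rels n" unfolding Gamma_rels_def using assms by blast
qed

lemma single_diff: "(\<lambda>q. bpath p q - bpath p' q) = (\<lambda>q. single 1 p q + single (- 1) p' q)"
  by (auto simp: bpath_def single_def)

lemma quiver_rels_Gamma: "quiver_rels \<Gamma> (Gamma_rels n)"
proof (intro quiver_rels.intro fin_quiver_Gamma quiver_rels_axioms.intro subsetI)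
  fix r assume "r \<in> Gamma_rels n"
  then show "r \<in> carrier (path_alg \<Gamma>)"
    by (cases rule: Gamma_rels_cases)
      (simp_all add: single_diff add_carrier single_carrier is_path_rel1 is_path_xs)
qed

end

sublocale gamma_quiver \<subseteq> G: quiver_rels "Gamma n" "Gamma_rels n"
  by (rule quiver_rels_Gamma)

context gamma_quiver
begin

text \<open>Lets the relations, which are indexed by \<open>i\<close> from 1 to \<open>n\<close>, be
  applied at any even integer position.\<close>

lemma rd_even_ex:
  assumes "even u" obtains i where "i \<in> {1..n}" "\<And>k. rd n (u + k) = rd n (2 * int i + k)"
proof -
  let ?i = "rd n u div 2"
  have e: "even (rd n u)" using even_rd[OF npos] assms by simp
  then have "2 * ?i = rd n u" by simp
  then have "?i \<in> {1..n}" "2 * int ?i = int (rd n u)" using rd_range[OF npos, of u] by auto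
  then show ?thesis using that[of ?i] rd_rd_add[OF npos] by simp
qed

lemma peq_rel1:
  assumes "even u"
  shows "G.peq (rd n u, [GX (rd n (u + 1)), GX (rd n (u + 2)), GZ (rd n (u + 2))])
    (rd n u, [GZ (rd n u), GX (rd n (u - 1)), GX (rd n u)])"
proof -
  obtain i where i: "i \<in> {1..n}" "\<And>k. rd n (u + k) = rd n (2 * int i + k)"
    using rd_even_ex[OF assms] by metis
  have "(\<lambda>q. bpath (rd n u, [GX (rd n (u + 1)), GX (rd n (u + 2)), GZ (rd n (u + 2))]) q
    - bpath (rd n u, [GZ (rd n u), GX (rd n (u - 1)), GX (rd n u)]) q) \<in> Gamma_rels n"
    using Gamma_relsI(1)[OF i(1)] i(2)[of 0] i(2)[of 1] i(2)[of 2] i(2)[of "- 1"] by simp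
  then show ?thesis
    by (rule G.peq_rel) (use is_path_rel1[OF assms] in \<open>simp_all add: pend_def rd_rd_diff npos\<close>)
qed

lemma peq_rel2:
  assumes "even u"
  shows "G.peq (rd n u, [GZ (rd n u), GZ (rd n (u - 2))]) (rd n u, xs u (2 * n - 4))"
proof -
  obtain i where i: "i \<in> {1..n}" "\<And>k. rd n (u + k) = rd n (2 * int i + k)"
    using rd_even_ex[OF assms] by metis
  have xs: "xs u m = xs (2 * int i) m" for m
    unfolding xs_def using i(2) by (simp add: add.assoc)
  have "(\<lambda>q. bpath (rd n u, [GZ (rd n u), GZ (rd n (u - 2))]) q
    - bpath (rd n u, xs u (2 * n - 4)) q) \<in> Gamma_rels n"
    using Gamma_relsI(2)[OF i(1)] i(2)[of 0] i(2)[of "- 2"] by (simp add: xs)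
  \<comment> \<open>\<open>2n - 4\<close> steps forward and the four steps back of \<open>zz\<close>
    end at the same vertex modulo \<open>2n\<close>.\<close>
  moreover have "rd n (u + int (2 * n - 4)) = rd n (u - 4)"
    by (rule rd_eqI[OF npos]) (use n3 in \<open>simp add: of_nat_diff\<close>)
  ultimately show ?thesis
    by (intro G.peq_rel) (use is_path_rel1[OF assms] is_path_xs[of u] in \<open>simp_all add: pend_def rd_rd_diff npos\<close>)
qed

end

lemma (in quiver_rels) peq_context:
  assumes "peq (v, as) (v, bs)" "is_path Q (u, l @ as @ r)" "pend Q (u, l) = v"
  shows "peq (u, l @ as @ r) (u, l @ bs @ r)"
proof -
  have l: "is_path Q (u, l)" using assms(2) by (simp add: is_path_append)
  have las: "is_path Q (u, l @ as)" using assms(2) by (simp add: is_path_append[of Q u "l @ as"] flip: append_assoc)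
  have e: "pend Q (u, l @ as) = pend Q (v, as)" using assms(3) by (auto simp: pend_def split: if_splits)
  have r: "is_path Q (pend Q (v, as), r)"
    using assms(2) pend_verts[OF las] unfolding append_assoc[symmetric] is_path_append[of Q u "l @ as"] e
    by (auto simp: is_path_def)
  have "peq (pcomp (u, l) (pcomp (v, as) (pend Q (v, as), r))) (pcomp (u, l) (pcomp (v, bs) (pend Q (v, as), r)))"
    using assms(1,3) l r peqD[OF assms(1)] by (intro peq_pcomp_left peq_pcomp_right) auto
  then show ?thesis by (simp add: pcomp_def)
qed

section \<open>Degrees and normal forms of paths of the quiver \<open>\<Gamma>(n)\<close>\<close>

context gamma_quiver
begin

text \<open>The weight of \<open>z\<close> is that of its image, a full rotation.\<close>

fun gw :: "ga \<Rightarrow> nat" where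
  "gw (GX k) = 1"
| "gw (GZ k) = n - 2"

abbreviation gws :: "ga list \<Rightarrow> nat" where "gws as \<equiv> sum_list (map gw as)"

lemma gws_xs [simp]: "gws (xs v m) = m"
  by (induction m) (simp_all add: xs_Suc)

definition nf :: "nat \<Rightarrow> ga list \<Rightarrow> bool" where
  "nf v bs \<longleftrightarrow> (\<exists>a. bs = xs v a
     \<or> even (int v + int a) \<and> (bs = xs v a @ [GZ (rd n (int v + int a))]
         \<or> bs = xs v a @ [GZ (rd n (int v + int a)), GX (rd n (int v + int a - 1))]))"

text \<open>Append one arrow to a normal form. A second \<open>z\<close> directly after
  \<open>z\<close> is absorbed by the second relation into a pure power of \<open>x\<close>;
  \<open>z x x\<close> becomes \<open>x x z\<close> by the first; and \<open>z x z\<close> cannot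
  occur, because \<open>z x\<close> ends at an odd vertex where no \<open>z\<close> starts. Both
  rewritings preserve the weight.\<close>

lemma normal_form:
  assumes "is_path \<Gamma> (v, as)"
  shows "\<exists>bs. nf v bs \<and> G.peq (v, as) (v, bs) \<and> gws as = gws bs"
  using assms
proof (induction as rule: rev_induct)
  case Nil
  have "nf v []" unfolding nf_def by (intro exI[of _ 0]) simp
  then show ?case using G.peq_refl[OF Nil] by auto
next
  case (snoc x as)
  have as: "is_path \<Gamma> (v, as)" and x: "x \<in> arrs \<Gamma>" "src \<Gamma> x = pend \<Gamma> (v, as)"
    using snoc.prems by (auto simp: is_path_snoc)
  obtain bs where bs: "nf v bs" "G.peq (v, as) (v, bs)" "gws as = gws bs" using snoc.IH[OF as] by blast
  have v: "rd n (int v) = v" using as by (intro rd_id) (simp add: is_path_def)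
  have step: "G.peq (v, as @ [x]) (v, bs @ [x])"
    using G.peq_context[OF bs(2), of v "[]" "[x]"] snoc.prems by simp
  then have path: "is_path \<Gamma> (v, bs @ [x])" by (rule G.peqD)
  have srcx: "src \<Gamma> x = pend \<Gamma> (v, bs)" using x(2) G.peqD(4)[OF bs(2)] by simp
  have goal: ?case if "nf v cs" "G.peq (v, bs @ [x]) (v, cs)" "gws (bs @ [x]) = gws cs" for cs
    using G.peq_trans[OF step that(2)] that bs(3) by (intro exI[of _ cs]) simp
  have same: ?case if "nf v (bs @ [x])"
    by (rule goal[OF that G.peq_refl[OF path]]) simp
  have xk: "x = GX (rd n (k + 1))" if "src \<Gamma> x = rd n k" "x = GX j" for j k
  proof -
    have "rd n (int j - 1) = rd n k" using that by simp
    then have "rd n (int j - 1 + 1) = rd n (k + 1)" using rd_rd_add[OF npos] by metis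
    then show ?thesis using that x(1) by (simp add: GX_arrs rd_id)
  qed
  have zk: "x = GZ (rd n k) \<and> even k" if "src \<Gamma> x = rd n k" "x = GZ j" for j k
    using that x(1) even_rd[OF npos, of k] by (auto simp: GZ_arrs)
  have pxs: "pend \<Gamma> (v, xs v a) = rd n (int v + int a)" for a
    using is_path_xs(2)[of "int v" a] v by simp
  from bs(1) obtain a where "bs = xs v a
     \<or> even (int v + int a) \<and> (bs = xs v a @ [GZ (rd n (int v + int a))]
         \<or> bs = xs v a @ [GZ (rd n (int v + int a)), GX (rd n (int v + int a - 1))])"
    unfolding nf_def by blast
  then consider (x) "bs = xs v a"
    | (z) "even (int v + int a)" "bs = xs v a @ [GZ (rd n (int v + int a))]"
    | (zx) "even (int v + int a)" "bs = (xs v a @ [GZ (rd n (int v + int a))]) @ [GX (rd n (int v + int a - 1))]"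
    by auto
  then show ?case
  proof cases
    case x
    then have s: "src \<Gamma> x = rd n (int v + int a)" using srcx pxs by simp
    show ?thesis
    proof (cases x)
      case (GX j)
      then have "bs @ [x] = xs v (Suc a)" using xk[OF s GX] x by (simp add: xs_Suc)
      then show ?thesis using same nf_def by blast
    next
      case (GZ j)
      then show ?thesis using same zk[OF s GZ] x unfolding nf_def by blast
    qed
  next
    case z
    then have s: "src \<Gamma> x = rd n (int v + int a - 2)" using srcx by (simp add: pend_snoc tgt_GZ_rd del: Gamma_simps)
    show ?thesis
    proof (cases x)
      case (GX j)
      then have "x = GX (rd n (int v + int a - 1))" using xk[OF s GX] by simp
      then show ?thesis using same z unfolding nf_def by auto
    next
      case (GZ j)
      then have x: "x = GZ (rd n (int v + int a - 2))" using zk[OF s GZ] by simp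
      have "G.peq (v, xs v a @ [GZ (rd n (int v + int a)), GZ (rd n (int v + int a - 2))] @ [])
         (v, xs v a @ xs (int v + int a) (2 * n - 4) @ [])"
        using path z x pxs by (intro G.peq_context[OF peq_rel2[OF z(1)]]) auto
      then have "G.peq (v, bs @ [x]) (v, xs v (a + (2 * n - 4)))"
        by (simp add: z x xs_add)
      moreover have "nf v (xs v (a + (2 * n - 4)))" unfolding nf_def by blast
      moreover have "gws (bs @ [x]) = gws (xs v (a + (2 * n - 4)))"
        using n3 by (simp add: z x)
      ultimately show ?thesis using goal by blast
    qed
  next
    case zx
    then have s: "src \<Gamma> x = rd n (int v + int a - 1)" using srcx by (simp add: pend_def)
    show ?thesis
    proof (cases x)
      case (GX j)
      then have x: "x = GX (rd n (int v + int a))" using xk[OF s GX] by simp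
      let ?cs = "xs v (a + 2) @ [GZ (rd n (int v + int (a + 2)))]"
      have "G.peq (v, xs v a @ [GZ (rd n (int v + int a)), GX (rd n (int v + int a - 1)), GX (rd n (int v + int a))] @ [])
         (v, xs v a @ [GX (rd n (int v + int a + 1)), GX (rd n (int v + int a + 2)), GZ (rd n (int v + int a + 2))] @ [])"
        using path zx x pxs by (intro G.peq_context[OF G.peq_sym[OF peq_rel1[OF zx(1)]]]) auto
      then have "G.peq (v, bs @ [x]) (v, ?cs)"
        by (simp add: zx x xs_add numeral_2_eq_2 xs_Suc add_ac)
      moreover have "nf v ?cs" unfolding nf_def using zx(1) by (intro exI[of _ "a + 2"]) auto
      moreover have "gws (bs @ [x]) = gws ?cs" by (simp add: zx x)
      ultimately show ?thesis using goal by blast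
    next
      case (GZ j)
      then have "even (int v + int a - 1)" using zk[OF s GZ] by simp
      then show ?thesis using zx(1) by simp
    qed
  qed
qed

text \<open>Equal weight and equal end force the two tails behind the power of \<open>x\<close> to
  have the same total \<open>e + f\<close> modulo \<open>2n\<close>. As this total is 0 or
  \<open>n\<close>, it is then the same number, and the parity of the end vertex tells the remaining
  tails \<open>z\<close> and \<open>z x\<close> apart.\<close>

lemma nf_unique:
  assumes "nf v as" "nf v bs" "v \<in> {1..2 * n}" "pend \<Gamma> (v, as) = pend \<Gamma> (v, bs)" "gws as = gws bs"
  shows "as = bs"
proof -
  \<comment> \<open>For the tail behind \<open>x^a\<close>, \<open>e\<close> is its weight and
    \<open>f\<close> is the number of steps by which it moves the end back.\<close>
  have data: "\<exists>a e f. (as = xs v a \<and> e = 0 \<and> f = 0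
       \<or> even (int v + int a) \<and> as = xs v a @ [GZ (rd n (int v + int a))] \<and> e = n - 2 \<and> f = 2
       \<or> even (int v + int a) \<and> as = xs v a @ [GZ (rd n (int v + int a)), GX (rd n (int v + int a - 1))]
           \<and> e = n - 1 \<and> f = 1)
     \<and> gws as = a + e \<and> pend \<Gamma> (v, as) = rd n (int v + int a - f)" if nf: "nf v as" for as
  proof -
    have p: "pend \<Gamma> (v, xs v a) = rd n (int v + int a)" for a
      using is_path_xs(2)[of "int v" a] rd_id[OF assms(3)] by simp
    obtain a where "as = xs v a
     \<or> even (int v + int a) \<and> (as = xs v a @ [GZ (rd n (int v + int a))]
         \<or> as = xs v a @ [GZ (rd n (int v + int a)), GX (rd n (int v + int a - 1))])"
      using nf unfolding nf_def by blast
    then consider (x) "as = xs v a"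
      | (z) "even (int v + int a)" "as = xs v a @ [GZ (rd n (int v + int a))]"
      | (zx) "even (int v + int a)" "as = xs v a @ [GZ (rd n (int v + int a)), GX (rd n (int v + int a - 1))]"
      by auto
    then show ?thesis
    proof cases
      case x
      then show ?thesis using p by (intro exI[of _ a] exI[of _ 0]) simp
    next
      case z
      then show ?thesis
        by (intro exI[of _ a] exI[of _ "n - 2"] exI[of _ 2]) (simp add: pend_def rd_rd_diff npos)
    next
      case zx
      then show ?thesis using n3
        by (intro exI[of _ a] exI[of _ "n - 1"] exI[of _ 1]) (simp add: pend_def)
    qed
  qed
  obtain a e f where a: "as = xs v a \<and> e = 0 \<and> f = 0
       \<or> even (int v + int a) \<and> as = xs v a @ [GZ (rd n (int v + int a))] \<and> e = n - 2 \<and> f = 2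
       \<or> even (int v + int a) \<and> as = xs v a @ [GZ (rd n (int v + int a)), GX (rd n (int v + int a - 1))]
           \<and> e = n - 1 \<and> f = 1"
    "gws as = a + e" "pend \<Gamma> (v, as) = rd n (int v + int a - f)"
    using data[OF assms(1)] by blast
  obtain b e' f' where b: "bs = xs v b \<and> e' = 0 \<and> f' = 0
       \<or> even (int v + int b) \<and> bs = xs v b @ [GZ (rd n (int v + int b))] \<and> e' = n - 2 \<and> f' = 2
       \<or> even (int v + int b) \<and> bs = xs v b @ [GZ (rd n (int v + int b)), GX (rd n (int v + int b - 1))]
           \<and> e' = n - 1 \<and> f' = 1"
    "gws bs = b + e'" "pend \<Gamma> (v, bs) = rd n (int v + int b - f')"
    using data[OF assms(2)] by blast
  have w: "a + e = b + e'" using a b assms(5) by simp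
  have rd: "rd n (int v + int a - f) = rd n (int v + int b - f')" using a b assms(4) by simp
  then have "(2 * int n) dvd (int v + int a - f) - (int v + int b - f')"
    using rd_eq_iff[OF npos] mod_eq_dvd_iff by blast
  moreover have "(int v + int a - f) - (int v + int b - f') = (int e' + f') - (int e + f)"
    using w by linarith
  moreover have "int e + f = 0 \<or> int e + f = int n" "int e' + f' = 0 \<or> int e' + f' = int n"
    using a(1) b(1) n3 by auto
  moreover have "\<not> (2 * int n) dvd int n" "\<not> (2 * int n) dvd - int n"
    using npos zdvd_not_zless[of "int n" "2 * int n"] by auto
  ultimately have sum: "int e + f = int e' + f'" by (elim disjE) simp_all
  have par: "even (int v + int a - f) \<longleftrightarrow> even (int v + int b - f')"
    using rd even_rd[OF npos] by metis
  \<comment> \<open>A nonempty tail starts at an even vertex, so the parity of the end is the parity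
    of \<open>f\<close>, which is 2 for \<open>z\<close> and 1 for \<open>z x\<close>.\<close>
  have "f = f'" using a(1) b(1) par sum n3 by (elim disjE) auto
  moreover have "a = b" using \<open>f = f'\<close> sum w by linarith
  ultimately show ?thesis using a(1) b(1) by (elim disjE) auto
qed

lemma faithful_Gamma:
  assumes "is_path \<Gamma> p" "is_path \<Gamma> q" "fst p = fst q" "pend \<Gamma> p = pend \<Gamma> q"
    "gws (snd p) = gws (snd q)"
  shows "G.peq p q"
proof -
  obtain v as where p: "p = (v, as)" by force
  then obtain bs where q: "q = (v, bs)" using assms(3) by (metis fst_conv prod.collapse)
  obtain as' where as: "nf v as'" "G.peq (v, as) (v, as')" "gws as = gws as'"
    using normal_form assms(1) p by blast
  obtain bs' where bs: "nf v bs'" "G.peq (v, bs) (v, bs')" "gws bs = gws bs'"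
    using normal_form assms(2) q by blast
  have "as' = bs'"
    using nf_unique[OF as(1) bs(1)] assms p q as bs G.peqD(4)[OF as(2)] G.peqD(4)[OF bs(2)]
    by (simp add: is_path_def)
  then show ?thesis using G.peq_trans[OF as(2) G.peq_sym] bs(2) by (simp add: p q)
qed

section \<open>The central element\<close>

definition loop :: "nat \<Rightarrow> nat \<times> ga list" where
  "loop v = (if even v then (v, [GX (rd n (int v + 1)), GX (rd n (int v + 2)), GZ (rd n (int v + 2))])
     else (v, [GX (rd n (int v + 1)), GZ (rd n (int v + 1)), GX v]))"

lemma loop:
  assumes "v \<in> {1..2 * n}"
  shows "is_path \<Gamma> (loop v)" "fst (loop v) = v" "pend \<Gamma> (loop v) = v" "gws (snd (loop v)) = n"
proof -
  have "GX v \<in> arrs \<Gamma>" using assms by (simp add: GX_arrs)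
  then show "is_path \<Gamma> (loop v)" "fst (loop v) = v" "pend \<Gamma> (loop v) = v" "gws (snd (loop v)) = n"
    using assms n3 rd_id[of v n] by (auto simp: loop_def is_path_def pend_def rd_rd_diff npos algebra_simps)
qed

text \<open>The first sum of \<open>t\<close> consists of the loops at even vertices and the second
  of those at odd ones. Thus \<open>t\<close> has exactly one summand at each vertex, and its
  product with a path is again a single path.\<close>

lemma t_elem_eq: "t_elem n = (\<lambda>q. \<Sum>v\<in>{1..2 * n}. single 1 (loop v) q)"
proof
  fix q
  \<comment> \<open>The \<open>i\<close>-th loop of the first sum starts at \<open>2i - 2\<close>,
    which has to be read as \<open>2n\<close> for \<open>i = 1\<close>.\<close>
  have bij: "bij_betw (\<lambda>i. rd n (2 * int i - 2)) {1..n} {v \<in> {1..2 * n}. even v}"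
  proof (rule bij_betw_byWitness[of _ "\<lambda>v. (v div 2) mod n + 1"])
    have rd: "rd n (2 * int i - 2) = (if i = 1 then 2 * n else 2 * i - 2)" if "i \<in> {1..n}" for i
    proof (cases "i = 1")
      case True
      then have "rd n (2 * int i - 2) = rd n (int (2 * n))" by (intro rd_eqI npos) simp
      then show ?thesis using True npos rd_id[of "2 * n" n] by simp
    next
      case False
      then have "2 * i - 2 \<in> {1..2 * n}" "int (2 * i - 2) = 2 * int i - 2" using that by auto
      then show ?thesis using False rd_id[of "2 * i - 2" n] by simp
    qed
    show "\<forall>i\<in>{1..n}. rd n (2 * int i - 2) div 2 mod n + 1 = i" by (auto simp: rd)
    show "(\<lambda>i. rd n (2 * int i - 2)) ` {1..n} \<subseteq> {v \<in> {1..2 * n}. even v}" by (auto simp: rd)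
    show "\<forall>v\<in>{v \<in> {1..2 * n}. even v}. rd n (2 * int (v div 2 mod n + 1) - 2) = v"
    proof
      fix v assume "v \<in> {v \<in> {1..2 * n}. even v}"
      then obtain k where k: "v = 2 * k" "k \<in> {1..n}" by (auto elim!: evenE)
      show "rd n (2 * int (v div 2 mod n + 1) - 2) = v"
        using k rd[of "k mod n + 1"] by (cases "k = n") auto
    qed
    show "(\<lambda>v. v div 2 mod n + 1) ` {v \<in> {1..2 * n}. even v} \<subseteq> {1..n}"
      using npos by (auto simp: Suc_leI)
  qed
  have "arel \<Gamma> [GX (rd n (2 * int i - 1)), GX (2 * i), GZ (2 * i)] q
      = single 1 (loop (rd n (2 * int i - 2))) q" if "i \<in> {1..n}" for i
    using even_rd_2[OF that] even_rd[OF npos, of "2 * int i - 2"]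
    by (simp add: loop_def arel_Gamma bpath_eq_single rd_rd_add npos)
  then have "(\<Sum>i\<in>{1..n}. arel \<Gamma> [GX (rd n (2 * int i - 1)), GX (2 * i), GZ (2 * i)] q)
     = (\<Sum>i\<in>{1..n}. single 1 (loop (rd n (2 * int i - 2))) q)" by simp
  also have "\<dots> = (\<Sum>v | v \<in> {1..2 * n} \<and> even v. single 1 (loop v) q)"
    by (rule sum.reindex_bij_betw[OF bij])
  finally have 1: "(\<Sum>i\<in>{1..n}. arel \<Gamma> [GX (rd n (2 * int i - 1)), GX (2 * i), GZ (2 * i)] q)
     = (\<Sum>v | v \<in> {1..2 * n} \<and> even v. single 1 (loop v) q)" .
  have odd: "rd n (2 * int i - 1) = 2 * i - 1" if "i \<in> {1..n}" for i
  proof -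
    have "2 * i - 1 \<in> {1..2 * n}" "int (2 * i - 1) = 2 * int i - 1" using that by auto
    then show ?thesis using rd_id[of "2 * i - 1" n] by simp
  qed
  have "arel \<Gamma> [GX (2 * i), GZ (2 * i), GX (rd n (2 * int i - 1))] q = single 1 (loop (2 * i - 1)) q"
    if "i \<in> {1..n}" for i
  proof -
    have "int (2 * i - 1) + 1 = 2 * int i" "odd (2 * i - 1)" using that by (auto simp: of_nat_diff)
    then show ?thesis
      using even_rd_2[OF that] odd[OF that] that
      by (simp add: loop_def arel_def bpath_eq_single)
  qed
  then have "(\<Sum>i\<in>{1..n}. arel \<Gamma> [GX (2 * i), GZ (2 * i), GX (rd n (2 * int i - 1))] q)
     = (\<Sum>i\<in>{1..n}. single 1 (loop (2 * i - 1)) q)" by simp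
  also have "\<dots> = (\<Sum>v | v \<in> {1..2 * n} \<and> odd v. single 1 (loop v) q)"
    by (rule sum.reindex_bij_witness[of _ "\<lambda>v. (v + 1) div 2" "\<lambda>i. 2 * i - 1"]) (auto elim!: oddE)
  finally have 2: "(\<Sum>i\<in>{1..n}. arel \<Gamma> [GX (2 * i), GZ (2 * i), GX (rd n (2 * int i - 1))] q)
     = (\<Sum>v | v \<in> {1..2 * n} \<and> odd v. single 1 (loop v) q)" .
  have split: "{1..2 * n} = {v. v \<in> {1..2 * n} \<and> even v} \<union> {v. v \<in> {1..2 * n} \<and> odd v}" by auto
  have "(\<Sum>v\<in>{1..2 * n}. single 1 (loop v) q) = (\<Sum>v | v \<in> {1..2 * n} \<and> even v. single 1 (loop v) q)
     + (\<Sum>v | v \<in> {1..2 * n} \<and> odd v. single 1 (loop v) q)"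
    by (subst split, rule sum.union_disjoint) auto
  then show "t_elem n q = (\<Sum>v\<in>{1..2 * n}. single 1 (loop v) q)"
    unfolding t_elem_def 1 2 by simp
qed

lemma loop_sum:
  assumes "finite S" "S \<subseteq> {1..2 * n}"
  shows "(\<lambda>q. \<Sum>v\<in>S. single 1 (loop v) q) \<in> carrier (path_alg \<Gamma>)"
    and "monoid.mult (path_alg \<Gamma>) (\<lambda>q. \<Sum>v\<in>S. single 1 (loop v) q) (single c p)
      = (if fst p \<in> S then single c (pcomp (loop (fst p)) p) else (\<lambda>_. 0))"
    and "monoid.mult (path_alg \<Gamma>) (single c p) (\<lambda>q. \<Sum>v\<in>S. single 1 (loop v) q)
      = (if pend \<Gamma> p \<in> S then single c (pcomp p (loop (pend \<Gamma> p))) else (\<lambda>_. 0))"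
  using assms
  by (induction rule: finite_induct)
    (auto simp: zero_carrier mult_add_left mult_add_right mult_single loop add_carrier single_carrier)

text \<open>Every loop has weight \<open>n\<close>. Attaching one in front of a path or behind it
  therefore gives the same start, end and weight, and such paths are congruent.\<close>

lemma t_central:
  assumes "f \<in> carrier (path_alg \<Gamma>)"
  shows "cls \<Gamma> (Gamma_rels n) (monoid.mult (path_alg \<Gamma>) (t_elem n) f)
     = cls \<Gamma> (Gamma_rels n) (monoid.mult (path_alg \<Gamma>) f (t_elem n))"
proof (rule G.central_cls[OF _ assms])
  show "t_elem n \<in> carrier (path_alg \<Gamma>)"
    unfolding t_elem_eq by (rule loop_sum) auto
  fix c p assume p: "is_path \<Gamma> p"
  have ends: "fst p \<in> {1..2 * n}" "pend \<Gamma> p \<in> {1..2 * n}"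
    using p G.pend_verts[OF p] by (auto simp: is_path_def)
  have "G.peq (pcomp (loop (fst p)) p) (pcomp p (loop (pend \<Gamma> p)))"
    using p ends by (intro faithful_Gamma is_path_pcomp) (simp_all add: loop)
  then show "\<exists>q q'. G.peq q q' \<and> monoid.mult (path_alg \<Gamma>) (t_elem n) (single c p) = single c q
      \<and> monoid.mult (path_alg \<Gamma>) (single c p) (t_elem n) = single c q'"
    unfolding t_elem_eq using loop_sum(2,3)[of "{1..2 * n}" c p] ends
    by (intro exI[of _ "pcomp (loop (fst p)) p"] exI[of _ "pcomp p (loop (pend \<Gamma> p))"]) simp
qed

end

section \<open>The boundary algebra\<close>

sublocale polygon_triangulation \<subseteq> gamma_quiver n
  by unfold_locales (rule n3)

context polygon_triangulation
begin

fun am :: "ga \<Rightarrow> qa list" where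
  "am (GX k) = [X k]"
| "am (GZ k) = rot (k div 2) 0 (lst (k div 2))"

lemma src_X_rd: "k \<in> {1..2 * n} \<Longrightarrow> src D (X k) = Bnd (rd n (int k - 1))"
proof -
  assume k: "k \<in> {1..2 * n}"
  show ?thesis
  proof (cases "k = 1")
    case True
    then have "rd n (int k - 1) = rd n (int (2 * n))" by (intro rd_eqI npos) simp
    then show ?thesis using True npos rd_id[of "2 * n" n] by (simp add: src_X)
  next
    case False
    then have "k - 1 \<in> {1..2 * n}" "int (k - 1) = int k - 1" using k by auto
    then show ?thesis using False rd_id[of "k - 1" n] by (simp add: src_X)
  qed
qed

lemma am_path:
  assumes "a \<in> arrs \<Gamma>"
  shows "is_path D (Bnd (src \<Gamma> a), am a)" "pend D (Bnd (src \<Gamma> a), am a) = Bnd (tgt \<Gamma> a)"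
proof -
  have "is_path D (Bnd (src \<Gamma> a), am a) \<and> pend D (Bnd (src \<Gamma> a), am a) = Bnd (tgt \<Gamma> a)"
  proof (cases a)
    case (GX k)
    then have k: "k \<in> {1..2 * n}" using assms by (simp add: GX_arrs)
    then show ?thesis
      using GX rd_range[OF npos, of "int k - 1"] src_X_rd[OF k]
      by (simp add: is_path_def pend_def X_arrs)
  next
    case (GZ k)
    then obtain j where j: "k = 2 * j" "j \<in> {1..n}" using assms by (auto simp: GZ_arrs elim!: evenE)
    have "2 * j - 1 \<in> {1..2 * n}" "int (2 * j - 1) - 1 = int k - 2" using j by auto
    then have "side n j (nb j ! lst j) = Bnd (rd n (int k - 2))"
      using side_nb_last[OF j(2)] src_X_rd[of "2 * j - 1"] by (simp only:)
    then show ?thesis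
      using GZ j is_path_rot[OF j(2), of 0 "lst j"] side_nb_first[OF j(2)] by simp
  qed
  then show "is_path D (Bnd (src \<Gamma> a), am a)" "pend D (Bnd (src \<Gamma> a), am a) = Bnd (tgt \<Gamma> a)"
    by auto
qed

lemma boundary_hom_QT: "boundary_hom \<Gamma> (Gamma_rels n) D (dimer_rels D) Bnd am"
proof (intro boundary_hom.intro boundary_hom_axioms.intro quiver_rels_Gamma quiver_rels_QT)
  show "inj_on Bnd (verts \<Gamma>)" by (simp add: inj_on_def)
  show "Bnd ` verts \<Gamma> \<subseteq> verts D" by auto
qed (use am_path in auto)

end

sublocale polygon_triangulation \<subseteq> H: boundary_hom "Gamma n" "Gamma_rels n" "QT n T" "dimer_rels (QT n T)" Bnd am wt
  by (rule boundary_hom_QT)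

section \<open>Images of the relations in the dimer algebra\<close>

context polygon_triangulation
begin

definition xQ :: "int \<Rightarrow> nat \<Rightarrow> qa list" where
  "xQ u m = map (\<lambda>l. X (rd n (u + 1 + int l))) [0..<m]"

lemma concat_am_xs: "concat (map am (xs u m)) = xQ u m"
  by (induction m) (simp_all add: xs_def xQ_def)

lemma pmap_xs: "H.pmap (v, xs u m) = (Bnd v, xQ u m)"
  by (simp add: H.pmap_def concat_am_xs)

lemma xQ_add: "xQ u (a + b) = xQ u a @ xQ (u + int a) b"
  using xs_add[of u a b] by (simp flip: concat_am_xs)

lemma rd_pv:
  assumes "j \<in> {1..n}" shows "d < n \<Longrightarrow> rd n (2 * int (pv j d) + k) = rd n (2 * int j + 2 * int d + k)"
proof -
  assume d: "d < n"
  have "int (pv j d) = int j + int d \<or> int (pv j d) = int j + int d - int n"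
    using assms d by (auto simp: pv_if of_nat_diff)
  then show ?thesis by (intro rd_eqI npos) auto
qed

lemma rd_off:
  assumes "j \<in> {1..n}" "c \<in> {1..n}"
  shows "rd n (2 * int c + k) = rd n (2 * int j + 2 * int (off j c) + k)"
  using rd_pv[OF assms(1) off_less[OF assms]] pv_off[OF assms] by metis

lemma xQ_off:
  assumes "j \<in> {1..n}" "c \<in> {1..n}"
  shows "xQ (2 * int c) m = xQ (2 * int j + 2 * int (off j c)) m"
  unfolding xQ_def using rd_off[OF assms] by (simp add: add.assoc)

text \<open>The boundary path stops at \<open>2c - 2\<close>, just before the polygon corner
  \<open>c\<close>, and two more arrows carry it past that corner. As \<open>j\<close> and
  \<open>c\<close> differ, the offset is at least 1 and the subtraction is genuine.\<close>

lemma XX_xQ: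
  assumes "j \<in> {1..n}" "c \<in> {1..n}" "j \<noteq> c"
  shows "xQ (2 * int j) (2 * (off j c - 1)) @ [X (2 * c - 1), X (2 * c)] = xQ (2 * int j) (2 * off j c)"
proof -
  let ?d = "off j c"
  have d: "1 \<le> ?d" using off_pos[OF assms] .
  have m: "2 * ?d = Suc (Suc (2 * (?d - 1)))" using d by simp
  have e: "2 * c \<in> {1..2 * n}" "2 * c - 1 \<in> {1..2 * n}" "int (2 * c - 1) = 2 * int c - 1" using assms(2) by auto
  have "rd n (2 * int j + 2 * int ?d) = 2 * c" "rd n (2 * int j + 2 * int ?d - 1) = 2 * c - 1"
    using rd_off[OF assms(1,2), of 0] rd_off[OF assms(1,2), of "- 1"] rd_id[OF e(1)] rd_id[OF e(2)] e(3) by simp_all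
  moreover have "2 * int j + 1 + int (2 * (?d - 1)) = 2 * int j + 2 * int ?d - 1"
    "2 * int j + 1 + int (Suc (2 * (?d - 1))) = 2 * int j + 2 * int ?d"
    using d by auto
  ultimately show ?thesis by (subst m) (simp add: xQ_def)
qed

lemma Bnd_rd_2: "j \<in> {1..n} \<Longrightarrow> rd n (2 * int j) = 2 * j"
  by (rule even_rd_2)

text \<open>The two arrows of the triangle \<open>b, c, a\<close> at \<open>b\<close> and \<open>a\<close> are traded for the rest of the white face
  at \<open>c\<close>, by the relation of the third arrow.\<close>

lemma peq_turn:
  assumes "b \<in> {1..n}" "c \<in> {1..n}"
    and b: "Suc i < length (nb b)" "nb b ! i = c" "nb b ! Suc i = a"
    and c: "Suc k < length (nb c)" "nb c ! k = a" "nb c ! Suc k = b"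
    and hyp: "D.peq (Bnd (2 * b), rot b 0 i @ rot c (Suc k) (lst c))
      (Bnd (2 * b), xQ (2 * int b) (2 * (off b c - 1)))"
  shows "D.peq (Bnd (2 * b), rot b 0 i @ [Ar b c a, Ar a b c]) (Bnd (2 * b), xQ (2 * int b) (2 * off b c) @ rot c 0 k)"
proof -
  have "b \<noteq> c" using nadj_range[OF nb_adj[of i b]] b by auto
  have tri: "tri_cyc b c a" using tri_cyc_nb[OF assms(1) b(1)] b by simp
  have l: "is_path D (Bnd (2 * b), rot b 0 i)" "pend D (Bnd (2 * b), rot b 0 i) = side n c b"
    using is_path_rot[OF assms(1), of 0 i] b side_nb_first[OF assms(1)] side_sym[OF assms(1,2)] by simp_all
  have white: "D.peq (side n c b, [Ar b c a, Ar a b c]) (side n c b, white_rest c k)"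
    using D.peq_sym[OF peq_white[OF assms(2) c]] .
  have path1: "is_path D (Bnd (2 * b), rot b 0 i @ [Ar b c a, Ar a b c])"
    using is_path_pcomp[OF l(1) D.peqD(1)[OF white]] l(2) by (simp add: pcomp_def)
  have 1: "D.peq (Bnd (2 * b), rot b 0 i @ [Ar b c a, Ar a b c]) (Bnd (2 * b), rot b 0 i @ white_rest c k)"
    using D.peq_context[OF white, of "Bnd (2 * b)" "rot b 0 i" "[]"] path1 l(2) by simp
  \<comment> \<open>The rest of the white face begins by finishing the rotation at \<open>c\<close>,
    so \<open>hyp\<close> turns the front part into a boundary path; the two boundary arrows at
    \<open>c\<close> then prolong it.\<close>
  have "D.peq (Bnd (2 * b), rot b 0 i @ white_rest c k)
     (Bnd (2 * b), (xQ (2 * int b) (2 * (off b c - 1)) @ [X (2 * c - 1), X (2 * c)]) @ rot c 0 k)"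
    using D.peq_context[OF hyp, of "Bnd (2 * b)" "[]" "[X (2 * c - 1), X (2 * c)] @ rot c 0 k"] D.peqD(2)[OF 1]
    by (simp add: white_rest_def)
  then show ?thesis unfolding XX_xQ[OF assms(1,2) \<open>b \<noteq> c\<close>] using 1 D.peq_trans by blast
qed

text \<open>Induction on the subpolygon cut off by \<open>ba\<close>, whose triangle at \<open>ba\<close> is \<open>b, c, a\<close>; the instance
  where \<open>ba\<close> is an edge of the polygon and the subpolygon is everything is the relation for \<open>zz\<close>.\<close>

lemma peq_rotations:
  assumes "b \<in> {1..n}" "i < length (nb b)" "nb b ! i = a" "k < length (nb a)" "nb a ! k = b"
  shows "D.peq (Bnd (2 * b), rot b 0 i @ rot a k (lst a)) (Bnd (2 * b), xQ (2 * int b) (2 * (off b a - 1)))"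
  using assms
proof (induction "off b a" arbitrary: a b i k rule: less_induct)
  case less
  have adj: "nadj b a" using nb_adj[OF less.prems(2)] less.prems(3) by simp
  have a: "a \<in> {1..n}" "a \<noteq> b" using nadj_range[OF adj] by auto
  have inv: "off b a + off a b = n" using less.prems(1) a by (auto simp: off_def)
  have offi: "off b a = offs b ! i" using off_nb[OF less.prems(1,2)] less.prems(3) by simp
  show ?case
  proof (cases i)
    \<comment> \<open>Here \<open>ba\<close> is the polygon edge leaving \<open>b\<close>: both
      rotations are empty, and so is the boundary path.\<close>
    case 0
    then have d: "off b a = 1" using offi offs_first less.prems(1) by simp
    then have "b = pv a (n - 1)" using inv pv_off[OF a(1) less.prems(1)] by (metis add_diff_cancel_left')
    then have "nb a ! k = nb a ! lst a" using nb_last[OF a(1)] less.prems(5) by simp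
    then have "k = lst a" using nb_inj[OF a(1) less.prems(4)] nb_length[OF a(1)] by simp
    then show ?thesis using 0 d less.prems(1) by (auto simp: xQ_def intro!: D.peq_refl)
  next
    case (Suc i')
    define c where "c = nb b ! i'"
    have i': "Suc i' < length (nb b)" "nb b ! i' = c" "nb b ! Suc i' = a"
      using less.prems(2,3) Suc by (auto simp: c_def)
    have bca: "tri_cyc b c a" using tri_cyc_nb[OF less.prems(1) i'(1)] i' by simp
    have c: "c \<in> {1..n}" using tri_cyc_range[OF tri_cyc_rotate[OF bca]] .
    obtain m where m: "Suc m < length (nb c)" "nb c ! m = a" "nb c ! Suc m = b"
      using nb_tri_cyc[OF tri_cyc_rotate[OF bca]] by blast
    obtain k' where k': "Suc k' < length (nb a)" "nb a ! k' = b" "nb a ! Suc k' = c"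
      using nb_tri_cyc[OF tri_cyc_rotate[OF tri_cyc_rotate[OF bca]]] by blast
    have k: "k' = k" using nb_inj[OF a(1), of k' k] k' less.prems(4,5) by simp
    have ne: "b \<noteq> c" "c \<noteq> a" using bca by (auto simp: tri_cyc_def cyc_def)
    \<comment> \<open>The apex \<open>c\<close> divides the arc from \<open>b\<close> to
      \<open>a\<close>, so \<open>bc\<close> and \<open>ca\<close> belong to strictly shorter arcs
      and the induction hypothesis applies to both.\<close>
    have sum: "off b a = off b c + off c a" using off_cyc_sum[OF bca] inv by simp
    have pos: "1 \<le> off b c" "1 \<le> off c a" using off_pos ne c a(1) less.prems(1) by auto
    have IH1: "D.peq (Bnd (2 * b), rot b 0 i' @ rot c (Suc m) (lst c)) (Bnd (2 * b), xQ (2 * int b) (2 * (off b c - 1)))"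
      using sum pos i' m less.prems(1) by (intro less.hyps) auto
    have IH2: "D.peq (Bnd (2 * c), rot c 0 m @ rot a (Suc k) (lst a)) (Bnd (2 * c), xQ (2 * int c) (2 * (off c a - 1)))"
      using sum pos m k' k c by (intro less.hyps) auto
    note turn = peq_turn[OF less.prems(1) c i' m IH1]
    have ra: "rot a k (lst a) = Ar a b c # rot a (Suc k) (lst a)"
      using k' k by (subst rot_Cons) auto
    \<comment> \<open>The last arrow around \<open>b\<close> and the first around \<open>a\<close>
      lie in the same triangle. Trading this pair at \<open>c\<close> leaves a rotation at
      \<open>c\<close> followed by one at \<open>a\<close>, which is the second instance of the
      hypothesis.\<close>
    have eq: "rot b 0 i @ rot a k (lst a) = [] @ (rot b 0 i' @ [Ar b c a, Ar a b c]) @ rot a (Suc k) (lst a)"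
      unfolding Suc ra using i' by (simp add: rot_Suc)
    have "is_path D (side n a b, rot a k (lst a))"
      using is_path_rot(1)[OF a(1), of k "lst a"] less.prems(4,5) by simp
    moreover have "is_path D (Bnd (2 * b), rot b 0 i)" "pend D (Bnd (2 * b), rot b 0 i) = side n a b"
      using is_path_rot[OF less.prems(1), of 0 i] less.prems(2,3) side_nb_first[OF less.prems(1)]
        side_sym[OF a(1) less.prems(1)] by simp_all
    ultimately have "is_path D (Bnd (2 * b), rot b 0 i @ rot a k (lst a))"
      using is_path_pcomp[of D "(Bnd (2 * b), rot b 0 i)" "(side n a b, rot a k (lst a))"] by (simp add: pcomp_def)
    then have 1: "D.peq (Bnd (2 * b), rot b 0 i @ rot a k (lst a))
        (Bnd (2 * b), xQ (2 * int b) (2 * off b c) @ (rot c 0 m @ rot a (Suc k) (lst a)) @ [])"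
      unfolding eq using D.peq_context[OF turn, of "Bnd (2 * b)" "[]" "rot a (Suc k) (lst a)"] by simp
    have pend: "pend D (Bnd (2 * b), xQ (2 * int b) (2 * off b c)) = Bnd (2 * c)"
      using H.is_path_pmap(2)[OF is_path_xs(1), of "2 * int b" "2 * off b c"] is_path_xs(2)[of "2 * int b" "2 * off b c"]
        rd_off[OF less.prems(1) c, of 0] Bnd_rd_2[OF less.prems(1)] Bnd_rd_2[OF c]
      by (simp add: pmap_xs)
    have 2: "D.peq (Bnd (2 * b), xQ (2 * int b) (2 * off b c) @ (rot c 0 m @ rot a (Suc k) (lst a)) @ [])
        (Bnd (2 * b), xQ (2 * int b) (2 * off b c) @ xQ (2 * int c) (2 * (off c a - 1)) @ [])"
      by (rule D.peq_context[OF IH2 D.peqD(2)[OF 1] pend])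
    have "xQ (2 * int b) (2 * off b c) @ xQ (2 * int c) (2 * (off c a - 1)) @ [] = xQ (2 * int b) (2 * (off b a - 1))"
    proof -
      have "2 * (off b a - 1) = 2 * off b c + 2 * (off c a - 1)" using sum pos by simp
      then show ?thesis using xQ_off[OF less.prems(1) c] by (simp add: xQ_add)
    qed
    then show ?thesis using D.peq_trans[OF 1 2] by simp
  qed
qed

lemma pred_succ:
  assumes "j \<in> {1..n}"
  shows "pv (j mod n + 1) (n - 1) = j" "pv j (n - 1) mod n + 1 = j"
proof -
  show "pv (j mod n + 1) (n - 1) = j"
    unfolding mod_succ_if[OF assms] using assms n3 by (auto simp: pv_if)
  have "pv j (n - 1) = (if j = 1 then n else j - 1)" using assms n3 by (auto simp: pv_if)
  then show "pv j (n - 1) mod n + 1 = j" using assms n3 mod_succ_if[of "j - 1"] by auto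
qed

text \<open>The triangle resting on the polygon edge \<open>ij\<close> contributes the first corner
  of the rotation at \<open>i\<close> and the last corner of the rotation at
  \<open>j\<close>.\<close>

lemma first_triangle:
  assumes "i \<in> {1..n}" "j = i mod n + 1"
  obtains c k where "1 < length (nb i)" "nb i ! 0 = j" "nb i ! 1 = c"
    "Suc k = lst j" "Suc k < length (nb j)" "nb j ! k = c" "nb j ! Suc k = i" "j \<in> {1..n}"
proof -
  have j: "j \<in> {1..n}" using assms n3 by (auto simp: Suc_leI)
  have i: "1 < length (nb i)" "nb i ! 0 = j" using nb_length[OF assms(1)] nb_first[OF assms(1)] assms(2) by auto
  have tri: "tri_cyc i j (nb i ! 1)" using tri_cyc_nb[OF assms(1), of 0] i by simp
  obtain k where k: "Suc k < length (nb j)" "nb j ! k = nb i ! 1" "nb j ! Suc k = i"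
    using nb_tri_cyc[OF tri_cyc_rotate[OF tri]] by blast
  have "pv j (n - 1) = i" using pred_succ(1)[OF assms(1)] assms(2) by simp
  then have "nb j ! Suc k = nb j ! lst j" using k(3) nb_last[OF j] by simp
  then have "Suc k = lst j" using nb_inj[OF j k(1)] nb_length[OF j] by simp
  then show ?thesis using that i k j by blast
qed

text \<open>Both images equal the boundary of the black face resting on the edge \<open>ij\<close>,
  read from the midpoint of that edge. The image of \<open>x x z\<close> becomes this cycle by the
  white relation at \<open>j\<close> for the last corner arrow, and the image of
  \<open>z x x\<close> by the white relation at \<open>i\<close> for the first one.\<close>

lemma rel1_mapped:
  assumes "i \<in> {1..n}"
  shows "D.peq (H.pmap (rd n (2 * int i), [GX (rd n (2 * int i + 1)), GX (rd n (2 * int i + 2)), GZ (rd n (2 * int i + 2))]))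
    (H.pmap (rd n (2 * int i), [GZ (rd n (2 * int i)), GX (rd n (2 * int i - 1)), GX (rd n (2 * int i))]))"
proof -
  define j where "j = i mod n + 1"
  obtain c k where i: "1 < length (nb i)" "nb i ! 0 = j" "nb i ! 1 = c"
    and k: "Suc k = lst j" "Suc k < length (nb j)" "nb j ! k = c" "nb j ! Suc k = i" and j: "j \<in> {1..n}"
    using first_triangle[OF assms j_def] by metis
  have jpv: "j = pv i 1" by (simp add: j_def pv_def)
  have rdj: "rd n (2 * int i + 2 + l) = rd n (2 * int j + l)" for l
    using rd_pv[OF assms, of 1 l] n3 jpv by simp
  have tri: "tri_cyc i j c" using tri_cyc_nb[OF assms, of 0] i by simp
  have jj: "2 * j \<in> {1..2 * n}" "2 * j - 1 \<in> {1..2 * n}" "int (2 * j - 1) = 2 * int j - 1" using j by auto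
  have ii: "2 * i - 1 \<in> {1..2 * n}" "int (2 * i - 1) = 2 * int i - 1" using assms by auto
  have "rd n (2 * int i + 1) = rd n (2 * int j - 1)" using rdj[of "- 1"] by (simp add: add.commute)
  then have rds: "rd n (2 * int i) = 2 * i" "rd n (2 * int i + 1) = 2 * j - 1" "rd n (2 * int i + 2) = 2 * j"
    "rd n (2 * int i - 1) = 2 * i - 1"
    using Bnd_rd_2[OF assms] rdj[of 0] rd_id[OF jj(1)] rd_id[OF jj(2)] rd_id[OF ii(1)] jj(3) ii(2)
    by simp_all
  have side: "side n j i = Bnd (2 * i)" "side n i j = Bnd (2 * i)"
    using side_nb_first[OF assms] i(2) side_sym[OF j assms] by simp_all
  have s: "Bnd (2 * i) \<in> verts D" using assms by auto
  have white_j: "D.peq (Bnd (2 * i), [X (2 * j - 1), X (2 * j)] @ rot j 0 k) (Bnd (2 * i), [Ar i j c, Ar c i j])"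
    using peq_white[OF j k(2,3,4)] k(1) by (simp add: white_rest_def side)
  have rotj: "rot j 0 (lst j) = rot j 0 k @ [Ar j c i]"
    unfolding k(1)[symmetric] using rot_Suc[of 0 k j] k(3,4) by simp
  have 1: "D.peq (Bnd (2 * i), [X (2 * j - 1), X (2 * j)] @ rot j 0 (lst j))
      (Bnd (2 * i), [Ar i j c, Ar c i j] @ [Ar j c i])"
  proof -
    have "is_path D (Bnd (2 * i), [X (2 * j - 1), X (2 * j)])"
      using is_path_XX[OF j] src_X_rd[OF jj(2)] jj(3) rdj[of "- 2"] rds(1) by simp
    moreover have "is_path D (Bnd (2 * j), rot j 0 (lst j))"
      using is_path_rot(1)[OF j, of 0 "lst j"] side_nb_first[OF j] by simp
    ultimately have "is_path D (Bnd (2 * i), [X (2 * j - 1), X (2 * j)] @ rot j 0 (lst j))"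
      using is_path_pcomp[of D "(Bnd (2 * i), [X (2 * j - 1), X (2 * j)])" "(Bnd (2 * j), rot j 0 (lst j))"]
      by (simp add: pcomp_def pend_def)
    then show ?thesis
      using D.peq_context[OF white_j, of "Bnd (2 * i)" "[]" "[Ar j c i]"] rotj by simp
  qed
  have white_i: "D.peq (side n i c, rot i 1 (lst i) @ [X (2 * i - 1), X (2 * i)]) (side n i c, [Ar c i j, Ar j c i])"
    using peq_white[OF assms, of 0 j c] i by (simp add: white_rest_def)
  have roti: "rot i 0 (lst i) = Ar i j c # rot i 1 (lst i)" using i by (subst rot_Cons) auto
  have "is_path D (Bnd (2 * i), [Ar i j c])" "pend D (Bnd (2 * i), [Ar i j c]) = side n i c"
    using tri s side side_sym[OF assms, of c] tri_cyc_range[OF tri_cyc_rotate[OF tri_cyc_rotate[OF tri]]]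
    by (simp_all add: is_path_def pend_def Ar_arrs del: QT_simps(1))
  then have 2: "D.peq (Bnd (2 * i), rot i 0 (lst i) @ [X (2 * i - 1), X (2 * i)])
      (Bnd (2 * i), [Ar i j c, Ar c i j] @ [Ar j c i])"
    unfolding roti using D.peq_pcomp_left[OF white_i, of "(Bnd (2 * i), [Ar i j c])"] by (simp add: pcomp_def)
  have "H.pmap (rd n (2 * int i), [GX (rd n (2 * int i + 1)), GX (rd n (2 * int i + 2)), GZ (rd n (2 * int i + 2))])
      = (Bnd (2 * i), [X (2 * j - 1), X (2 * j)] @ rot j 0 (lst j))"
    unfolding rds by (simp add: H.pmap_def)
  moreover have "H.pmap (rd n (2 * int i), [GZ (rd n (2 * int i)), GX (rd n (2 * int i - 1)), GX (rd n (2 * int i))])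
      = (Bnd (2 * i), rot i 0 (lst i) @ [X (2 * i - 1), X (2 * i)])"
    unfolding rds by (simp add: H.pmap_def)
  ultimately show ?thesis using D.peq_trans[OF 1 D.peq_sym[OF 2]] by simp
qed

text \<open>The case of \<open>peq_rotations\<close> with \<open>a\<close> the predecessor of
  \<open>b\<close>: the offset is \<open>n - 1\<close>, both rotations are full, and the boundary
  path has \<open>2(n - 2)\<close> arrows.\<close>

lemma rel2_mapped:
  assumes "i \<in> {1..n}"
  shows "D.peq (H.pmap (rd n (2 * int i), [GZ (rd n (2 * int i)), GZ (rd n (2 * int i - 2))]))
    (H.pmap (rd n (2 * int i), xs (2 * int i) (2 * n - 4)))"
proof -
  define h where "h = pv i (n - 1)"
  have h: "h \<in> {1..n}" unfolding h_def by (rule pv_range)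
  have hi: "h mod n + 1 = i" unfolding h_def by (rule pred_succ(2)[OF assms])
  have off: "off i h = n - 1" unfolding h_def using assms n3 by (intro off_pv) auto
  have "rd n (2 * int h) = rd n (2 * int i - 2)"
    using rd_pv[OF assms, of "n - 1" 0] n3 h_def by (simp add: rd_eq_iff npos mod_eq_dvd_iff of_nat_diff algebra_simps)
  then have rdh: "rd n (2 * int i - 2) = 2 * h" using Bnd_rd_2[OF h] by simp
  have "D.peq (Bnd (2 * i), rot i 0 (lst i) @ rot h 0 (lst h)) (Bnd (2 * i), xQ (2 * int i) (2 * (n - 1 - 1)))"
    unfolding off[symmetric]
  proof (rule peq_rotations[OF assms])
    show "lst i < length (nb i)" "0 < length (nb h)" using nb_length[OF assms] nb_length[OF h] by linarith+
    show "nb i ! lst i = h" unfolding h_def by (rule nb_last[OF assms])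
    show "nb h ! 0 = i" using nb_first[OF h] hi by simp
  qed
  moreover have "2 * (n - 1 - 1) = 2 * n - 4" using n3 by simp
  ultimately show ?thesis
    by (simp add: pmap_xs rdh Bnd_rd_2[OF assms]) (simp add: H.pmap_def)
qed

lemma rels_mapped:
  assumes "r \<in> Gamma_rels n"
  shows "push H.pmap r \<in> D.rel_ideal"
proof -
  have "push H.pmap (\<lambda>q. bpath p q - bpath p' q) \<in> D.rel_ideal" if "D.peq (H.pmap p) (H.pmap p')" for p p'
    unfolding single_diff using that
    by (simp add: push_add finite_supp_single D.peq_def)
  note mapped = this
  from assms show ?thesis
  proof (cases rule: Gamma_rels_cases)
    case (1 i)
    show ?thesis unfolding 1(2) by (rule mapped[OF rel1_mapped[OF 1(1)]])
  next
    case (2 i)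
    show ?thesis unfolding 2(2) by (rule mapped[OF rel2_mapped[OF 2(1)]])
  qed
qed

lemma wts_pmap:
  assumes "set as \<subseteq> arrs \<Gamma>"
  shows "wts (concat (map am as)) = gws as"
  using assms
proof (induction as)
  case (Cons a as)
  have "wts (am a) = gw a"
  proof (cases a)
    case (GZ k)
    then obtain j where "k = 2 * j" "j \<in> {1..n}" using Cons.prems by (auto simp: GZ_arrs elim!: evenE)
    then show ?thesis using GZ wts_full_rot by simp
  qed simp
  then show ?case using Cons by simp
qed simp

section \<open>Rewriting paths that start on the boundary\<close>

lemma side_eq_Bnd:
  assumes "a \<in> {1..n}" "i < length (nb a)" "side n a (nb a ! i) = Bnd k"
  shows "i = 0 \<or> i = lst a"
proof -
  let ?b = "nb a ! i"
  have b: "?b \<in> {1..n}" using nadj_range[OF nb_adj[OF assms(2)]] by simp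
  have "?b = a mod n + 1 \<or> a = ?b mod n + 1" using assms(3) by (auto simp: side_def split: if_splits)
  then show ?thesis
  proof
    assume "?b = a mod n + 1"
    then have "nb a ! i = nb a ! 0" using nb_first[OF assms(1)] by simp
    moreover have "0 < length (nb a)" using nb_length[OF assms(1)] by linarith
    ultimately show ?thesis using nb_inj[OF assms(1,2)] by blast
  next
    assume a: "a = ?b mod n + 1"
    have "pv a (n - 1) = ?b" using pred_succ(1)[OF b] a by metis
    then have "nb a ! i = nb a ! lst a" using nb_last[OF assms(1)] by simp
    then show ?thesis using nb_inj[OF assms(1,2), of "lst a"] nb_length[OF assms(1)] by simp
  qed
qed

lemma pcomp_Nil_right: "pcomp p (v, []) = p"
  by (simp add: pcomp_def)

definition reachable :: "nat \<Rightarrow> qa list \<Rightarrow> bool" where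
  "reachable k as \<longleftrightarrow> (\<exists>g. is_path \<Gamma> g \<and> D.peq (Bnd k, as) (H.pmap g))"

text \<open>The invariant for a path under construction, which may end at an interior vertex. It
  does not cover paths ending at odd boundary vertices, since no corner arrow meets those; they are
  the reason for keeping \<open>reachable\<close> as well.\<close>

definition reachable_rot :: "nat \<Rightarrow> qa list \<Rightarrow> nat \<Rightarrow> nat \<Rightarrow> bool" where
  "reachable_rot k as a i \<longleftrightarrow> a \<in> {1..n} \<and> i < length (nb a)
     \<and> (\<exists>g. is_path \<Gamma> g \<and> pend \<Gamma> g = 2 * a \<and> D.peq (Bnd k, as) (pcomp (H.pmap g) (Bnd (2 * a), rot a 0 i)))"

lemma reachable_rot_pend:
  assumes "reachable_rot k as a i" shows "pend D (Bnd k, as) = side n a (nb a ! i)"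
proof -
  obtain g where g: "is_path \<Gamma> g" "pend \<Gamma> g = 2 * a" "a \<in> {1..n}" "i < length (nb a)"
    "D.peq (Bnd k, as) (pcomp (H.pmap g) (Bnd (2 * a), rot a 0 i))"
    using assms unfolding reachable_rot_def by blast
  have "pend D (Bnd (2 * a), rot a 0 i) = side n a (nb a ! i)"
    using is_path_rot(2)[OF g(3), of 0 i] g(4) side_nb_first[OF g(3)] by simp
  then show ?thesis using D.peqD(4)[OF g(5)] H.is_path_pmap(2)[OF g(1)] g(2) by simp
qed

text \<open>A rotation meets the boundary only at its two extreme positions: there it is either
  empty or full, and a full one is the image of \<open>z\<close>.\<close>

lemma reachable_rot_Bnd:
  assumes "reachable_rot k as a i" "pend D (Bnd k, as) = Bnd l"
  shows "reachable k as"
proof -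
  obtain g where g: "is_path \<Gamma> g" "pend \<Gamma> g = 2 * a" "a \<in> {1..n}" "i < length (nb a)"
    "D.peq (Bnd k, as) (pcomp (H.pmap g) (Bnd (2 * a), rot a 0 i))"
    using assms(1) unfolding reachable_rot_def by blast
  have "i = 0 \<or> i = lst a"
    using side_eq_Bnd[OF g(3,4)] reachable_rot_pend[OF assms(1)] assms(2) by metis
  then show ?thesis
  proof
    assume "i = 0"
    then have "D.peq (Bnd k, as) (H.pmap g)" using g(5) by (simp add: pcomp_Nil_right)
    then show ?thesis using g(1) unfolding reachable_def by blast
  next
    assume i: "i = lst a"
    let ?g = "pcomp g (2 * a, [GZ (2 * a)])"
    have "is_path \<Gamma> ?g"
      using g(1-3) by (intro is_path_pcomp) (auto simp: is_path_def GZ_arrs)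
    moreover have "H.pmap ?g = pcomp (H.pmap g) (Bnd (2 * a), rot a 0 i)"
      unfolding i by (simp add: H.pmap_def pcomp_def)
    ultimately show ?thesis using g(5) unfolding reachable_def by metis
  qed
qed

text \<open>A side of a triangle that is a boundary vertex is the midpoint of a polygon edge, hence
  an even vertex \<open>2s\<close>, where the empty rotation at \<open>s\<close> can be
  attached.\<close>

lemma reachable_Bnd_rot:
  assumes "reachable k as" "pend D (Bnd k, as) = side n a b" "nadj a b"
  shows "\<exists>c i. reachable_rot k as c i"
proof -
  obtain g where g: "is_path \<Gamma> g" "D.peq (Bnd k, as) (H.pmap g)"
    using assms(1) unfolding reachable_def by blast
  have "side n a b = Bnd (pend \<Gamma> g)"
    using D.peqD(4)[OF g(2)] H.is_path_pmap(2)[OF g(1)] assms(2) by simp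
  then have "\<exists>s. side n a b = Bnd (2 * s) \<and> {a, b} = {s, s mod n + 1}"
    by (cases a b rule: side_cases) (blast, simp)
  then obtain s where s: "pend \<Gamma> g = 2 * s" "{a, b} = {s, s mod n + 1}"
    using \<open>side n a b = Bnd (pend \<Gamma> g)\<close> by auto
  then have "s \<in> {1..n}" using nadj_range[OF assms(3)] by (auto simp: doubleton_eq_iff)
  then have "0 < length (nb s)" using nb_length[of s] by linarith
  moreover have "D.peq (Bnd k, as) (pcomp (H.pmap g) (Bnd (2 * s), rot s 0 0))"
    using g(2) by (simp add: pcomp_Nil_right)
  ultimately have "reachable_rot k as s 0"
    unfolding reachable_rot_def using g(1) s(1) \<open>s \<in> {1..n}\<close> by blast
  then show ?thesis by blast
qed

text \<open>The next arrow sits at one end of the side reached. At the centre \<open>a\<close> it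
  prolongs the rotation. At the other end it lies in the same triangle as the last arrow of the
  rotation, and turning at the third corner \<open>d\<close> yields a longer boundary path and a
  rotation at \<open>d\<close>.\<close>

lemma reachable_rot_arrow:
  assumes r: "reachable_rot k as a i" and path: "is_path D (Bnd k, as @ [Ar b c d])"
  shows "\<exists>e j. reachable_rot k (as @ [Ar b c d]) e j"
proof -
  obtain g where g: "is_path \<Gamma> g" "pend \<Gamma> g = 2 * a" "a \<in> {1..n}" "i < length (nb a)"
    and peq: "D.peq (Bnd k, as) (pcomp (H.pmap g) (Bnd (2 * a), rot a 0 i))"
    using r unfolding reachable_rot_def by blast
  have tri: "tri_cyc b c d" and src: "side n b c = side n a (nb a ! i)"
    using path reachable_rot_pend[OF r] by (simp_all add: is_path_append Ar_arrs)
  have step: "D.peq (Bnd k, as @ [Ar b c d]) (pcomp (H.pmap g) (Bnd (2 * a), rot a 0 i @ [Ar b c d]))"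
  proof -
    have "is_path D (side n b c, [Ar b c d])" using tri side_verts[of b c]
      by (auto simp: is_path_def Ar_arrs tri_cyc_def simp del: QT_simps(1))
    then have "D.peq (pcomp (Bnd k, as) (side n b c, [Ar b c d]))
       (pcomp (pcomp (H.pmap g) (Bnd (2 * a), rot a 0 i)) (side n b c, [Ar b c d]))"
      using peq reachable_rot_pend[OF r] src by (intro D.peq_pcomp_right) simp_all
    then show ?thesis by (simp add: pcomp_def)
  qed
  consider "b = a" "c = nb a ! i" | "b = nb a ! i" "c = a"
    using side_inj[OF src] by auto
  then show ?thesis
  proof cases
    case 1
    obtain j where j: "Suc j < length (nb b)" "nb b ! j = c" "nb b ! Suc j = d" using nb_tri_cyc[OF tri] by blast
    then have "j = i" using nb_inj[OF g(3), of j i] 1 g(4) by simp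
    then have "D.peq (Bnd k, as @ [Ar b c d]) (pcomp (H.pmap g) (Bnd (2 * a), rot a 0 (Suc i)))"
      "Suc i < length (nb a)"
      using j 1 step by (simp_all add: rot_Suc)
    then have "reachable_rot k (as @ [Ar b c d]) a (Suc i)"
      unfolding reachable_rot_def using g by blast
    then show ?thesis by blast
  next
    case 2
    have d: "d \<in> {1..n}" using tri_cyc_range[OF tri_cyc_rotate[OF tri_cyc_rotate[OF tri]]] .
    have "d \<noteq> a" using tri 2 by (auto simp: tri_cyc_def cyc_def)
    obtain j where j: "Suc j < length (nb c)" "nb c ! j = d" "nb c ! Suc j = b"
      using nb_tri_cyc[OF tri_cyc_rotate[OF tri]] by blast
    obtain m where m: "Suc m < length (nb d)" "nb d ! m = b" "nb d ! Suc m = c"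
      using nb_tri_cyc[OF tri_cyc_rotate[OF tri_cyc_rotate[OF tri]]] by blast
    \<comment> \<open>In particular the rotation is not empty: its last arrow is
      \<open>Ar a d b\<close>, which \<open>peq_turn\<close> can trade together with the new
      arrow.\<close>
    have i: "i = Suc j" using nb_inj[OF g(3,4), of "Suc j"] j 2 by simp
    have ja: "Suc j < length (nb a)" "nb a ! j = d" "nb a ! Suc j = b" and ma: "nb d ! Suc m = a"
      using j m 2 by simp_all
    have "D.peq (Bnd (2 * a), rot a 0 j @ [Ar a d b, Ar b a d]) (Bnd (2 * a), xQ (2 * int a) (2 * off a d) @ rot d 0 m)"
    proof (rule peq_turn[OF g(3) d ja m(1,2) ma])
      show "D.peq (Bnd (2 * a), rot a 0 j @ rot d (Suc m) (lst d)) (Bnd (2 * a), xQ (2 * int a) (2 * (off a d - 1)))"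
        by (rule peq_rotations[OF g(3) Suc_lessD[OF ja(1)] ja(2) m(1) ma])
    qed
    then have turn: "D.peq (Bnd (2 * a), rot a 0 i @ [Ar b c d]) (Bnd (2 * a), xQ (2 * int a) (2 * off a d) @ rot d 0 m)"
      unfolding i 2(2) using ja(2,3) by (simp add: rot_Suc)
    let ?x = "(2 * a, xs (2 * int a) (2 * off a d))"
    have rds: "rd n (2 * int a) = 2 * a" "rd n (2 * int a + int (2 * off a d)) = 2 * d"
      using Bnd_rd_2[OF g(3)] Bnd_rd_2[OF d] rd_off[OF g(3) d, of 0] by simp_all
    have x: "is_path \<Gamma> ?x" "pend \<Gamma> ?x = 2 * d"
      using is_path_xs[of "2 * int a" "2 * off a d"] unfolding rds by auto
    have gx: "is_path \<Gamma> (pcomp g ?x)" "pend \<Gamma> (pcomp g ?x) = 2 * d"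
      using g x by (auto intro: is_path_pcomp)
    have "D.peq (pcomp (H.pmap g) (Bnd (2 * a), rot a 0 i @ [Ar b c d]))
        (pcomp (H.pmap g) (Bnd (2 * a), xQ (2 * int a) (2 * off a d) @ rot d 0 m))"
      using turn H.is_path_pmap[OF g(1)] g(2) by (intro D.peq_pcomp_left) simp_all
    moreover have "pcomp (H.pmap g) (Bnd (2 * a), xQ (2 * int a) (2 * off a d) @ rot d 0 m)
        = pcomp (H.pmap (pcomp g ?x)) (Bnd (2 * d), rot d 0 m)"
      by (simp add: H.pmap_pcomp pmap_xs) (simp add: pcomp_def)
    ultimately have "D.peq (Bnd k, as @ [Ar b c d]) (pcomp (H.pmap (pcomp g ?x)) (Bnd (2 * d), rot d 0 m))"
      using D.peq_trans[OF step] by simp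
    then have "reachable_rot k (as @ [Ar b c d]) d m"
      unfolding reachable_rot_def using gx d Suc_lessD[OF m(1)] by blast
    then show ?thesis by blast
  qed
qed

text \<open>A boundary arrow can be appended only when the path has returned to the boundary, a
  corner arrow only to a rotation. The preceding conversions between the two forms supply whichever
  is required.\<close>

lemma reachable_path:
  assumes "is_path D (Bnd k, as)" "k \<in> {1..2 * n}"
  shows "reachable k as \<or> (\<exists>a i. reachable_rot k as a i)"
  using assms(1)
proof (induction as rule: rev_induct)
  case Nil
  have "is_path \<Gamma> (k, [])" using assms(2) by (simp add: is_path_def)
  moreover have "H.pmap (k, []) = (Bnd k, [])" by (simp add: H.pmap_def)
  ultimately have "reachable k []"
    using D.peq_refl[OF Nil] unfolding reachable_def by metis
  then show ?case by blast
next
  case (snoc x as)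
  have as: "is_path D (Bnd k, as)" and x: "x \<in> arrs D" "src D x = pend D (Bnd k, as)"
    using snoc.prems by (auto simp: is_path_append)
  show ?case
  proof (cases x)
    case (X l)
    then have l: "l \<in> {1..2 * n}" using x by (simp add: X_arrs)
    have pend: "pend D (Bnd k, as) = Bnd (rd n (int l - 1))" using x X src_X_rd[OF l] by simp
    then have "reachable k as" using snoc.IH[OF as] reachable_rot_Bnd by blast
    then obtain g where g: "is_path \<Gamma> g" "D.peq (Bnd k, as) (H.pmap g)" unfolding reachable_def by blast
    then have pg: "pend \<Gamma> g = rd n (int l - 1)"
      using pend D.peqD(4)[OF g(2)] H.is_path_pmap(2)[OF g(1)] by simp
    let ?x = "(rd n (int l - 1), [GX l])"
    have px: "is_path \<Gamma> ?x" using l rd_verts[of "int l - 1"] by (simp add: is_path_def GX_arrs)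
    have "D.peq (pcomp (Bnd k, as) (H.pmap ?x)) (pcomp (H.pmap g) (H.pmap ?x))"
      using g pend H.is_path_pmap(1)[OF px] by (intro D.peq_pcomp_right) simp_all
    then have "D.peq (Bnd k, as @ [x]) (H.pmap (pcomp g ?x))"
      by (simp add: H.pmap_pcomp X) (simp add: pcomp_def H.pmap_def)
    moreover have "is_path \<Gamma> (pcomp g ?x)" using g px pg by (intro is_path_pcomp) simp_all
    ultimately show ?thesis unfolding reachable_def by blast
  next
    case (Ar a b c)
    then have "nadj a b" using x by (simp add: Ar_arrs tri_cyc_def)
    then have "\<exists>a i. reachable_rot k as a i"
      using snoc.IH[OF as] reachable_Bnd_rot[of k as a b] x(2) Ar by auto
    then show ?thesis using reachable_rot_arrow snoc.prems Ar by blast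
  qed
qed

lemma boundary_iso_QT: "boundary_iso \<Gamma> (Gamma_rels n) D (dimer_rels D) Bnd am wt"
proof (intro boundary_iso.intro boundary_hom_QT boundary_iso_axioms.intro)
  show "push H.pmap r \<in> D.rel_ideal" if "r \<in> Gamma_rels n" for r
    using rels_mapped[OF that] .
  show "push (D.path_data wt) s = (\<lambda>_. 0)" if "s \<in> dimer_rels D" for s
    using rels_homogeneous[OF that] .
  show "G.peq p q" if "is_path \<Gamma> p" "is_path \<Gamma> q" "fst p = fst q" "pend \<Gamma> p = pend \<Gamma> q"
    "wts (snd (H.pmap p)) = wts (snd (H.pmap q))" for p q
    using that by (intro faithful_Gamma) (simp_all add: H.pmap_def wts_pmap is_path_def)
  show "\<exists>g. is_path \<Gamma> g \<and> D.peq x (H.pmap g)"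
    if x: "is_path D x" "fst x \<in> Bnd ` verts \<Gamma>" "pend D x \<in> Bnd ` verts \<Gamma>" for x
  proof -
    obtain k as where k: "x = (Bnd k, as)" "k \<in> {1..2 * n}" using x(2) by (cases x) auto
    then have "reachable k as"
      using reachable_path[of k as] x reachable_rot_Bnd[of k as] by auto
    then show ?thesis unfolding reachable_def k .
  qed
qed

end

sublocale polygon_triangulation \<subseteq> I: boundary_iso "Gamma n" "Gamma_rels n" "QT n T" "dimer_rels (QT n T)" Bnd am wt
  by (rule boundary_iso_QT)

section \<open>Transport to the boundary algebra\<close>

context polygon_triangulation
begin

lemma e_b_QT: "e_b D = cls D (dimer_rels D) (D.idem (Bnd ` verts \<Gamma>))"
proof -
  have "(\<lambda>p. if snd p = [] \<and> fst p \<in> bverts D then 1 else 0) = D.idem (Bnd ` verts \<Gamma>)"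
    by (rule ext) (simp only: D.idem_def bverts_QT Gamma_simps)
  then show ?thesis by (simp only: e_b_def dcls_def)
qed

lemma bdry_alg_QT: "bdry_alg D = I.target"
  by (simp only: bdry_alg_def dimer_alg_def e_b_QT)

lemma boundary_algebra_iso:
  "\<exists>\<phi>. \<phi> \<in> ring_iso (quot_alg \<Gamma> (Gamma_rels n)) (bdry_alg D)
     \<and> (\<forall>c. \<phi> (cls \<Gamma> (Gamma_rels n) (pscal \<Gamma> c)) = dcls D (pscal D c) \<otimes>\<^bsub>dimer_alg D\<^esub> e_b D)
     \<and> (\<forall>k\<in>{1..2 * n}. \<phi> (cls \<Gamma> (Gamma_rels n) (arel \<Gamma> [GX k])) = dcls D (arel D [X k]))
     \<and> (\<forall>b\<in>carrier (bdry_alg D).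
            \<phi> (cls \<Gamma> (Gamma_rels n) (t_elem n)) \<otimes>\<^bsub>bdry_alg D\<^esub> b
          = b \<otimes>\<^bsub>bdry_alg D\<^esub> \<phi> (cls \<Gamma> (Gamma_rels n) (t_elem n)))"
proof -
  obtain \<phi> where iso: "\<phi> \<in> ring_iso (quot_alg \<Gamma> (Gamma_rels n)) (bdry_alg D)"
    and \<phi>: "\<And>f. f \<in> carrier (path_alg \<Gamma>) \<Longrightarrow> \<phi> (cls \<Gamma> (Gamma_rels n) f) = cls D (dimer_rels D) (push H.pmap f)"
    using I.corner_iso unfolding bdry_alg_QT by blast
  have scalars: "\<phi> (cls \<Gamma> (Gamma_rels n) (pscal \<Gamma> c)) = dcls D (pscal D c) \<otimes>\<^bsub>dimer_alg D\<^esub> e_b D" for c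
  proof -
    let ?B = "Bnd ` verts \<Gamma>"
    have G: "pscal \<Gamma> c = (\<lambda>p. c * G.idem (verts \<Gamma>) p)" and D: "pscal D c = (\<lambda>p. c * D.idem (verts D) p)"
      unfolding pscal_def G.one_eq_idem D.one_eq_idem by simp_all
    have carr: "(\<lambda>p. c * G.idem (verts \<Gamma>) p) \<in> carrier (path_alg \<Gamma>)"
      "(\<lambda>p. c * D.idem (verts D) p) \<in> carrier (path_alg D)"
      using G.idem_carrier[OF order_refl] D.idem_carrier[OF order_refl]
      by (auto simp: carrier_path_alg intro: rev_finite_subset)
    have "\<phi> (cls \<Gamma> (Gamma_rels n) (pscal \<Gamma> c)) = cls D (dimer_rels D) (\<lambda>p. c * D.idem ?B p)"
      unfolding G \<phi>[OF carr(1)] H.push_pmap_scaled_idem[OF order_refl] ..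
    \<comment> \<open>In the corner the scalar \<open>c\<close> is \<open>c\<close> times the
      boundary idempotent. Writing it as a product with a scalar of the dimer algebra expresses
      complex linearity of the ring isomorphism.\<close>
    also have "(\<lambda>p. c * D.idem ?B p) = monoid.mult (path_alg D) (\<lambda>p. c * D.idem (verts D) p) (D.idem ?B)"
      unfolding D.mult_scaled_idem D.one_mult[OF D.idem_carrier[OF H.vm_verts]] ..
    also have "cls D (dimer_rels D) \<dots> = dcls D (pscal D c) \<otimes>\<^bsub>dimer_alg D\<^esub> e_b D"
      unfolding ring_hom_mult[OF D.cls_hom carr(2) D.idem_carrier[OF H.vm_verts]]
      by (simp only: dcls_def D e_b_QT dimer_alg_def)
    finally show ?thesis .
  qed
  have arrows: "\<phi> (cls \<Gamma> (Gamma_rels n) (arel \<Gamma> [GX k])) = dcls D (arel D [X k])" if k: "k \<in> {1..2 * n}" for k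
  proof -
    have path: "is_path \<Gamma> (rd n (int k - 1), [GX k])"
      using k rd_verts[of "int k - 1"] by (simp add: is_path_def GX_arrs)
    have "arel \<Gamma> [GX k] = single 1 (rd n (int k - 1), [GX k])"
      by (simp add: arel_def bpath_eq_single)
    moreover have "arel D [X k] = single 1 (H.pmap (rd n (int k - 1), [GX k]))"
      using src_X_rd[OF k] by (simp add: arel_def bpath_eq_single H.pmap_def)
    ultimately show ?thesis using \<phi>[OF single_carrier[OF path]] by (simp add: dcls_def)
  qed
  have central: "\<phi> (cls \<Gamma> (Gamma_rels n) (t_elem n)) \<otimes>\<^bsub>bdry_alg D\<^esub> b
      = b \<otimes>\<^bsub>bdry_alg D\<^esub> \<phi> (cls \<Gamma> (Gamma_rels n) (t_elem n))" if b: "b \<in> carrier (bdry_alg D)" for b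
  proof -
    note hom = ring_iso_memE(2)[OF iso]
    have "b \<in> \<phi> ` carrier (quot_alg \<Gamma> (Gamma_rels n))"
      using ring_iso_memE(5)[OF iso] b by (simp add: bij_betw_def)
    then obtain f where f: "f \<in> carrier (path_alg \<Gamma>)" "b = \<phi> (cls \<Gamma> (Gamma_rels n) f)"
      unfolding G.carrier_quot_alg by blast
    have t: "t_elem n \<in> carrier (path_alg \<Gamma>)"
      unfolding t_elem_eq by (rule loop_sum) auto
    have mem: "cls \<Gamma> (Gamma_rels n) (t_elem n) \<in> carrier (quot_alg \<Gamma> (Gamma_rels n))"
      "cls \<Gamma> (Gamma_rels n) f \<in> carrier (quot_alg \<Gamma> (Gamma_rels n))"
      using t f(1) unfolding G.carrier_quot_alg by blast+
    show ?thesis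
      unfolding f(2) hom[OF mem, symmetric] hom[OF mem(2,1), symmetric]
        ring_hom_mult[OF G.cls_hom t f(1), symmetric] ring_hom_mult[OF G.cls_hom f(1) t, symmetric]
        t_central[OF f(1)] ..
  qed
  show ?thesis using iso scalars arrows central by blast
qed

end

theorem theorem3p1:
  fixes n :: nat and T :: "nat set set"
  assumes "n \<ge> 3" and "triangulation n T"
  shows "\<exists>\<phi>. \<phi> \<in> ring_iso (quot_alg (Gamma n) (Gamma_rels n)) (bdry_alg (QT n T))
     \<and> (\<forall>c. \<phi> (cls (Gamma n) (Gamma_rels n) (pscal (Gamma n) c))
            = dcls (QT n T) (pscal (QT n T) c) \<otimes>\<^bsub>dimer_alg (QT n T)\<^esub> e_b (QT n T))
     \<and> (\<forall>k\<in>{1..2 * n}. \<phi> (cls (Gamma n) (Gamma_rels n) (arel (Gamma n) [GX k]))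
            = dcls (QT n T) (arel (QT n T) [X k]))
     \<and> (\<forall>b\<in>carrier (bdry_alg (QT n T)).
            \<phi> (cls (Gamma n) (Gamma_rels n) (t_elem n)) \<otimes>\<^bsub>bdry_alg (QT n T)\<^esub> b
          = b \<otimes>\<^bsub>bdry_alg (QT n T)\<^esub> \<phi> (cls (Gamma n) (Gamma_rels n) (t_elem n)))"
  by (rule polygon_triangulation.boundary_algebra_iso[OF polygon_triangulation.intro[OF assms]])

end
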